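(* Let $(X,p_0)$ be a pointed tropical curve and let $\mu$ be a degree-$d$ polarization on $X$. For every divisor $\mathcal D$ on $X$ of degree $d$ there exists a unique degree-$d$ divisor on $X$ which is equivalent to $\mathcal D$ and $(p_0,\mu)$-quasistable.
   Context: A metric graph is a pair $(\Gamma,\ell)$ with $\Gamma$ a finite connected graph (loops and multiple edges allowed) and $\ell\colon E(\Gamma)\to\mathbb R_{>0}$. The associated tropical curve $X$ is the metric space obtained by gluing intervals $[0,\ell(e)]$, $e\in E(\Gamma)$, at their endpoints according to the incidences of $\Gamma$. A graph $\Gamma$ is a model of $X$ if $X$ is isometric to the tropical curve of $(\Gamma,\ell)$ for some $\ell$. Tropical curves are connected. A pointed tropical curve $(X,p_0)$ is a tropical curve with a chosen point $p_0\in X$. A tropical subcurve $Y\subset X$ is a subset induced by a (possibly disconnected) subgraph $\Gamma_Y$ of some model $\Gamma_{X,Y}$ of $X$, i.e. the union of the vertices and closed edges of $\Gamma_Y$ (isolated points are allowed). For such $Y$, $\delta_Y=\delta_{X,Y}:=\sum_{v\in V(\Gamma_Y)}\mathrm{val}_{E(\Gamma_{X,Y})\setminus E(\Gamma_Y)}(v)$, where $\mathrm{val}_{\mathcal E}(v)$ is the number of edges in $\mathcal E$ incident to $v$ (loops counted twice); this is independent of the model. A divisor on $X$ is a function $\mathcal D\colon X\to\mathbb Z$ with finite support; $\deg\mathcal D=\sum_{p}\mathcal D(p)$, and $\deg(\mathcal D|_Y)=\sum_{p\in Y}\mathcal D(p)$. A rational function on $X$ is a continuous piecewise linear function $f\colon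 X\to\mathbb R$ with integer slopes; $\mathrm{div}(f)=\sum_p \mathrm{ord}_p(f)\,p$, where $\mathrm{ord}_p(f)$ is the sum of the incoming slopes of $f$ at $p$. Two divisors are equivalent if their difference is $\mathrm{div}(f)$ for some rational function $f$. A degree-$d$ polarization on $X$ ($d$ an integer) is a function $\mu\colon X\to\mathbb R$ with $\mu(p)=0$ for all but finitely many $p$ and $\sum_p\mu(p)=d$; set $\mu(Y)=\sum_{p\in Y}\mu(p)$. For a degree-$d$ divisor $\mathcal D$ and a tropical subcurve $Y$ set $\beta_{\mathcal D}(Y):=\deg(\mathcal D|_Y)-\mu(Y)+\delta_Y/2$. The divisor $\mathcal D$ is $(p_0,\mu)$-quasistable if $\beta_{\mathcal D}(Y)\ge 0$ for every tropical subcurve $Y\subset X$, and $\beta_{\mathcal D}(Y)>0$ for every proper tropical subcurve $Y\subsetneq X$ with $p_0\in Y$. *)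

theory Defs
  imports "HOL-Analysis.Analysis" "Graph_Theory.Digraph_Component"
begin

section \<open>Metric graphs and their tropical curves\<close>

text \<open>
  A finite multigraph with loops is represented by a finite digraph \<open>\<Gamma>\<close> in which every edge carries
  an arbitrary orientation; this only serves to parametrise the edge \<open>e\<close> by \<open>[0, len e]\<close>, from its
  tail to its head. Connectedness is that of the underlying undirected graph (and includes
  \<open>verts \<Gamma> \<noteq> {}\<close>).
\<close>

definition metric_graph :: "('v, 'e) pre_digraph \<Rightarrow> ('e \<Rightarrow> real) \<Rightarrow> bool" where
  "metric_graph \<Gamma> len \<longleftrightarrow>
     fin_digraph \<Gamma> \<and> Digraph_Component.connected \<Gamma> \<and> (\<forall>e\<in>arcs \<Gamma>. 0 < len e)"

datatype ('v, 'e) point = Vertex 'v | Inner 'e real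

text \<open>
  The image of the parameter \<open>t \<in> [0, len e]\<close> of the edge \<open>e\<close> under the gluing: the end points of the
  interval are identified with the vertices at the two ends of \<open>e\<close>, and nothing else is identified.
\<close>

definition glue :: "('v, 'e) pre_digraph \<Rightarrow> ('e \<Rightarrow> real) \<Rightarrow> 'e \<Rightarrow> real \<Rightarrow> ('v, 'e) point" where
  "glue \<Gamma> len e t =
     (if t = 0 then Vertex (tail \<Gamma> e) else if t = len e then Vertex (head \<Gamma> e) else Inner e t)"

definition graph_points :: "('v, 'e) pre_digraph \<Rightarrow> ('e \<Rightarrow> real) \<Rightarrow> ('v, 'e) point set" where
  "graph_points \<Gamma> len = Vertex ` verts \<Gamma> \<union> (\<Union>e\<in>arcs \<Gamma>. glue \<Gamma> len e ` {0..len e})"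

text \<open>
  The gluing metric: the infimum of the lengths of the finite chains of edge segments joining two
  points, where the segment \<open>(e, s, t)\<close> runs from parameter \<open>s\<close> to parameter \<open>t\<close> of the edge \<open>e\<close>.
\<close>

primrec seg_chain ::
  "('v, 'e) pre_digraph \<Rightarrow> ('e \<Rightarrow> real) \<Rightarrow> ('v, 'e) point \<Rightarrow> ('e \<times> real \<times> real) list \<Rightarrow> ('v, 'e) point \<Rightarrow> bool"
where
  "seg_chain \<Gamma> len x [] y \<longleftrightarrow> x = y"
| "seg_chain \<Gamma> len x (c # cs) y \<longleftrightarrow>
     (case c of (e, s, t) \<Rightarrow>
        e \<in> arcs \<Gamma> \<and> s \<in> {0..len e} \<and> t \<in> {0..len e} \<and>
        glue \<Gamma> len e s = x \<and> seg_chain \<Gamma> len (glue \<Gamma> len e t) cs y)"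

definition chain_length :: "('e \<times> real \<times> real) list \<Rightarrow> real" where
  "chain_length cs = (\<Sum>(e, s, t)\<leftarrow>cs. \<bar>s - t\<bar>)"

text \<open>
  Outside of the carrier the value is a dummy \<open>0\<close>, because \<^locale>\<open>Metric_space\<close> requires
  symmetry and non-negativity for all arguments.
\<close>

definition glue_dist ::
  "('v, 'e) pre_digraph \<Rightarrow> ('e \<Rightarrow> real) \<Rightarrow> ('v, 'e) point \<Rightarrow> ('v, 'e) point \<Rightarrow> real" where
  "glue_dist \<Gamma> len x y =
     (if x \<in> graph_points \<Gamma> len \<and> y \<in> graph_points \<Gamma> len
      then Inf (chain_length ` {cs. seg_chain \<Gamma> len x cs y}) else 0)"

definition glued_curve :: "('v, 'e) pre_digraph \<Rightarrow> ('e \<Rightarrow> real) \<Rightarrow> ('v, 'e) point metric" where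
  "glued_curve \<Gamma> len = metric (graph_points \<Gamma> len, glue_dist \<Gamma> len)"


subsection \<open>The gluing metric is a metric\<close>

lemma chain_length_simps [simp]:
  "chain_length [] = 0"
  "chain_length ((e, s, t) # cs) = \<bar>s - t\<bar> + chain_length cs"
  by (simp_all add: chain_length_def)

lemma chain_length_append [simp]: "chain_length (cs @ ds) = chain_length cs + chain_length ds"
  by (simp add: chain_length_def)

lemma chain_length_nonneg: "0 \<le> chain_length cs"
  by (induction cs) auto

lemma seg_chain_append:
  "seg_chain \<Gamma> len x cs y \<Longrightarrow> seg_chain \<Gamma> len y ds z \<Longrightarrow> seg_chain \<Gamma> len x (cs @ ds) z"
  by (induction cs arbitrary: x) auto

lemma seg_chain_rev:
  "seg_chain \<Gamma> len x cs y \<Longrightarrow>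
     \<exists>ds. seg_chain \<Gamma> len y ds x \<and> chain_length ds = chain_length cs"
proof (induction cs arbitrary: x)
  case Nil
  then show ?case by (intro exI[of _ "[]"]) simp
next
  case (Cons c cs)
  obtain e s t where c: "c = (e, s, t)" by (cases c) auto
  from Cons.prems c have h: "e \<in> arcs \<Gamma>" "s \<in> {0..len e}" "t \<in> {0..len e}" "glue \<Gamma> len e s = x"
    "seg_chain \<Gamma> len (glue \<Gamma> len e t) cs y" by auto
  from Cons.IH[OF h(5)] obtain ds where ds: "seg_chain \<Gamma> len y ds (glue \<Gamma> len e t)"
    "chain_length ds = chain_length cs" by blast
  have "seg_chain \<Gamma> len (glue \<Gamma> len e t) [(e, t, s)] x" using h by simp
  from seg_chain_append[OF ds(1) this] show ?case
    using ds(2) c by (intro exI[of _ "ds @ [(e, t, s)]"]) (simp add: abs_minus_commute)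
qed

lemma seg_chain_lipschitz:
  assumes lip: "\<And>e s t. e \<in> arcs \<Gamma> \<Longrightarrow> s \<in> {0..len e} \<Longrightarrow> t \<in> {0..len e} \<Longrightarrow>
      \<bar>f (glue \<Gamma> len e s) - f (glue \<Gamma> len e t)\<bar> \<le> \<bar>s - t\<bar>"
    and "seg_chain \<Gamma> len x cs y"
  shows "\<bar>f x - f y\<bar> \<le> chain_length cs"
  using assms(2)
proof (induction cs arbitrary: x)
  case Nil
  then show ?case by simp
next
  case (Cons c cs)
  obtain e s t where c: "c = (e, s, t)" by (cases c) auto
  from Cons.prems c have h: "e \<in> arcs \<Gamma>" "s \<in> {0..len e}" "t \<in> {0..len e}" "glue \<Gamma> len e s = x"
    "seg_chain \<Gamma> len (glue \<Gamma> len e t) cs y" by auto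
  show ?case using lip[OF h(1-3)] Cons.IH[OF h(5)] h(4) c by auto
qed

lemma seg_chain_to_vertex:
  assumes "fin_digraph \<Gamma>" "\<forall>e\<in>arcs \<Gamma>. 0 < len e" "x \<in> graph_points \<Gamma> len"
  shows "\<exists>v cs. v \<in> verts \<Gamma> \<and> seg_chain \<Gamma> len x cs (Vertex v)"
proof -
  interpret fin_digraph \<Gamma> by fact
  from assms(3) consider v where "v \<in> verts \<Gamma>" "x = Vertex v"
    | e t where "e \<in> arcs \<Gamma>" "t \<in> {0..len e}" "x = glue \<Gamma> len e t"
    unfolding graph_points_def by blast
  then show ?thesis
  proof cases
    case 1
    then show ?thesis by (intro exI[of _ v] exI[of _ "[]"]) simp
  next
    case 2
    have "seg_chain \<Gamma> len x [(e, t, 0)] (Vertex (tail \<Gamma> e))"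
      using 2 assms(2) by (simp add: glue_def less_imp_le)
    then show ?thesis using 2 by (meson tail_in_verts)
  qed
qed

lemma seg_chain_vertices:
  assumes mg: "metric_graph \<Gamma> len" and uv: "u \<in> verts \<Gamma>" "v \<in> verts \<Gamma>"
  shows "\<exists>cs. seg_chain \<Gamma> len (Vertex u) cs (Vertex v)"
proof -
  have pos: "\<forall>e\<in>arcs \<Gamma>. 0 < len e" using mg by (simp add: metric_graph_def)
  have "u \<rightarrow>\<^sup>*\<^bsub>with_proj (mk_symmetric \<Gamma>)\<^esub> v"
    using mg uv by (auto simp: metric_graph_def Digraph_Component.connected_def strongly_connected_def)
  then have "(u, v) \<in> rtrancl_on (verts \<Gamma>) (arcs_ends (with_proj (mk_symmetric \<Gamma>)))"
    by (simp add: reachable_def)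
  then show ?thesis
  proof (induction rule: rtrancl_on.induct)
    case (rtrancl_on_refl a)
    then show ?case by (intro exI[of _ "[]"]) simp
  next
    case (rtrancl_on_into_rtrancl_on a b c)
    then obtain cs where cs: "seg_chain \<Gamma> len (Vertex a) cs (Vertex b)" by blast
    have "(b, c) \<in> parcs (mk_symmetric \<Gamma>)"
      using rtrancl_on_into_rtrancl_on by simp
    then obtain e where e: "e \<in> arcs \<Gamma>"
      "(b = tail \<Gamma> e \<and> c = head \<Gamma> e) \<or> (b = head \<Gamma> e \<and> c = tail \<Gamma> e)"
      unfolding parcs_mk_symmetric by auto
    have l: "0 < len e" using pos e by blast
    have "seg_chain \<Gamma> len (Vertex b) [(e, 0, len e)] (Vertex c) \<or>
      seg_chain \<Gamma> len (Vertex b) [(e, len e, 0)] (Vertex c)"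
      using e l by (auto simp: glue_def)
    then show ?case using seg_chain_append[OF cs] by blast
  qed
qed

lemma seg_chain_exists:
  assumes mg: "metric_graph \<Gamma> len" and xy: "x \<in> graph_points \<Gamma> len" "y \<in> graph_points \<Gamma> len"
  shows "\<exists>cs. seg_chain \<Gamma> len x cs y"
proof -
  have h: "fin_digraph \<Gamma>" "\<forall>e\<in>arcs \<Gamma>. 0 < len e" using mg by (auto simp: metric_graph_def)
  obtain u cs where 1: "u \<in> verts \<Gamma>" "seg_chain \<Gamma> len x cs (Vertex u)"
    using seg_chain_to_vertex[OF h xy(1)] by blast
  obtain v ds where 2: "v \<in> verts \<Gamma>" "seg_chain \<Gamma> len y ds (Vertex v)"
    using seg_chain_to_vertex[OF h xy(2)] by blast
  obtain es where 3: "seg_chain \<Gamma> len (Vertex u) es (Vertex v)"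
    using seg_chain_vertices[OF mg 1(1) 2(1)] by blast
  obtain ds' where 4: "seg_chain \<Gamma> len (Vertex v) ds' y"
    using seg_chain_rev[OF 2(2)] by blast
  show ?thesis using seg_chain_append[OF 1(2) seg_chain_append[OF 3 4]] by blast
qed

lemma glue_dist_le:
  assumes "x \<in> graph_points \<Gamma> len" "y \<in> graph_points \<Gamma> len" "seg_chain \<Gamma> len x cs y"
  shows "glue_dist \<Gamma> len x y \<le> chain_length cs"
proof -
  have "bdd_below (chain_length ` {cs. seg_chain \<Gamma> len x cs y})"
    by (rule bdd_belowI2[of _ 0]) (simp add: chain_length_nonneg)
  then show ?thesis using assms by (auto simp: glue_dist_def intro!: cInf_lower)
qed

lemma glue_dist_ge:
  assumes "metric_graph \<Gamma> len" "x \<in> graph_points \<Gamma> len" "y \<in> graph_points \<Gamma> len"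
    and "\<And>cs. seg_chain \<Gamma> len x cs y \<Longrightarrow> r \<le> chain_length cs"
  shows "r \<le> glue_dist \<Gamma> len x y"
  using assms seg_chain_exists[OF assms(1-3)]
  by (auto simp: glue_dist_def intro!: cInf_greatest)

lemma glue_dist_commute:
  assumes "metric_graph \<Gamma> len"
  shows "glue_dist \<Gamma> len x y = glue_dist \<Gamma> len y x"
proof -
  have "glue_dist \<Gamma> len x y \<le> glue_dist \<Gamma> len y x"
    if "x \<in> graph_points \<Gamma> len" "y \<in> graph_points \<Gamma> len" for x y
  proof (rule glue_dist_ge[OF assms that(2,1)])
    fix cs assume "seg_chain \<Gamma> len y cs x"
    then obtain ds where "seg_chain \<Gamma> len x ds y" "chain_length ds = chain_length cs"
      using seg_chain_rev by blast
    then show "glue_dist \<Gamma> len x y \<le> chain_length cs" using glue_dist_le[OF that] by metis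
  qed
  then show ?thesis by (cases "x \<in> graph_points \<Gamma> len \<and> y \<in> graph_points \<Gamma> len")
      (auto simp: glue_dist_def intro: order_antisym)
qed

lemma glue_dist_triangle:
  assumes mg: "metric_graph \<Gamma> len"
    and x: "x \<in> graph_points \<Gamma> len" and y: "y \<in> graph_points \<Gamma> len" and z: "z \<in> graph_points \<Gamma> len"
  shows "glue_dist \<Gamma> len x z \<le> glue_dist \<Gamma> len x y + glue_dist \<Gamma> len y z"
proof -
  have "glue_dist \<Gamma> len x z - glue_dist \<Gamma> len y z \<le> glue_dist \<Gamma> len x y"
  proof (rule glue_dist_ge[OF mg x y])
    fix cs assume cs: "seg_chain \<Gamma> len x cs y"
    have "glue_dist \<Gamma> len x z - chain_length cs \<le> glue_dist \<Gamma> len y z"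
    proof (rule glue_dist_ge[OF mg y z])
      fix ds assume "seg_chain \<Gamma> len y ds z"
      from glue_dist_le[OF x z seg_chain_append[OF cs this]]
      show "glue_dist \<Gamma> len x z - chain_length cs \<le> chain_length ds" by simp
    qed
    then show "glue_dist \<Gamma> len x z - glue_dist \<Gamma> len y z \<le> chain_length cs" by simp
  qed
  then show ?thesis by simp
qed

lemma glue_dist_pos_of_lipschitz:
  assumes "metric_graph \<Gamma> len" "x \<in> graph_points \<Gamma> len" "y \<in> graph_points \<Gamma> len"
    and "\<And>e s t. e \<in> arcs \<Gamma> \<Longrightarrow> s \<in> {0..len e} \<Longrightarrow> t \<in> {0..len e} \<Longrightarrow>
      \<bar>f (glue \<Gamma> len e s) - f (glue \<Gamma> len e t)\<bar> \<le> \<bar>s - t\<bar>"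
    and "f x \<noteq> (f y :: real)"
  shows "0 < glue_dist \<Gamma> len x y"
proof -
  have "\<bar>f x - f y\<bar> \<le> glue_dist \<Gamma> len x y"
    by (rule glue_dist_ge[OF assms(1-3)], rule seg_chain_lipschitz[where f = f and \<Gamma> = \<Gamma> and len = len])
      (use assms(4) in auto)
  then show ?thesis using assms(5) by auto
qed

lemma glue_dist_pos_Inner:
  fixes \<Gamma> :: "('v, 'e) pre_digraph"
  assumes mg: "metric_graph \<Gamma> len"
    and x: "x \<in> graph_points \<Gamma> len" and y: "y \<in> graph_points \<Gamma> len"
    and xI: "x = Inner e0 t0" and ne: "x \<noteq> y"
  shows "0 < glue_dist \<Gamma> len x y"
proof -
  from x xI have t0: "e0 \<in> arcs \<Gamma>" "0 < t0" "t0 < len e0"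
    unfolding graph_points_def by (auto simp: glue_def split: if_splits)
  define r where "r = Min {t0, len e0 - t0, (case y of Inner e t \<Rightarrow> if t = t0 then 1 else \<bar>t - t0\<bar> | _ \<Rightarrow> 1)}"
  have r: "0 < r" "r \<le> t0" "r \<le> len e0 - t0"
    using t0 by (auto simp: r_def split: point.splits)
  have ry: "r \<le> \<bar>t - t0\<bar>" if "y = Inner e0 t" for t
    using that ne xI by (auto simp: r_def)
  define f :: "('v, 'e) point \<Rightarrow> real"
    where "f = (\<lambda>z. case z of Inner e t \<Rightarrow> if e = e0 then max 0 (r - \<bar>t - t0\<bar>) else 0 | _ \<Rightarrow> 0)"
  have fg: "f (glue \<Gamma> len e s) = (if e = e0 then max 0 (r - \<bar>s - t0\<bar>) else 0)"
    if "s \<in> {0..len e}" for e s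
    using that r by (auto simp: f_def glue_def)
  show ?thesis
  proof (rule glue_dist_pos_of_lipschitz[OF mg x y, where f = f])
    show "f x \<noteq> f y" using r ry xI by (auto simp: f_def split: point.splits)
  next
    fix e s t assume "s \<in> {0..len e}" "t \<in> {0..len e}"
    then show "\<bar>f (glue \<Gamma> len e s) - f (glue \<Gamma> len e t)\<bar> \<le> \<bar>s - t\<bar>"
      by (auto simp: fg max_def)
  qed
qed

lemma glue_dist_pos_Vertex:
  assumes mg: "metric_graph \<Gamma> len"
    and x: "x \<in> graph_points \<Gamma> len" and y: "y \<in> graph_points \<Gamma> len"
    and xy: "x = Vertex v" "y = Vertex w" and ne: "v \<noteq> w"
  shows "0 < glue_dist \<Gamma> len x y"
proof -
  have fin: "finite (arcs \<Gamma>)" and pos: "\<forall>e\<in>arcs \<Gamma>. 0 < len e"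
    using mg fin_digraph.finite_arcs by (auto simp: metric_graph_def)
  define r where "r = Min (insert 1 (len ` arcs \<Gamma>))"
  have r: "0 < r" "\<And>e. e \<in> arcs \<Gamma> \<Longrightarrow> r \<le> len e"
    using fin pos by (auto simp: r_def)
  define g where "g = (\<lambda>e t. max 0 (max (if tail \<Gamma> e = v then r - t else 0)
      (if head \<Gamma> e = v then r - (len e - t) else 0)))"
  define f where "f = (\<lambda>z. case z of Inner e t \<Rightarrow> g e t | Vertex u \<Rightarrow> if u = v then r else 0)"
  have fg: "f (glue \<Gamma> len e s) = g e s" if "e \<in> arcs \<Gamma>" "s \<in> {0..len e}" for e s
    using that r(1) r(2)[OF that(1)] pos by (auto simp: f_def g_def glue_def)
  show ?thesis
  proof (rule glue_dist_pos_of_lipschitz[OF mg x y, where f = f])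
    show "f x \<noteq> f y" using r ne xy by (auto simp: f_def)
  next
    fix e s t assume "e \<in> arcs \<Gamma>" "s \<in> {0..len e}" "t \<in> {0..len e}"
    then show "\<bar>f (glue \<Gamma> len e s) - f (glue \<Gamma> len e t)\<bar> \<le> \<bar>s - t\<bar>"
      by (auto simp: fg g_def max_def)
  qed
qed

lemma Metric_space_glue_dist:
  assumes mg: "metric_graph \<Gamma> len"
  shows "Metric_space (graph_points \<Gamma> len) (glue_dist \<Gamma> len)"
proof
  show "0 \<le> glue_dist \<Gamma> len x y" for x y
    using glue_dist_ge[OF mg] chain_length_nonneg
    by (cases "x \<in> graph_points \<Gamma> len \<and> y \<in> graph_points \<Gamma> len") (blast, auto simp: glue_dist_def)
  then have nonneg: "0 \<le> glue_dist \<Gamma> len x y" for x y .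
  show "glue_dist \<Gamma> len x y = glue_dist \<Gamma> len y x" for x y
    by (rule glue_dist_commute[OF mg])
  show "glue_dist \<Gamma> len x y = 0 \<longleftrightarrow> x = y"
    if x: "x \<in> graph_points \<Gamma> len" and y: "y \<in> graph_points \<Gamma> len" for x y
  proof
    assume "x = y"
    then have "glue_dist \<Gamma> len x y \<le> 0" using glue_dist_le[OF x y, of "[]"] by simp
    then show "glue_dist \<Gamma> len x y = 0" using nonneg by (rule order_antisym)
  next
    assume 0: "glue_dist \<Gamma> len x y = 0"
    show "x = y"
    proof (rule ccontr)
      assume ne: "x \<noteq> y"
      have "0 < glue_dist \<Gamma> len x y"
        using ne glue_dist_pos_Inner[OF mg x y] glue_dist_pos_Inner[OF mg y x]
          glue_dist_pos_Vertex[OF mg x y] glue_dist_commute[OF mg, of x y]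
        by (metis point.exhaust)
      then show False using 0 by simp
    qed
  qed
  show "glue_dist \<Gamma> len x z \<le> glue_dist \<Gamma> len x y + glue_dist \<Gamma> len y z"
    if "x \<in> graph_points \<Gamma> len" "y \<in> graph_points \<Gamma> len" "z \<in> graph_points \<Gamma> len" for x y z
    using glue_dist_triangle[OF mg that] .
qed

lemma mspace_glued_curve [simp]:
  "metric_graph \<Gamma> len \<Longrightarrow> mspace (glued_curve \<Gamma> len) = graph_points \<Gamma> len"
  unfolding glued_curve_def by (rule Metric_space.mspace_metric[OF Metric_space_glue_dist])

lemma mdist_glued_curve [simp]:
  "metric_graph \<Gamma> len \<Longrightarrow> mdist (glued_curve \<Gamma> len) = glue_dist \<Gamma> len"
  unfolding glued_curve_def by (rule Metric_space.mdist_metric[OF Metric_space_glue_dist])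


section \<open>Tropical curves, models and subcurves\<close>

definition isometry :: "'a metric \<Rightarrow> 'b metric \<Rightarrow> ('a \<Rightarrow> 'b) \<Rightarrow> bool" where
  "isometry M N \<phi> \<longleftrightarrow>
     \<phi> ` mspace M = mspace N \<and>
     (\<forall>x\<in>mspace M. \<forall>y\<in>mspace M. mdist N (\<phi> x) (\<phi> y) = mdist M x y)"

text \<open>
  Since every finite graph is isomorphic to one with natural numbers as vertices and edges,
  it suffices to consider models of this kind.
\<close>

definition model ::
  "'a metric \<Rightarrow> (nat, nat) pre_digraph \<Rightarrow> (nat \<Rightarrow> real) \<Rightarrow> ((nat, nat) point \<Rightarrow> 'a) \<Rightarrow> bool" where
  "model X \<Gamma> len \<phi> \<longleftrightarrow> metric_graph \<Gamma> len \<and> isometry (glued_curve \<Gamma> len) X \<phi>"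

definition tropical_curve :: "'a metric \<Rightarrow> bool" where
  "tropical_curve X \<longleftrightarrow> (\<exists>\<Gamma> len \<phi>. model X \<Gamma> len \<phi>)"

definition induces ::
  "'a metric \<Rightarrow> (nat, nat) pre_digraph \<Rightarrow> (nat, nat) pre_digraph \<Rightarrow> 'a set \<Rightarrow> bool" where
  "induces X \<Gamma> \<Delta> Y \<longleftrightarrow>
     (\<exists>len \<phi>. model X \<Gamma> len \<phi> \<and> subgraph \<Delta> \<Gamma> \<and> Y = \<phi> ` graph_points \<Delta> len)"

definition subcurve :: "'a metric \<Rightarrow> 'a set \<Rightarrow> bool" where
  "subcurve X Y \<longleftrightarrow> (\<exists>\<Gamma> \<Delta>. induces X \<Gamma> \<Delta> Y)"

text \<open>The number of edges in \<open>E\<close> incident to \<open>v\<close>; a loop is counted once as incoming and once as outgoing.\<close>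

definition valence :: "('v, 'e) pre_digraph \<Rightarrow> 'e set \<Rightarrow> 'v \<Rightarrow> nat" where
  "valence \<Gamma> E v = card (in_arcs \<Gamma> v \<inter> E) + card (out_arcs \<Gamma> v \<inter> E)"

text \<open>The value does not depend on the model and the subgraph inducing \<open>Y\<close>.\<close>

definition delta :: "'a metric \<Rightarrow> 'a set \<Rightarrow> nat" where
  "delta X Y =
     (THE n. \<exists>\<Gamma> \<Delta>. induces X \<Gamma> \<Delta> Y \<and> n = (\<Sum>v\<in>verts \<Delta>. valence \<Gamma> (arcs \<Gamma> - arcs \<Delta>) v))"


section \<open>Divisors and rational functions\<close>

text \<open>
  Divisors and polarizations are functions on the whole type that vanish outside of the curve.
\<close>

definition fin_supp_on :: "'a set \<Rightarrow> ('a \<Rightarrow> 'b::zero) \<Rightarrow> bool" where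
  "fin_supp_on S f \<longleftrightarrow> finite {p. f p \<noteq> 0} \<and> {p. f p \<noteq> 0} \<subseteq> S"

definition total_on_set :: "('a \<Rightarrow> 'b::comm_monoid_add) \<Rightarrow> 'a set \<Rightarrow> 'b" where
  "total_on_set f Y = (\<Sum>p | p \<in> Y \<and> f p \<noteq> 0. f p)"

definition divisor :: "'a metric \<Rightarrow> ('a \<Rightarrow> int) \<Rightarrow> bool" where
  "divisor X D \<longleftrightarrow> fin_supp_on (mspace X) D"

definition degree_on :: "('a \<Rightarrow> int) \<Rightarrow> 'a set \<Rightarrow> int" where
  "degree_on D Y = total_on_set D Y"

definition degree_div :: "'a metric \<Rightarrow> ('a \<Rightarrow> int) \<Rightarrow> int" where
  "degree_div X D = degree_on D (mspace X)"

definition linear_on_edges ::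
  "(nat, nat) pre_digraph \<Rightarrow> (nat \<Rightarrow> real) \<Rightarrow> ((nat, nat) point \<Rightarrow> 'a) \<Rightarrow> ('a \<Rightarrow> real) \<Rightarrow> (nat \<Rightarrow> int) \<Rightarrow> bool"
where
  "linear_on_edges \<Gamma> len \<phi> f a \<longleftrightarrow>
     (\<forall>e\<in>arcs \<Gamma>. \<forall>t\<in>{0..len e}.
        f (\<phi> (glue \<Gamma> len e t)) = f (\<phi> (glue \<Gamma> len e 0)) + of_int (a e) * t)"

text \<open>Piecewise linear means linear on each edge of some model.\<close>

definition rational_function :: "'a metric \<Rightarrow> ('a \<Rightarrow> real) \<Rightarrow> bool" where
  "rational_function X f \<longleftrightarrow>
     continuous_map (mtopology_of X) euclideanreal f \<and>
     (\<exists>\<Gamma> len \<phi> a. model X \<Gamma> len \<phi> \<and> linear_on_edges \<Gamma> len \<phi> f a)"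

text \<open>
  The order of \<open>f\<close> at \<open>p\<close>, computed in any model that has \<open>p\<close> as a vertex and on whose edges \<open>f\<close> is
  linear; the value does not depend on the model. The slope of \<open>f\<close> along \<open>e\<close> in the direction of the
  head of \<open>e\<close> is \<open>a e\<close>, hence the incoming slope at the tail of \<open>e\<close> is \<open>- a e\<close>.
\<close>

definition ord_at :: "'a metric \<Rightarrow> ('a \<Rightarrow> real) \<Rightarrow> 'a \<Rightarrow> int" where
  "ord_at X f p =
     (THE k. \<exists>\<Gamma> len \<phi> a v.
        model X \<Gamma> len \<phi> \<and> linear_on_edges \<Gamma> len \<phi> f a \<and> v \<in> verts \<Gamma> \<and> \<phi> (Vertex v) = p \<and>
        k = (\<Sum>e\<in>in_arcs \<Gamma> v. a e) + (\<Sum>e\<in>out_arcs \<Gamma> v. - a e))"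

definition div_of :: "'a metric \<Rightarrow> ('a \<Rightarrow> real) \<Rightarrow> 'a \<Rightarrow> int" where
  "div_of X f p = (if p \<in> mspace X then ord_at X f p else 0)"

definition equivalent :: "'a metric \<Rightarrow> ('a \<Rightarrow> int) \<Rightarrow> ('a \<Rightarrow> int) \<Rightarrow> bool" where
  "equivalent X D D' \<longleftrightarrow> (\<exists>f. rational_function X f \<and> (\<forall>p. D p - D' p = div_of X f p))"


section \<open>Polarizations and quasistability\<close>

definition polarization :: "'a metric \<Rightarrow> int \<Rightarrow> ('a \<Rightarrow> real) \<Rightarrow> bool" where
  "polarization X d \<mu> \<longleftrightarrow> fin_supp_on (mspace X) \<mu> \<and> total_on_set \<mu> (mspace X) = of_int d"

definition beta :: "'a metric \<Rightarrow> ('a \<Rightarrow> real) \<Rightarrow> ('a \<Rightarrow> int) \<Rightarrow> 'a set \<Rightarrow> real" where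
  "beta X \<mu> D Y = of_int (degree_on D Y) - total_on_set \<mu> Y + of_nat (delta X Y) / 2"

definition quasistable :: "'a metric \<Rightarrow> 'a \<Rightarrow> ('a \<Rightarrow> real) \<Rightarrow> ('a \<Rightarrow> int) \<Rightarrow> bool" where
  "quasistable X p0 \<mu> D \<longleftrightarrow>
     (\<forall>Y. subcurve X Y \<longrightarrow> 0 \<le> beta X \<mu> D Y) \<and>
     (\<forall>Y. subcurve X Y \<and> Y \<noteq> mspace X \<and> p0 \<in> Y \<longrightarrow> 0 < beta X \<mu> D Y)"

end

theory Submission
  imports Defs
begin

text \<open>
  Uniqueness: if two quasistable divisors differ by \<open>div f\<close> with \<open>f\<close> not constant, let \<open>Y\<close> be spanned by
  the vertices where \<open>f\<close> is maximal and \<open>Z\<close> by the remaining ones. Then \<open>div f\<close> has degree at least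
  \<open>\<delta>\<^sub>Y\<close> on \<open>Y\<close>, while \<open>\<beta>(Y) + \<beta>(Z) = \<delta>\<^sub>Y\<close> for each of the divisors; as \<open>p\<^sub>0\<close> lies in \<open>Y\<close> or in \<open>Z\<close>,
  strictness is violated.

  Existence: in a model whose vertices carry \<open>D\<close>, \<open>\<mu>\<close> and \<open>p\<^sub>0\<close>, minimise
  \<open>1/2 \<integral> f'\<^sup>2 + \<Sum>\<^sub>v (D - \<mu>)(v) f(v)\<close> over the functions with integer slopes. For given vertex values the
  integral is least when on each edge only the two integers next to the average slope occur, so this is a
  finite-dimensional convex problem, coercive because the graph is connected. The derivative of the energy
  in the direction of the indicator function of a vertex set \<open>W\<close> is a lower bound of \<open>\<beta>\<close>, for the divisor
  \<open>D + div f\<close>, on the subcurves with vertex set \<open>W\<close>. Strictness at \<open>p\<^sub>0\<close> is obtained by perturbing \<open>\<mu>\<close>.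
\<close>

section \<open>Metric geometry of a glued graph\<close>

text \<open>The term \<delta>/2 comes out of the integrality of the slopes. The chords of the square
  function over consecutive integers have slopes \<open>2 * n + 1\<close>, so half of the
  interpolated square has one-sided derivatives n + 1/2: raising a function slightly on a vertex set
  costs an integer plus one half for every edge of the cut, and these halves add up to \<delta>/2.
  The obstacle is that subcurves, \<delta> and orders are defined by quantifying over all models up
  to isometry, whereas the energy lives on a single model. Models can be compared only through the
  metric: small spheres recover \<delta> and orders, and an edge of a model that contains the
  vertices of another one runs along a single edge of the latter at unit speed. Moreover, a subcurve
  may begin and end inside the edges of the chosen model; its boundary is then estimated from below
  edge by edge (\<open>exits\<close>) while the model stays fixed. The perturbation of \<mu> does
  not harm the weak inequalities because the bounds in question lie in finitely many translates of
  the half-integers, which leaves a gap below 0.\<close>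

locale mgraph =
  fixes \<Gamma> :: "('v, 'e) pre_digraph" and len :: "'e \<Rightarrow> real"
  assumes metric_graph: "metric_graph \<Gamma> len"
begin

abbreviation "points \<equiv> graph_points \<Gamma> len"
abbreviation "gl \<equiv> glue \<Gamma> len"
abbreviation "gd \<equiv> glue_dist \<Gamma> len"

sublocale fin_digraph \<Gamma>
  using metric_graph by (simp add: metric_graph_def)

sublocale MS: Metric_space points gd
  by (rule Metric_space_glue_dist[OF metric_graph])

lemma len_pos: "e \<in> arcs \<Gamma> \<Longrightarrow> 0 < len e"
  using metric_graph by (simp add: metric_graph_def)

lemma gl_0 [simp]: "gl e 0 = Vertex (tail \<Gamma> e)"
  by (simp add: glue_def)

lemma gl_len: "e \<in> arcs \<Gamma> \<Longrightarrow> gl e (len e) = Vertex (head \<Gamma> e)"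
  using len_pos[of e] by (simp add: glue_def)

lemma gl_inner: "0 < t \<Longrightarrow> t < len e \<Longrightarrow> gl e t = Inner e t"
  by (simp add: glue_def)

lemma gl_in_points: "e \<in> arcs \<Gamma> \<Longrightarrow> t \<in> {0..len e} \<Longrightarrow> gl e t \<in> points"
  unfolding graph_points_def by blast

lemma inner_in_points: "e \<in> arcs \<Gamma> \<Longrightarrow> 0 < t \<Longrightarrow> t < len e \<Longrightarrow> Inner e t \<in> points"
  using gl_in_points[of e t] by (simp add: gl_inner)

lemma vertex_in_points_iff [simp]: "Vertex v \<in> points \<longleftrightarrow> v \<in> verts \<Gamma>"
  by (auto simp: graph_points_def glue_def split: if_splits)

lemma inner_in_points_iff [simp]: "Inner e t \<in> points \<longleftrightarrow> e \<in> arcs \<Gamma> \<and> 0 < t \<and> t < len e"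
proof
  assume "Inner e t \<in> points"
  then show "e \<in> arcs \<Gamma> \<and> 0 < t \<and> t < len e"
    by (auto simp: graph_points_def glue_def split: if_splits)
qed (simp add: inner_in_points)

lemma points_cases [consumes 1, case_names vertex inner]:
  assumes "x \<in> points"
  obtains v where "v \<in> verts \<Gamma>" "x = Vertex v"
  | e t where "e \<in> arcs \<Gamma>" "0 < t" "t < len e" "x = Inner e t" "x = gl e t"
  using assms by (cases x) (auto simp: gl_inner)

lemma gl_eq_inner: "0 < t \<Longrightarrow> t < len e \<Longrightarrow> e' \<in> arcs \<Gamma> \<Longrightarrow> s \<in> {0..len e'} \<Longrightarrow>
    gl e' s = gl e t \<longleftrightarrow> e' = e \<and> s = t"
  by (auto simp: glue_def)

text \<open>The distance is an infimum over chains, so a lower bound needs a certificate: a test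
  function that is 1-Lipschitz on every edge.\<close>

lemma dist_ge_lipschitz:
  assumes "x \<in> points" "y \<in> points"
    and "\<And>e s t. e \<in> arcs \<Gamma> \<Longrightarrow> s \<in> {0..len e} \<Longrightarrow> t \<in> {0..len e} \<Longrightarrow> \<bar>f (gl e s) - f (gl e t)\<bar> \<le> \<bar>s - t\<bar>"
  shows "\<bar>f x - f y\<bar> \<le> gd x y"
  by (rule glue_dist_ge[OF metric_graph assms(1,2)], rule seg_chain_lipschitz[where f = f and \<Gamma> = \<Gamma> and len = len])
    (use assms(3) in auto)

lemma dist_le_edge:
  assumes "e \<in> arcs \<Gamma>" "s \<in> {0..len e}" "t \<in> {0..len e}"
  shows "gd (gl e s) (gl e t) \<le> \<bar>s - t\<bar>"
  using glue_dist_le[of "gl e s" \<Gamma> len "gl e t" "[(e, s, t)]"] assms gl_in_points by simp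

text \<open>The test function is the distance from \<open>s\<close> in the circle obtained by collapsing
  everything outside of the open edge \<open>e\<close> to a point.\<close>

lemma dist_ge_edge:
  assumes e: "e \<in> arcs \<Gamma>" "s \<in> {0..len e}" "t \<in> {0..len e}"
  shows "min \<bar>s - t\<bar> (len e - \<bar>s - t\<bar>) \<le> gd (gl e s) (gl e t)"
proof -
  define f :: "('v, 'e) point \<Rightarrow> real" where
    "f z = (case z of Inner e' u \<Rightarrow> if e' = e then min \<bar>s - u\<bar> (len e - \<bar>s - u\<bar>) else min s (len e - s)
       | Vertex _ \<Rightarrow> min s (len e - s))" for z
  have fgl: "f (gl e' u) = (if e' = e then min \<bar>s - u\<bar> (len e - \<bar>s - u\<bar>) else min s (len e - s))"
    if "e' \<in> arcs \<Gamma>" "u \<in> {0..len e'}" for e' u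
    using that e(2) by (cases "u = 0"; cases "u = len e'") (auto simp: f_def glue_def)
  have lip: "\<bar>min \<bar>s - u\<bar> (len e - \<bar>s - u\<bar>) - min \<bar>s - w\<bar> (len e - \<bar>s - w\<bar>)\<bar> \<le> \<bar>u - w\<bar>" for u w
    by linarith
  have "\<bar>f (gl e s) - f (gl e t)\<bar> \<le> gd (gl e s) (gl e t)"
    using e lip by (intro dist_ge_lipschitz) (simp_all add: gl_in_points fgl del: atLeastAtMost_iff)
  then show ?thesis using e by (simp add: fgl)
qed

text \<open>On a loop the way around the other side has length
  \<open>len e - \<bar>s - t\<bar>\<close>, so equality can be expected only up to half of the edge
  length.\<close>

lemma dist_edge:
  assumes "e \<in> arcs \<Gamma>" "s \<in> {0..len e}" "t \<in> {0..len e}" "\<bar>s - t\<bar> \<le> len e / 2"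
  shows "gd (gl e s) (gl e t) = \<bar>s - t\<bar>"
  using dist_le_edge[OF assms(1-3)] dist_ge_edge[OF assms(1-3)] assms(4) by linarith

text \<open>The tent function of height \<open>min t (len e - t)\<close> centred at the point
  vanishes outside of the open edge \<open>e\<close>. At a smaller distance its value is still
  positive, which forces \<open>z\<close> onto this edge.\<close>

lemma near_inner:
  assumes e: "e \<in> arcs \<Gamma>" "0 < t" "t < len e" and z: "z \<in> points"
    and d: "gd (gl e t) z < min t (len e - t)"
  obtains u where "0 < u" "u < len e" "z = gl e u" "\<bar>u - t\<bar> = gd (gl e t) z"
proof -
  define r where "r = min t (len e - t)"
  define f :: "('v, 'e) point \<Rightarrow> real" where
    "f z = (case z of Inner e' u \<Rightarrow> if e' = e then max 0 (r - \<bar>u - t\<bar>) else 0 | Vertex _ \<Rightarrow> 0)" for z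
  have fgl: "f (gl e' u) = (if e' = e then max 0 (r - \<bar>u - t\<bar>) else 0)"
    if "e' \<in> arcs \<Gamma>" "u \<in> {0..len e'}" for e' u
    using that e by (auto simp: f_def glue_def r_def)
  have "\<bar>f (gl e t) - f z\<bar> \<le> gd (gl e t) z"
    by (rule dist_ge_lipschitz) (use e z in \<open>auto simp: gl_in_points fgl\<close>)
  then have "f (gl e t) - f z < r" using d by (auto simp: r_def)
  moreover have "f (gl e t) = r" using e by (simp add: fgl r_def)
  ultimately have "0 < f z" by linarith
  then obtain u where u: "z = Inner e u" "\<bar>u - t\<bar> < r"
    by (auto simp: f_def max_def split: point.splits if_splits)
  then have "0 < u" "u < len e" using e by (auto simp: r_def)
  moreover from this have "z = gl e u" using u by (simp add: gl_inner)
  moreover have "\<bar>u - t\<bar> = gd (gl e t) z"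
    using dist_edge[of e t u] u e \<open>z = gl e u\<close> \<open>0 < u\<close> \<open>u < len e\<close> by (auto simp: r_def abs_minus_commute)
  ultimately show ?thesis by (rule that)
qed

lemma sphere_inner:
  assumes e: "e \<in> arcs \<Gamma>" "0 < t" "t < len e" and \<epsilon>: "0 < \<epsilon>" "\<epsilon> < t" "\<epsilon> < len e - t"
  shows "{z \<in> points. gd (gl e t) z = \<epsilon>} = {gl e (t - \<epsilon>), gl e (t + \<epsilon>)}"
proof (intro equalityI subsetI)
  fix z assume "z \<in> {z \<in> points. gd (gl e t) z = \<epsilon>}"
  then have z: "z \<in> points" "gd (gl e t) z = \<epsilon>" by auto
  obtain u where "z = gl e u" "\<bar>u - t\<bar> = \<epsilon>"
    using near_inner[OF e z(1)] z(2) \<epsilon> by (metis min_less_iff_conj)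
  then have "u = t - \<epsilon> \<or> u = t + \<epsilon>" by linarith
  then show "z \<in> {gl e (t - \<epsilon>), gl e (t + \<epsilon>)}" using \<open>z = gl e u\<close> by auto
next
  fix z assume "z \<in> {gl e (t - \<epsilon>), gl e (t + \<epsilon>)}"
  moreover have "gl e (t - \<epsilon>) \<in> points" "gl e (t + \<epsilon>) \<in> points"
    using e \<epsilon> by (auto intro!: gl_in_points)
  moreover have "gd (gl e t) (gl e (t - \<epsilon>)) = \<epsilon>" "gd (gl e t) (gl e (t + \<epsilon>)) = \<epsilon>"
    using dist_edge[of e t "t - \<epsilon>"] dist_edge[of e t "t + \<epsilon>"] e \<epsilon> by auto
  ultimately show "z \<in> {z \<in> points. gd (gl e t) z = \<epsilon>}" by blast
qed

text \<open>A radius that works for all vertices at once: the points at distance less than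
  \<open>rad\<close> from the two ends of an edge do not meet. The 1 covers graphs without
  edges.\<close>

definition rad :: real where "rad = Min (insert 1 (len ` arcs \<Gamma>)) / 2"

lemma rad_pos: "0 < rad" and rad_le: "e \<in> arcs \<Gamma> \<Longrightarrow> rad \<le> len e / 2"
proof -
  have "0 < Min (insert 1 (len ` arcs \<Gamma>))" using len_pos by (subst Min_gr_iff) auto
  then show "0 < rad" by (simp add: rad_def)
  show "rad \<le> len e / 2" if "e \<in> arcs \<Gamma>" using that by (simp add: rad_def)
qed

end

section \<open>Refinement of models\<close>

text \<open>Taking for \<open>W\<close> the set of vertices reachable from a given one turns
  reachability into a statement about cuts. This form passes easily to subdivisions and supports
  arguments by closure under edges.\<close>

lemma (in wf_digraph) connected_iff:
  "Digraph_Component.connected G \<longleftrightarrow> verts G \<noteq> {} \<and>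
     (\<forall>W\<subseteq>verts G. W \<noteq> {} \<longrightarrow> (\<forall>e\<in>arcs G. tail G e \<in> W \<longleftrightarrow> head G e \<in> W) \<longrightarrow> W = verts G)"
    (is "?C \<longleftrightarrow> ?N \<and> ?R")
proof -
  let ?S = "with_proj (mk_symmetric G)"
  let ?E = "rtrancl_on (verts G) (arcs_ends ?S)"
  have C: "?C \<longleftrightarrow> ?N \<and> (\<forall>u\<in>verts G. \<forall>v\<in>verts G. (u, v) \<in> ?E)"
    by (simp add: Digraph_Component.connected_def strongly_connected_def reachable_def)
  have step: "(u, v) \<in> arcs_ends ?S \<longleftrightarrow> (\<exists>e\<in>arcs G. (u = tail G e \<and> v = head G e) \<or> (u = head G e \<and> v = tail G e))"
    for u v by (auto simp: parcs_mk_symmetric)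
  show ?thesis
  proof
    assume c: ?C
    have "W = verts G" if W: "W \<subseteq> verts G" "W \<noteq> {}" "\<forall>e\<in>arcs G. tail G e \<in> W \<longleftrightarrow> head G e \<in> W" for W
    proof -
      obtain u where u: "u \<in> W" using W by blast
      have "v \<in> W" if "(u, v) \<in> ?E" for v
        using that u
      proof (induction rule: rtrancl_on.induct)
        case (rtrancl_on_into_rtrancl_on a b c)
        then show ?case using W(3) step by metis
      qed
      then show ?thesis using c C u W(1) by blast
    qed
    then show "?N \<and> ?R" using c C by blast
  next
    assume r: "?N \<and> ?R"
    have "(u, v) \<in> ?E" if uv: "u \<in> verts G" "v \<in> verts G" for u v
    proof -
      let ?W = "{v \<in> verts G. (u, v) \<in> ?E}"
      have "?W \<noteq> {}" using uv by (auto intro: rtrancl_on_refl)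
      moreover have "\<forall>e\<in>arcs G. tail G e \<in> ?W \<longleftrightarrow> head G e \<in> ?W"
      proof
        fix e assume e: "e \<in> arcs G"
        have "(tail G e, head G e) \<in> arcs_ends ?S" "(head G e, tail G e) \<in> arcs_ends ?S"
          using step e by blast+
        then show "tail G e \<in> ?W \<longleftrightarrow> head G e \<in> ?W"
          using e rtrancl_on_into_rtrancl_on[of u _ "verts G" "arcs_ends ?S"] by auto
      qed
      moreover have "?W \<subseteq> verts G" by blast
      ultimately have "?W = verts G" using r by blast
      then show ?thesis using uv by blast
    qed
    then show ?C using r C by blast
  qed
qed

text \<open>By the triangle inequality in the target, a map that does not lengthen segments does not
  lengthen chains. The target is an arbitrary metric space, so the lemma applies in both directions
  between a graph and its subdivision.\<close>

lemma (in mgraph) contraction: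
  assumes M: "Metric_space M d" and F: "\<And>x. x \<in> points \<Longrightarrow> F x \<in> M"
    and seg: "\<And>e s t. e \<in> arcs \<Gamma> \<Longrightarrow> s \<in> {0..len e} \<Longrightarrow> t \<in> {0..len e} \<Longrightarrow> d (F (gl e s)) (F (gl e t)) \<le> \<bar>s - t\<bar>"
    and xy: "x \<in> points" "y \<in> points"
  shows "d (F x) (F y) \<le> gd x y"
proof -
  interpret M: Metric_space M d by fact
  have "d (F x) (F y) \<le> chain_length cs" if "seg_chain \<Gamma> len x cs y" "x \<in> points" for x cs
    using that
  proof (induction cs arbitrary: x)
    case Nil
    then show ?case using F by simp
  next
    case (Cons c cs)
    obtain e s t where c: "c = (e, s, t)" by (cases c) auto
    from Cons.prems c have h: "e \<in> arcs \<Gamma>" "s \<in> {0..len e}" "t \<in> {0..len e}" "gl e s = x"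
      "seg_chain \<Gamma> len (gl e t) cs y" by auto
    have p: "gl e t \<in> points" using h gl_in_points by blast
    have "d (F x) (F y) \<le> d (F x) (F (gl e t)) + d (F (gl e t)) (F y)"
      using F p Cons.prems(2) xy(2) by (intro M.triangle) auto
    moreover have "d (F x) (F (gl e t)) \<le> \<bar>s - t\<bar>" using seg[OF h(1-3)] h(4) by simp
    ultimately show ?case using Cons.IH[OF h(5) p] c by simp
  qed
  then show ?thesis using glue_dist_ge[OF metric_graph xy] xy by blast
qed

text \<open>The first half keeps the name \<open>e\<close> and only the second half gets a new one,
  so that coordinates change only at \<open>w\<close> and on \<open>e'\<close>.\<close>

definition subdivide :: "('v, 'e) pre_digraph \<Rightarrow> 'e \<Rightarrow> 'v \<Rightarrow> 'e \<Rightarrow> ('v, 'e) pre_digraph" where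
  "subdivide \<Gamma> e w e' = \<lparr>verts = insert w (verts \<Gamma>), arcs = insert e' (arcs \<Gamma>),
     tail = (tail \<Gamma>)(e' := w), head = (head \<Gamma>)(e := w, e' := head \<Gamma> e)\<rparr>"

locale subdivision = mgraph +
  fixes e :: 'b and t :: real and w :: 'a and e' :: 'b
  assumes e: "e \<in> arcs \<Gamma>" and t: "0 < t" "t < len e" and w: "w \<notin> verts \<Gamma>" and e': "e' \<notin> arcs \<Gamma>"
begin

definition "\<Gamma>' = subdivide \<Gamma> e w e'"
definition "len' = len(e := t, e' := len e - t)"

lemma len'_eq: "len' a = (if a = e' then len e - t else if a = e then t else len a)"
  by (simp add: len'_def)

lemma subdivide_simps [simp]:
  "verts \<Gamma>' = insert w (verts \<Gamma>)" "arcs \<Gamma>' = insert e' (arcs \<Gamma>)"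
  "tail \<Gamma>' = (tail \<Gamma>)(e' := w)" "head \<Gamma>' = (head \<Gamma>)(e := w, e' := head \<Gamma> e)"
  by (simp_all add: \<Gamma>'_def subdivide_def)

lemma metric_graph_subdivide: "metric_graph \<Gamma>' len'"
proof -
  interpret S: fin_digraph \<Gamma>'
    by standard (auto intro: tail_in_verts head_in_verts e)
  have "W = verts \<Gamma>'" if W: "W \<subseteq> verts \<Gamma>'" "W \<noteq> {}" "\<forall>a\<in>arcs \<Gamma>'. tail \<Gamma>' a \<in> W \<longleftrightarrow> head \<Gamma>' a \<in> W" for W
  proof -
    have ne: "e \<noteq> e'" using e e' by blast
    \<comment> \<open>The two halves put \<open>tail \<Gamma> e\<close>, \<open>w\<close> and
      \<open>head \<Gamma> e\<close> on the same side, so the old part of \<open>W\<close> is closed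
      under the undivided edge as well.\<close>
    have w1: "tail \<Gamma> e \<in> W \<longleftrightarrow> w \<in> W" "w \<in> W \<longleftrightarrow> head \<Gamma> e \<in> W"
      using bspec[OF W(3), of e] bspec[OF W(3), of e'] e ne by auto
    have "\<forall>a\<in>arcs \<Gamma>. tail \<Gamma> a \<in> W \<inter> verts \<Gamma> \<longleftrightarrow> head \<Gamma> a \<in> W \<inter> verts \<Gamma>"
    proof
      fix a assume a: "a \<in> arcs \<Gamma>"
      then have "tail \<Gamma> a \<in> W \<longleftrightarrow> head \<Gamma> a \<in> W"
        using bspec[OF W(3), of a] w1 e' by (cases "a = e") (auto split: if_splits)
      then show "tail \<Gamma> a \<in> W \<inter> verts \<Gamma> \<longleftrightarrow> head \<Gamma> a \<in> W \<inter> verts \<Gamma>" using a by auto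
    qed
    moreover have "W \<inter> verts \<Gamma> \<noteq> {}" using W(1,2) w1 tail_in_verts[OF e] by auto
    moreover have "W \<inter> verts \<Gamma> \<subseteq> verts \<Gamma>" by blast
    moreover have "Digraph_Component.connected \<Gamma>" using metric_graph by (simp add: metric_graph_def)
    ultimately have "W \<inter> verts \<Gamma> = verts \<Gamma>"
      unfolding connected_iff by blast
    then show ?thesis using W(1) w1 tail_in_verts[OF e] by auto
  qed
  then have "Digraph_Component.connected \<Gamma>'" unfolding S.connected_iff by auto
  then show ?thesis using S.fin_digraph_axioms t len_pos by (auto simp: metric_graph_def len'_eq)
qed

sublocale S: mgraph \<Gamma>' len'
  by unfold_locales (rule metric_graph_subdivide)

text \<open>The identity of the underlying space in coordinates, with inverse \<open>\<rho>\<close>.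
  Both are shown to be contractions, hence isometries.\<close>

definition \<psi> :: "('a, 'b) point \<Rightarrow> ('a, 'b) point" where
  "\<psi> p = (case p of Vertex u \<Rightarrow> if u = w then Inner e t else Vertex u
     | Inner a s \<Rightarrow> if a = e' then Inner e (t + s) else Inner a s)"

definition \<rho> :: "('a, 'b) point \<Rightarrow> ('a, 'b) point" where
  "\<rho> p = (case p of Vertex u \<Rightarrow> Vertex u
     | Inner a s \<Rightarrow> if a = e then (if s < t then Inner e s else if s = t then Vertex w else Inner e' (s - t))
         else Inner a s)"

lemma ne: "e \<noteq> e'" using e e' by blast

lemma \<psi>_gl:
  assumes a: "a \<in> arcs \<Gamma>'" and s: "s \<in> {0..len' a}"
  shows "\<psi> (S.gl a s) = (if a = e' then gl e (t + s) else gl a s)"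
proof -
  consider "a = e'" | "a = e" "a \<noteq> e'" | "a \<in> arcs \<Gamma>" "a \<noteq> e" "a \<noteq> e'" using a by auto
  then show ?thesis
  proof cases
    case 1
    then show ?thesis using t s w head_in_verts[OF e] by (auto simp: \<psi>_def glue_def len'_eq)
  next
    case 2
    then show ?thesis using t s w tail_in_verts[OF e] by (auto simp: \<psi>_def glue_def len'_eq)
  next
    case 3
    then have "tail \<Gamma> a \<noteq> w" "head \<Gamma> a \<noteq> w" using w tail_in_verts head_in_verts by blast+
    then show ?thesis using 3 by (simp add: \<psi>_def glue_def len'_eq)
  qed
qed

lemma \<rho>_gl:
  assumes a: "a \<in> arcs \<Gamma>" and s: "s \<in> {0..len a}"
  shows "\<rho> (gl a s) = (if a = e then if s \<le> t then S.gl e s else S.gl e' (s - t) else S.gl a s)"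
proof (cases "a = e")
  case True
  then show ?thesis using t s ne by (auto simp: \<rho>_def glue_def len'_eq)
next
  case False
  moreover have "a \<noteq> e'" using a e' by blast
  ultimately show ?thesis by (simp add: \<rho>_def glue_def len'_eq)
qed

lemma \<psi>_in: "p \<in> S.points \<Longrightarrow> \<psi> p \<in> points"
  using t e ne by (cases p) (auto simp: \<psi>_def len'_eq split: if_splits)

lemma \<rho>_in: "p \<in> points \<Longrightarrow> \<rho> p \<in> S.points"
  using t e ne e' by (cases p) (auto simp: \<rho>_def len'_eq)

lemma \<psi>_\<rho>: "p \<in> points \<Longrightarrow> \<psi> (\<rho> p) = p"
  using t e ne e' w by (cases p) (auto simp: \<rho>_def \<psi>_def)

lemma \<rho>_\<psi>: "p \<in> S.points \<Longrightarrow> \<rho> (\<psi> p) = p"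
  using t e ne e' w by (cases p) (auto simp: \<rho>_def \<psi>_def len'_eq split: if_splits)

lemma \<psi>_contraction:
  assumes "x \<in> S.points" "y \<in> S.points"
  shows "gd (\<psi> x) (\<psi> y) \<le> S.gd x y"
proof (rule S.contraction[OF MS.Metric_space_axioms \<psi>_in _ assms])
  fix a s u assume a: "a \<in> arcs \<Gamma>'" "s \<in> {0..len' a}" "u \<in> {0..len' a}"
  show "gd (\<psi> (S.gl a s)) (\<psi> (S.gl a u)) \<le> \<bar>s - u\<bar>"
  proof (cases "a = e'")
    case True
    then show ?thesis using dist_le_edge[OF e, of "t + s" "t + u"] a t
      unfolding \<psi>_gl[OF a(1,2)] \<psi>_gl[OF a(1,3)] by (simp add: len'_eq)
  next
    case False
    then have "s \<in> {0..len a}" "u \<in> {0..len a}" "a \<in> arcs \<Gamma>" using a t by (auto simp: len'_eq split: if_splits)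
    then show ?thesis using dist_le_edge[of a s u] False
      unfolding \<psi>_gl[OF a(1,2)] \<psi>_gl[OF a(1,3)] by simp
  qed
qed

lemma \<rho>_contraction:
  assumes "x \<in> points" "y \<in> points"
  shows "S.gd (\<rho> x) (\<rho> y) \<le> gd x y"
proof (rule contraction[OF S.MS.Metric_space_axioms \<rho>_in _ assms])
  fix a s u assume a: "a \<in> arcs \<Gamma>" "s \<in> {0..len a}" "u \<in> {0..len a}"
  have le: "S.gd (\<rho> (gl a s)) (\<rho> (gl a u)) \<le> u - s"
    if "s \<in> {0..len a}" "u \<in> {0..len a}" "s \<le> u" for s u
  proof -
    consider "a \<noteq> e" | "a = e" "u \<le> t" | "a = e" "t < s" | "a = e" "s \<le> t" "t < u" by linarith
    then show ?thesis
    proof cases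
      case 1
      moreover have "a \<noteq> e'" using a(1) e' by blast
      ultimately show ?thesis using S.dist_le_edge[of a s u] a(1) that by (simp add: \<rho>_gl len'_eq)
    next
      case 2
      then show ?thesis using S.dist_le_edge[of e s u] a(1) that ne by (simp add: \<rho>_gl len'_eq)
    next
      case 3
      then show ?thesis using S.dist_le_edge[of e' "s - t" "u - t"] a(1) that ne by (simp add: \<rho>_gl len'_eq)
    next
      case 4
      \<comment> \<open>The segment crosses the subdivision point and is split there.\<close>
      have w2: "S.gl e t = Vertex w" "S.gl e' 0 = Vertex w"
        using ne t by (auto simp: glue_def len'_eq)
      have "S.gd (S.gl e s) (S.gl e' (u - t)) \<le> S.gd (S.gl e s) (Vertex w) + S.gd (Vertex w) (S.gl e' (u - t))"
        using 4 that ne e t by (intro S.MS.triangle S.gl_in_points) (auto simp: len'_eq)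
      moreover have "S.gd (S.gl e s) (Vertex w) \<le> t - s"
        using S.dist_le_edge[of e s t] 4 that ne e t unfolding w2 by (auto simp: len'_eq)
      moreover have "S.gd (Vertex w) (S.gl e' (u - t)) \<le> u - t"
        using S.dist_le_edge[of e' 0 "u - t"] 4 that ne e t unfolding w2 by (auto simp: len'_eq)
      ultimately show ?thesis using 4 that by (simp add: \<rho>_gl e)
    qed
  qed
  show "S.gd (\<rho> (gl a s)) (\<rho> (gl a u)) \<le> \<bar>s - u\<bar>"
    using le[of s u] le[of u s] a S.MS.commute[of "\<rho> (gl a s)" "\<rho> (gl a u)"] by linarith
qed

lemma \<psi>_dist: "x \<in> S.points \<Longrightarrow> y \<in> S.points \<Longrightarrow> gd (\<psi> x) (\<psi> y) = S.gd x y"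
  using \<psi>_contraction[of x y] \<rho>_contraction[of "\<psi> x" "\<psi> y"] by (simp add: \<psi>_in \<rho>_\<psi>)

lemma \<psi>_image: "\<psi> ` S.points = points"
proof
  show "\<psi> ` S.points \<subseteq> points" using \<psi>_in by blast
  show "points \<subseteq> \<psi> ` S.points"
  proof
    fix p assume "p \<in> points"
    then have "p = \<psi> (\<rho> p)" "\<rho> p \<in> S.points" by (simp_all add: \<psi>_\<rho> \<rho>_in)
    then show "p \<in> \<psi> ` S.points" by (rule image_eqI)
  qed
qed

end

lemma model_subdivide:
  assumes m: "model X \<Gamma> len \<phi>" and p: "p \<in> mspace X"
  shows "\<exists>\<Gamma>' len' \<phi>'. model X \<Gamma>' len' \<phi>' \<and>
    insert p (\<phi> ` Vertex ` verts \<Gamma>) \<subseteq> \<phi>' ` Vertex ` verts \<Gamma>'"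
proof -
  interpret mgraph \<Gamma> len using m by unfold_locales (simp add: model_def)
  from p m obtain x where x: "x \<in> points" "p = \<phi> x"
    unfolding model_def isometry_def by (metis (no_types, lifting) image_iff mspace_glued_curve)
  from x(1) show ?thesis
  proof (cases rule: points_cases)
    case (vertex v)
    then show ?thesis using m x by (intro exI[of _ \<Gamma>] exI[of _ len] exI[of _ \<phi>]) auto
  next
    case (inner e t)
    obtain w where w: "w \<notin> verts \<Gamma>" using ex_new_if_finite[OF infinite_UNIV_nat finite_verts] by blast
    obtain e' where e': "e' \<notin> arcs \<Gamma>" using ex_new_if_finite[OF infinite_UNIV_nat finite_arcs] by blast
    interpret S: subdivision \<Gamma> len e t w e' by unfold_locales (use inner w e' in auto)
    have "isometry (glued_curve S.\<Gamma>' S.len') X (\<phi> \<circ> S.\<psi>)"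
      using m S.\<psi>_in unfolding model_def isometry_def image_comp[symmetric]
      by (auto simp: metric_graph S.metric_graph_subdivide S.\<psi>_image S.\<psi>_dist)
    then have "model X S.\<Gamma>' S.len' (\<phi> \<circ> S.\<psi>)"
      by (simp add: model_def S.metric_graph_subdivide)
    moreover have "insert p (\<phi> ` Vertex ` verts \<Gamma>) \<subseteq> (\<phi> \<circ> S.\<psi>) ` Vertex ` verts S.\<Gamma>'"
    proof -
      have "S.\<psi> (Vertex w) = x" using inner by (simp add: S.\<psi>_def)
      moreover have "S.\<psi> (Vertex v) = Vertex v" if "v \<in> verts \<Gamma>" for v
        using that w by (auto simp: S.\<psi>_def)
      ultimately show ?thesis using x(2) by (force simp: image_image)
    qed
    ultimately show ?thesis by blast
  qed
qed

text \<open>Supports, the base point and the break points of functions are finitely many points, so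
  one model can have all of them as vertices. The old vertices are kept, which is what
  \<open>edge_affine\<close> asks for when the two models are compared.\<close>

lemma model_refine:
  assumes "model X \<Gamma> len \<phi>" and "finite F" "F \<subseteq> mspace X"
  obtains \<Gamma>' len' \<phi>' where "model X \<Gamma>' len' \<phi>'" "F \<union> \<phi> ` Vertex ` verts \<Gamma> \<subseteq> \<phi>' ` Vertex ` verts \<Gamma>'"
proof -
  have "\<exists>\<Gamma>' len' \<phi>'. model X \<Gamma>' len' \<phi>' \<and> F \<union> \<phi> ` Vertex ` verts \<Gamma> \<subseteq> \<phi>' ` Vertex ` verts \<Gamma>'"
    using assms(2,3)
  proof (induction F)
    case empty
    then show ?case using assms(1) by auto
  next
    case (insert p F)
    then obtain \<Gamma>' len' \<phi>' where 1: "model X \<Gamma>' len' \<phi>'" "F \<union> \<phi> ` Vertex ` verts \<Gamma> \<subseteq> \<phi>' ` Vertex ` verts \<Gamma>'"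
      by auto
    obtain \<Gamma>'' len'' \<phi>'' where 2: "model X \<Gamma>'' len'' \<phi>''"
        "insert p (\<phi>' ` Vertex ` verts \<Gamma>') \<subseteq> \<phi>'' ` Vertex ` verts \<Gamma>''"
      using model_subdivide[OF 1(1), of p] insert.prems by auto
    have "insert p F \<union> \<phi> ` Vertex ` verts \<Gamma> \<subseteq> \<phi>'' ` Vertex ` verts \<Gamma>''"
      using subset_trans[OF 1(2), of "\<phi>'' ` Vertex ` verts \<Gamma>''"] 2(2) by simp
    then show ?case using 2(1) by (intro exI conjI)
  qed
  then show ?thesis using that by blast
qed

section \<open>Comparison of two models\<close>

locale curve_model =
  fixes X :: "'a metric" and \<Gamma> :: "(nat, nat) pre_digraph" and len :: "nat \<Rightarrow> real"
    and \<phi> :: "(nat, nat) point \<Rightarrow> 'a"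
  assumes model: "model X \<Gamma> len \<phi>"
begin

sublocale mgraph \<Gamma> len
  by unfold_locales (use model in \<open>simp add: model_def\<close>)

lemma \<phi>_image: "\<phi> ` points = mspace X"
  and \<phi>_dist: "x \<in> points \<Longrightarrow> y \<in> points \<Longrightarrow> mdist X (\<phi> x) (\<phi> y) = gd x y"
  using model by (auto simp: model_def isometry_def metric_graph)

lemma \<phi>_in: "x \<in> points \<Longrightarrow> \<phi> x \<in> mspace X"
  using \<phi>_image by blast

lemma \<phi>_eq_iff: "x \<in> points \<Longrightarrow> y \<in> points \<Longrightarrow> \<phi> x = \<phi> y \<longleftrightarrow> x = y"
  using \<phi>_dist[of x y] \<phi>_dist[of x x] MS.zero[of x y] MS.zero[of x x] by auto

lemma inj_\<phi>: "inj_on \<phi> points"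
  by (simp add: inj_on_def \<phi>_eq_iff)

abbreviation "pt e t \<equiv> \<phi> (gl e t)"
abbreviation "vt v \<equiv> \<phi> (Vertex v)"

lemma pt_in: "e \<in> arcs \<Gamma> \<Longrightarrow> t \<in> {0..len e} \<Longrightarrow> pt e t \<in> mspace X"
  by (simp add: \<phi>_in gl_in_points del: atLeastAtMost_iff)

lemma vt_in: "v \<in> verts \<Gamma> \<Longrightarrow> vt v \<in> mspace X"
  by (simp add: \<phi>_in)

lemma vt_eq_iff: "v \<in> verts \<Gamma> \<Longrightarrow> w \<in> verts \<Gamma> \<Longrightarrow> vt v = vt w \<longleftrightarrow> v = w"
  by (simp add: \<phi>_eq_iff)

lemma pt_eq_iff: "e \<in> arcs \<Gamma> \<Longrightarrow> 0 < t \<Longrightarrow> t < len e \<Longrightarrow> e' \<in> arcs \<Gamma> \<Longrightarrow> s \<in> {0..len e'} \<Longrightarrow>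
    pt e' s = pt e t \<longleftrightarrow> e' = e \<and> s = t"
  using gl_eq_inner[of t e e' s] gl_in_points[of e t] gl_in_points[of e' s] by (simp add: \<phi>_eq_iff)

lemma vt_neq_pt: "v \<in> verts \<Gamma> \<Longrightarrow> e \<in> arcs \<Gamma> \<Longrightarrow> 0 < t \<Longrightarrow> t < len e \<Longrightarrow> vt v \<noteq> pt e t"
  by (simp add: \<phi>_eq_iff gl_in_points gl_inner)

lemma mspace_cases [consumes 1, case_names vertex inner]:
  assumes "p \<in> mspace X"
  obtains v where "v \<in> verts \<Gamma>" "p = vt v"
  | e t where "e \<in> arcs \<Gamma>" "0 < t" "t < len e" "p = pt e t"
  using assms \<phi>_image by (metis (no_types, lifting) imageE points_cases)

lemma dist_pt_le: "e \<in> arcs \<Gamma> \<Longrightarrow> s \<in> {0..len e} \<Longrightarrow> t \<in> {0..len e} \<Longrightarrow> mdist X (pt e s) (pt e t) \<le> \<bar>s - t\<bar>"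
  using dist_le_edge[of e s t] \<phi>_dist[of "gl e s" "gl e t"] gl_in_points[of e s] gl_in_points[of e t] by simp

lemma dist_pt: "e \<in> arcs \<Gamma> \<Longrightarrow> s \<in> {0..len e} \<Longrightarrow> t \<in> {0..len e} \<Longrightarrow> \<bar>s - t\<bar> \<le> len e / 2 \<Longrightarrow>
    mdist X (pt e s) (pt e t) = \<bar>s - t\<bar>"
  using dist_edge[of e s t] \<phi>_dist[of "gl e s" "gl e t"] gl_in_points[of e s] gl_in_points[of e t] by simp

lemma near_pt:
  assumes e: "e \<in> arcs \<Gamma>" "0 < t" "t < len e" and p: "p \<in> mspace X"
    and d: "mdist X (pt e t) p < min t (len e - t)"
  obtains u where "0 < u" "u < len e" "p = pt e u" "\<bar>u - t\<bar> = mdist X (pt e t) p"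
proof -
  obtain z where z: "z \<in> points" "p = \<phi> z" using p \<phi>_image by blast
  have "gl e t \<in> points" using e by (simp add: gl_in_points)
  then have "mdist X (pt e t) p = gd (gl e t) z" using z \<phi>_dist by simp
  then show ?thesis using near_inner[OF e z(1)] d z(2) that by metis
qed

end

locale two_models = A: curve_model X \<Gamma> len \<phi> + B: curve_model X \<Gamma>\<^sub>1 len\<^sub>1 \<phi>\<^sub>1
  for X :: "'a metric" and \<Gamma> len \<phi> \<Gamma>\<^sub>1 len\<^sub>1 \<phi>\<^sub>1
begin

text \<open>The edge \<open>e\<close> of the first model runs near \<open>s\<close> along the edge
  \<open>e\<^sub>1\<close> of the second, with orientation \<sigma> and offset \<open>c\<close>.
  Being a germ at \<open>s\<close>, the condition persists at nearby parameters, so local constancy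
  of the triple requires no estimates.\<close>

definition local_affine :: "nat \<Rightarrow> real \<Rightarrow> nat \<times> real \<times> real \<Rightarrow> bool" where
  "local_affine e s k = (case k of (e\<^sub>1, \<sigma>, c) \<Rightarrow> e\<^sub>1 \<in> arcs \<Gamma>\<^sub>1 \<and> \<bar>\<sigma>\<bar> = 1 \<and>
     (\<forall>\<^sub>F s' in nhds s. 0 < c + \<sigma> * s' \<and> c + \<sigma> * s' < len\<^sub>1 e\<^sub>1 \<and> A.pt e s' = B.pt e\<^sub>1 (c + \<sigma> * s')))"

lemma local_affine_exists:
  assumes e: "e \<in> arcs \<Gamma>" "0 < s\<^sub>0" "s\<^sub>0 < len e" and nv: "A.pt e s\<^sub>0 \<notin> B.vt ` verts \<Gamma>\<^sub>1"
  shows "\<exists>k. local_affine e s\<^sub>0 k"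
proof -
  have "A.pt e s\<^sub>0 \<in> mspace X" using e by (intro A.pt_in) auto
  then obtain e1 t1 where e1: "e1 \<in> arcs \<Gamma>\<^sub>1" "0 < t1" "t1 < len\<^sub>1 e1" "A.pt e s\<^sub>0 = B.pt e1 t1"
    using nv by (cases rule: B.mspace_cases) auto
  \<comment> \<open>Half the distance to the ends of both edges: two parameters within
    \<open>r\<close> of the centre differ by at most half of either edge length, where
    \<open>dist_pt\<close> is exact.\<close>
  define r where "r = min (min t1 (len\<^sub>1 e1 - t1)) (min s\<^sub>0 (len e - s\<^sub>0)) / 2"
  have r: "0 < r" "r < t1" "r < len\<^sub>1 e1 - t1" "r < s\<^sub>0" "r < len e - s\<^sub>0" "2 * r \<le> len e / 2" "2 * r \<le> len\<^sub>1 e1 / 2"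
    using e e1 by (auto simp: r_def min_def)
  have "\<exists>u. 0 < u \<and> u < len\<^sub>1 e1 \<and> A.pt e s = B.pt e1 u \<and> \<bar>u - t1\<bar> = \<bar>s - s\<^sub>0\<bar>"
    if s: "\<bar>s - s\<^sub>0\<bar> < r" for s
  proof -
    have s': "s \<in> {0..len e}" "s\<^sub>0 \<in> {0..len e}" using s r e by auto
    have d: "mdist X (B.pt e1 t1) (A.pt e s) = \<bar>s\<^sub>0 - s\<bar>"
      unfolding e1(4)[symmetric] by (intro A.dist_pt e s') (use s r in linarith)
    show ?thesis
    proof (rule B.near_pt[OF e1(1-3) A.pt_in[OF e(1) s'(1)]])
      show "mdist X (B.pt e1 t1) (A.pt e s) < min t1 (len\<^sub>1 e1 - t1)" using d s r by linarith
    qed (use d in \<open>auto simp: abs_minus_commute\<close>)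
  qed
  then obtain u where u: "\<And>s. \<bar>s - s\<^sub>0\<bar> < r \<Longrightarrow> 0 < u s \<and> u s < len\<^sub>1 e1 \<and> A.pt e s = B.pt e1 (u s) \<and> \<bar>u s - t1\<bar> = \<bar>s - s\<^sub>0\<bar>"
    by metis
  have iso: "\<bar>u s - u s'\<bar> = \<bar>s - s'\<bar>" if s: "\<bar>s - s\<^sub>0\<bar> < r" "\<bar>s' - s\<^sub>0\<bar> < r" for s s'
  proof -
    note us = u[OF s(1)] u[OF s(2)]
    have "s \<in> {0..len e}" "s' \<in> {0..len e}" "\<bar>s - s'\<bar> \<le> len e / 2"
      using s r unfolding atLeastAtMost_iff by linarith+
    then have "mdist X (A.pt e s) (A.pt e s') = \<bar>s - s'\<bar>" by (intro A.dist_pt e)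
    moreover have "mdist X (B.pt e1 (u s)) (B.pt e1 (u s')) = \<bar>u s - u s'\<bar>"
    proof (intro B.dist_pt e1)
      show "\<bar>u s - u s'\<bar> \<le> len\<^sub>1 e1 / 2" using us r(7) s by linarith
    qed (use us in auto)
    ultimately show ?thesis using us by metis
  qed
  \<comment> \<open>The coordinate change \<open>u\<close> is an isometry of an interval into the
    line, so the image of one further point decides between translation and reflection.\<close>
  define \<sigma> :: real where "\<sigma> = (if u (s\<^sub>0 + r / 2) > t1 then 1 else - 1)"
  have s1: "\<bar>s\<^sub>0 + r / 2 - s\<^sub>0\<bar> < r" using r by simp
  have aff: "u s = (t1 - \<sigma> * s\<^sub>0) + \<sigma> * s" if "\<bar>s - s\<^sub>0\<bar> < r" for s
  proof (cases "u (s\<^sub>0 + r / 2) > t1")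
    case True
    then show ?thesis using u[OF that] u[OF s1] iso[OF that s1] r(1) by (simp add: \<sigma>_def abs_if split: if_splits)
  next
    case False
    then show ?thesis using u[OF that] u[OF s1] iso[OF that s1] r(1) by (simp add: \<sigma>_def abs_if split: if_splits)
  qed
  have "\<forall>\<^sub>F s in nhds s\<^sub>0. \<bar>s - s\<^sub>0\<bar> < r"
    using r(1) by (auto simp: eventually_nhds_metric dist_real_def)
  then have "\<forall>\<^sub>F s in nhds s\<^sub>0. 0 < (t1 - \<sigma> * s\<^sub>0) + \<sigma> * s \<and> (t1 - \<sigma> * s\<^sub>0) + \<sigma> * s < len\<^sub>1 e1 \<and>
      A.pt e s = B.pt e1 ((t1 - \<sigma> * s\<^sub>0) + \<sigma> * s)"
    by (rule eventually_mono) (use u aff in metis)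
  then have "local_affine e s\<^sub>0 (e1, \<sigma>, t1 - \<sigma> * s\<^sub>0)"
    using e1(1) by (simp add: local_affine_def) (simp add: \<sigma>_def)
  then show ?thesis by blast
qed

lemma local_affine_unique:
  assumes "local_affine e s k" "local_affine e s k'"
  shows "k = k'"
proof -
  obtain e1 \<sigma> c e1' \<sigma>' c' where k: "k = (e1, \<sigma>, c)" "k' = (e1', \<sigma>', c')" by (metis prod_cases3)
  have e1: "e1 \<in> arcs \<Gamma>\<^sub>1" "e1' \<in> arcs \<Gamma>\<^sub>1" using assms k by (auto simp: local_affine_def)
  have "\<forall>\<^sub>F s' in nhds s. 0 < c + \<sigma> * s' \<and> c + \<sigma> * s' < len\<^sub>1 e1 \<and> A.pt e s' = B.pt e1 (c + \<sigma> * s')"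
    "\<forall>\<^sub>F s' in nhds s. 0 < c' + \<sigma>' * s' \<and> c' + \<sigma>' * s' < len\<^sub>1 e1' \<and> A.pt e s' = B.pt e1' (c' + \<sigma>' * s')"
    using assms by (auto simp: k local_affine_def)
  then have "\<forall>\<^sub>F s' in nhds s. e1 = e1' \<and> c + \<sigma> * s' = c' + \<sigma>' * s'"
  proof eventually_elim
    case (elim s')
    then have "B.pt e1 (c + \<sigma> * s') = B.pt e1' (c' + \<sigma>' * s')" by metis
    then show ?case using B.pt_eq_iff[of e1' "c' + \<sigma>' * s'" e1 "c + \<sigma> * s'"] elim e1 by simp
  qed
  then obtain d where d: "d > 0" "\<And>s'. \<bar>s' - s\<bar> < d \<Longrightarrow> e1 = e1' \<and> c + \<sigma> * s' = c' + \<sigma>' * s'"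
    by (auto simp: eventually_nhds_metric dist_real_def)
  have "c + \<sigma> * s = c' + \<sigma>' * s" "c + \<sigma> * (s + d / 2) = c' + \<sigma>' * (s + d / 2)" "e1 = e1'"
    using d(1) d(2)[of s] d(2)[of "s + d / 2"] by auto
  moreover from this have "\<sigma> * (d / 2) = \<sigma>' * (d / 2)" unfolding distrib_left by linarith
  ultimately show ?thesis using d(1) k by simp
qed

text \<open>By \<open>local_affine_exists\<close> and \<open>local_affine_unique\<close> the triple describing the affine piece is
  a locally constant function on the open edge, hence constant.\<close>

lemma edge_affine:
  assumes e: "e \<in> arcs \<Gamma>" and sub: "B.vt ` verts \<Gamma>\<^sub>1 \<subseteq> A.vt ` verts \<Gamma>"
  obtains e\<^sub>1 \<sigma> c where "e\<^sub>1 \<in> arcs \<Gamma>\<^sub>1" "\<sigma> = 1 \<or> \<sigma> = - 1"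
    "\<And>s. s \<in> {0..len e} \<Longrightarrow> c + \<sigma> * s \<in> {0..len\<^sub>1 e\<^sub>1}"
    "\<And>s. s \<in> {0..len e} \<Longrightarrow> A.pt e s = B.pt e\<^sub>1 (c + \<sigma> * s)"
    "\<And>s. 0 < s \<Longrightarrow> s < len e \<Longrightarrow> 0 < c + \<sigma> * s \<and> c + \<sigma> * s < len\<^sub>1 e\<^sub>1"
proof -
  let ?l = "len e"
  have l: "0 < ?l" using e A.len_pos by blast
  define st where "st s = (SOME k. local_affine e s k)" for s
  have st: "local_affine e s (st s)" if "s \<in> {0<..<?l}" for s
    unfolding st_def
  proof (rule someI_ex, rule local_affine_exists[OF e])
    show "A.pt e s \<notin> B.vt ` verts \<Gamma>\<^sub>1" using A.vt_neq_pt[of _ e s] that e sub by auto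
  qed (use that in auto)
  have const: "st s = st (?l / 2)" if s: "s \<in> {0<..<?l}" for s
  proof (rule connected_local_const[of "{0<..<?l}"])
    show "\<forall>a\<in>{0<..<?l}. \<forall>\<^sub>F b in at a within {0<..<?l}. st a = st b"
    proof
      fix a assume a: "a \<in> {0<..<?l}"
      have "\<forall>\<^sub>F b in nhds a. local_affine e b (st a)"
        using st[OF a] unfolding local_affine_def
        by (cases "st a") (simp add: eventually_eventually)
      then have "\<forall>\<^sub>F b in at a within {0<..<?l}. local_affine e b (st a)"
        by (simp add: eventually_at_filter eventually_mono)
      moreover have "\<forall>\<^sub>F b in at a within {0<..<?l}. b \<in> {0<..<?l}"
        by (simp add: eventually_at_filter)
      ultimately show "\<forall>\<^sub>F b in at a within {0<..<?l}. st a = st b"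
        by eventually_elim (use st local_affine_unique in blast)
    qed
  qed (use s l in auto)
  obtain e1 \<sigma> c where k: "st (?l / 2) = (e1, \<sigma>, c)" by (metis prod_cases3)
  have e1: "e1 \<in> arcs \<Gamma>\<^sub>1" and \<sigma>: "\<bar>\<sigma>\<bar> = 1"
    using st[of "?l / 2"] l k by (auto simp: local_affine_def)
  have inner: "0 < c + \<sigma> * s \<and> c + \<sigma> * s < len\<^sub>1 e1 \<and> A.pt e s = B.pt e1 (c + \<sigma> * s)" if "s \<in> {0<..<?l}" for s
    using st[OF that] const[OF that] k unfolding local_affine_def
    by (auto dest!: eventually_nhds_x_imp_x)
  have "(\<lambda>s. c + \<sigma> * s) ` closure {0<..<?l} \<subseteq> {0..len\<^sub>1 e1}"
  proof (rule image_closure_subset)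
    show "continuous_on (closure {0<..<?l}) (\<lambda>s. c + \<sigma> * s)" by (intro continuous_intros)
    show "(\<lambda>s. c + \<sigma> * s) ` {0<..<?l} \<subseteq> {0..len\<^sub>1 e1}" using inner by (simp add: image_subset_iff less_imp_le)
  qed simp
  then have closed: "c + \<sigma> * s \<in> {0..len\<^sub>1 e1}" if "s \<in> {0..?l}" for s
    using that l by (simp add: image_subset_iff)
  have eq: "A.pt e s = B.pt e1 (c + \<sigma> * s)" if s: "s \<in> {0..?l}" for s
  proof -
    let ?D = "mdist X (A.pt e s) (B.pt e1 (c + \<sigma> * s))"
    have in1: "A.pt e s \<in> mspace X" "B.pt e1 (c + \<sigma> * s) \<in> mspace X"
      using A.pt_in[OF e s] B.pt_in[OF e1 closed[OF s]] by auto
    \<comment> \<open>Equality is known inside the edge only. Both sides are 1-Lipschitz in the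
      parameter, so passing through the point at fraction \<theta> of the way from \<open>s\<close>
      to the midpoint bounds the distance by \<open>\<theta> * ?l\<close>, for every small
      \<theta>.\<close>
    have D: "?D \<le> \<theta> * ?l" if \<theta>: "0 < \<theta>" "\<theta> < 1" for \<theta>
    proof -
      define s' where "s' = (1 - \<theta>) * s + \<theta> * (?l / 2)"
      have "(1 - \<theta>) * s \<le> (1 - \<theta>) * ?l" "0 \<le> (1 - \<theta>) * s" "0 < \<theta> * ?l" using s \<theta> l by (auto intro: mult_left_mono)
      then have s': "s' \<in> {0<..<?l}" by (simp add: s'_def algebra_simps)
      have "s - s' = \<theta> * (s - ?l / 2)" by (simp add: s'_def algebra_simps)
      moreover have "\<bar>s - ?l / 2\<bar> \<le> ?l / 2" using s unfolding atLeastAtMost_iff by linarith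
      ultimately have ss: "\<bar>s - s'\<bar> \<le> \<theta> * (?l / 2)" using \<theta> by (simp add: abs_mult mult_left_mono)
      have s'': "s' \<in> {0..?l}" using s' by auto
      have "?D \<le> mdist X (A.pt e s) (A.pt e s') + mdist X (A.pt e s') (B.pt e1 (c + \<sigma> * s))"
        by (rule mdist_triangle[OF in1(1) A.pt_in[OF e s''] in1(2)])
      also have "mdist X (A.pt e s) (A.pt e s') \<le> \<bar>s - s'\<bar>" by (rule A.dist_pt_le[OF e s s''])
      also have "A.pt e s' = B.pt e1 (c + \<sigma> * s')" using inner[OF s'] by simp
      also have "mdist X (B.pt e1 (c + \<sigma> * s')) (B.pt e1 (c + \<sigma> * s)) \<le> \<bar>(c + \<sigma> * s') - (c + \<sigma> * s)\<bar>"
        by (rule B.dist_pt_le[OF e1 closed[OF s''] closed[OF s]])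
      also have "\<dots> = \<bar>\<sigma>\<bar> * \<bar>s - s'\<bar>" by (simp add: abs_mult[symmetric] algebra_simps abs_minus_commute)
      finally show ?thesis using ss \<sigma> by simp
    qed
    have "?D \<le> 0"
    proof (rule ccontr)
      assume *: "\<not> ?D \<le> 0"
      define \<theta> where "\<theta> = min (1 / 2) (?D / (2 * ?l))"
      have "0 < \<theta>" "\<theta> < 1" using * l by (auto simp: \<theta>_def)
      from D[OF this] have "?D \<le> \<theta> * ?l" .
      also have "\<dots> \<le> ?D / (2 * ?l) * ?l" using l by (intro mult_right_mono) (auto simp: \<theta>_def)
      also have "\<dots> = ?D / 2" using l by simp
      finally show False using * by simp
    qed
    then show ?thesis using in1 by (metis mdist_nonneg mdist_zero order_antisym)
  qed
  show ?thesis
    by (rule that[OF e1 _ closed eq]) (use \<sigma> inner in auto)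
qed

end

section \<open>Spheres, boundary and order\<close>

text \<open>Spheres of small radius are purely metric, so quantities read off from them (the number of edges
  leaving a subcurve, the order of a function) do not depend on the model.\<close>

definition shell :: "'a metric \<Rightarrow> 'a set \<Rightarrow> real \<Rightarrow> 'a set" where
  "shell X Y \<epsilon> = {x \<in> mspace X. (\<exists>p\<in>Y. mdist X p x = \<epsilon>) \<and> (\<forall>p\<in>Y. \<epsilon> \<le> mdist X p x)}"

text \<open>Along the branch that carries \<open>x\<close>, the quotient of \<open>f p - f x\<close>
  by \<epsilon> is the incoming slope at \<open>p\<close>.\<close>

definition has_ord :: "'a metric \<Rightarrow> ('a \<Rightarrow> real) \<Rightarrow> 'a \<Rightarrow> int \<Rightarrow> bool" where
  "has_ord X f p k \<longleftrightarrow> (\<forall>\<^sub>F \<epsilon> in at_right 0. (\<Sum>x\<in>shell X {p} \<epsilon>. f p - f x) = of_int k * \<epsilon>)"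

lemma has_ord_unique:
  assumes "has_ord X f p k" "has_ord X f p k'"
  shows "k = k'"
proof -
  have "\<forall>\<^sub>F \<epsilon> :: real in at_right 0. 0 < \<epsilon>" by (simp add: eventually_at_right_less)
  with assms have "\<forall>\<^sub>F \<epsilon> :: real in at_right 0. k = k'"
    unfolding has_ord_def by eventually_elim auto
  then show ?thesis by simp
qed

section \<open>Subcurves and their boundaries in a fixed model\<close>

context curve_model
begin

text \<open>A description by membership alone, with every open edge either inside or outside of
  \<open>Y\<close>. By the next two lemmas it amounts to being induced by a subgraph of this
  particular model.\<close>

definition adapted :: "'a set \<Rightarrow> nat set \<Rightarrow> nat set \<Rightarrow> bool" where
  "adapted Y W A \<longleftrightarrow> Y \<subseteq> mspace X \<and> W \<subseteq> verts \<Gamma> \<and> A \<subseteq> arcs \<Gamma> \<and>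
     (\<forall>v\<in>verts \<Gamma>. vt v \<in> Y \<longleftrightarrow> v \<in> W) \<and>
     (\<forall>e\<in>arcs \<Gamma>. \<forall>t. 0 < t \<and> t < len e \<longrightarrow> (pt e t \<in> Y \<longleftrightarrow> e \<in> A)) \<and>
     (\<forall>e\<in>A. tail \<Gamma> e \<in> W \<and> head \<Gamma> e \<in> W)"

lemma adapted_of_subgraph:
  assumes "subgraph \<Delta> \<Gamma>"
  shows "adapted (\<phi> ` graph_points \<Delta> len) (verts \<Delta>) (arcs \<Delta>)"
proof -
  have th: "tail \<Delta> = tail \<Gamma>" "head \<Delta> = head \<Gamma>" "verts \<Delta> \<subseteq> verts \<Gamma>" "arcs \<Delta> \<subseteq> arcs \<Gamma>" "wf_digraph \<Delta>"
    using assms by (auto simp: subgraph_def compatible_def)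
  interpret D: wf_digraph \<Delta> by fact
  have g: "glue \<Delta> len = gl" by (intro ext) (simp add: glue_def th)
  have ends: "tail \<Gamma> e \<in> verts \<Delta>" "head \<Gamma> e \<in> verts \<Delta>" if "e \<in> arcs \<Delta>" for e
    using D.tail_in_verts[OF that] D.head_in_verts[OF that] th by auto
  have sub: "graph_points \<Delta> len \<subseteq> points"
    unfolding graph_points_def g using th by blast
  have v: "Vertex v \<in> graph_points \<Delta> len \<longleftrightarrow> v \<in> verts \<Delta>" for v
    using ends by (auto simp: graph_points_def g glue_def split: if_splits)
  have i: "Inner e t \<in> graph_points \<Delta> len \<longleftrightarrow> e \<in> arcs \<Delta>" if "0 < t" "t < len e" for e t
  proof
    assume "Inner e t \<in> graph_points \<Delta> len"
    then show "e \<in> arcs \<Delta>" by (auto simp: graph_points_def g glue_def split: if_splits)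
  next
    assume "e \<in> arcs \<Delta>"
    moreover have "Inner e t = gl e t" using that by (simp add: gl_inner)
    ultimately show "Inner e t \<in> graph_points \<Delta> len"
      using that unfolding graph_points_def g by (intro UnI2 UN_I[of e]) auto
  qed
  have mem: "\<phi> z \<in> \<phi> ` graph_points \<Delta> len \<longleftrightarrow> z \<in> graph_points \<Delta> len" if "z \<in> points" for z
    using that sub \<phi>_eq_iff by (auto simp: image_iff)
  have "pt e t \<in> \<phi> ` graph_points \<Delta> len \<longleftrightarrow> e \<in> arcs \<Delta>" if "e \<in> arcs \<Gamma>" "0 < t" "t < len e" for e t
    using that mem[of "Inner e t"] i[of t e] by (simp add: gl_inner)
  moreover have "\<phi> ` graph_points \<Delta> len \<subseteq> mspace X" using sub \<phi>_image by blast
  ultimately show ?thesis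
    using th ends v mem by (auto simp: adapted_def subset_eq)
qed

lemma adapted_subgraph:
  assumes "adapted Y W A"
  obtains \<Delta> where "subgraph \<Delta> \<Gamma>" "Y = \<phi> ` graph_points \<Delta> len" "verts \<Delta> = W" "arcs \<Delta> = A"
proof -
  define \<Delta> where "\<Delta> = \<lparr>verts = W, arcs = A, tail = tail \<Gamma>, head = head \<Gamma>\<rparr>"
  have s: "subgraph \<Delta> \<Gamma>"
    using assms by (auto simp: subgraph_def \<Delta>_def adapted_def compatible_def wf_digraph_def
        intro: wf_digraph_axioms[unfolded wf_digraph_def, THEN conjunct1, rule_format] tail_in_verts head_in_verts)
  have *: "adapted (\<phi> ` graph_points \<Delta> len) W A"
    using adapted_of_subgraph[OF s] by (simp add: \<Delta>_def)
  have "p \<in> Y \<longleftrightarrow> p \<in> \<phi> ` graph_points \<Delta> len" if "p \<in> mspace X" for p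
    using that
  proof (cases rule: mspace_cases)
    case (vertex v)
    then show ?thesis using assms * by (simp add: adapted_def)
  next
    case (inner e t)
    then show ?thesis using assms * by (simp add: adapted_def)
  qed
  moreover have "Y \<subseteq> mspace X" "\<phi> ` graph_points \<Delta> len \<subseteq> mspace X"
    using assms * by (simp_all add: adapted_def)
  ultimately have "Y = \<phi> ` graph_points \<Delta> len" by blast
  then show ?thesis using that[OF s] by (simp add: \<Delta>_def)
qed

lemma adapted_subcurve: "adapted Y W A \<Longrightarrow> subcurve X Y"
  using adapted_subgraph[of Y W A] model unfolding subcurve_def induces_def by metis

lemma adapted_vertex: "v \<in> verts \<Gamma> \<Longrightarrow> adapted {vt v} {v} {}"
  using vt_neq_pt[of v] by (fastforce simp: adapted_def vt_in vt_eq_iff)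

text \<open>The lower bound is the distance from \<open>Y\<close> truncated at \<^term>\<open>rad\<close>.\<close>

lemma dist_ge_of_adapted:
  assumes Y: "adapted Y W A" and p: "p \<in> Y" and z: "z \<in> points"
  shows "(case z of Vertex v \<Rightarrow> if v \<in> W then 0 else rad
     | Inner e t \<Rightarrow> if e \<in> A then 0
         else min rad (min (if tail \<Gamma> e \<in> W then t else rad) (if head \<Gamma> e \<in> W then len e - t else rad)))
    \<le> mdist X p (\<phi> z)"
proof -
  define h where "h z = (case z of Vertex v \<Rightarrow> if v \<in> W then 0 else rad
     | Inner e t \<Rightarrow> if e \<in> A then 0
         else min rad (min (if tail \<Gamma> e \<in> W then t else rad) (if head \<Gamma> e \<in> W then len e - t else rad)))" for z
  define H where "H e t = (if e \<in> A then 0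
      else min rad (min (if tail \<Gamma> e \<in> W then t else rad) (if head \<Gamma> e \<in> W then len e - t else rad)))" for e t
  have h: "h (gl e t) = H e t" if "e \<in> arcs \<Gamma>" "t \<in> {0..len e}" for e t
  proof -
    have A: "e \<in> A \<Longrightarrow> tail \<Gamma> e \<in> W \<and> head \<Gamma> e \<in> W" using Y by (simp add: adapted_def)
    show ?thesis
      using that A rad_pos rad_le[of e] by (cases "t = 0"; cases "t = len e") (auto simp: h_def H_def glue_def)
  qed
  have "p \<in> \<phi> ` points" using Y p unfolding adapted_def \<phi>_image by (rule_tac subsetD) (rule conjunct1)
  then obtain y where y: "y \<in> points" "p = \<phi> y" by (elim imageE)
  have "h y = 0"
    using y(1)
  proof (cases rule: points_cases)
    case (vertex v)
    then show ?thesis using Y p y by (simp add: h_def adapted_def)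
  next
    case (inner e t)
    then have "pt e t \<in> Y" using p y(2) by simp
    then have "e \<in> A" using inner(1-3) Y unfolding adapted_def by blast
    then show ?thesis using inner(4) by (simp add: h_def)
  qed
  moreover have "\<bar>h y - h z\<bar> \<le> gd y z"
  proof (rule dist_ge_lipschitz[OF y(1) z])
    fix e s t assume e: "e \<in> arcs \<Gamma>" "s \<in> {0..len e}" "t \<in> {0..len e}"
    have "\<bar>H e s - H e t\<bar> \<le> \<bar>s - t\<bar>"
      unfolding H_def by (cases "e \<in> A"; cases "tail \<Gamma> e \<in> W"; cases "head \<Gamma> e \<in> W"; simp; linarith?)
    then show "\<bar>h (gl e s) - h (gl e t)\<bar> \<le> \<bar>s - t\<bar>" using h e by simp
  qed
  ultimately show ?thesis using \<phi>_dist[OF y(1) z] y(2) by (simp add: h_def[symmetric])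
qed

text \<open>A vertex outside of \<open>W\<close> is at distance at least \<open>rad\<close> from
  \<open>Y\<close>, so it is too far away; a point inside an edge outside of \<open>A\<close> has
  its nearest point of \<open>Y\<close> at an end in \<open>W\<close>. Every such end contributes
  one point, and a loop or an edge with both ends in \<open>W\<close> contributes two.\<close>

lemma shell_adapted:
  assumes Y: "adapted Y W A" and \<epsilon>: "0 < \<epsilon>" "\<epsilon> < rad"
  shows "shell X Y \<epsilon> = (\<lambda>e. pt e \<epsilon>) ` {e \<in> arcs \<Gamma> - A. tail \<Gamma> e \<in> W}
    \<union> (\<lambda>e. pt e (len e - \<epsilon>)) ` {e \<in> arcs \<Gamma> - A. head \<Gamma> e \<in> W}"
proof (intro equalityI subsetI)
  fix x assume "x \<in> shell X Y \<epsilon>"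
  then obtain p where x: "x \<in> mspace X" "p \<in> Y" "mdist X p x = \<epsilon>" "\<And>q. q \<in> Y \<Longrightarrow> \<epsilon> \<le> mdist X q x"
    by (auto simp: shell_def)
  have "mdist X x x = 0" using x(1) by simp
  then have nY: "x \<notin> Y" using x(4)[of x] \<epsilon>(1) by linarith
  from x(1) show "x \<in> (\<lambda>e. pt e \<epsilon>) ` {e \<in> arcs \<Gamma> - A. tail \<Gamma> e \<in> W}
    \<union> (\<lambda>e. pt e (len e - \<epsilon>)) ` {e \<in> arcs \<Gamma> - A. head \<Gamma> e \<in> W}"
  proof (cases rule: mspace_cases)
    case (vertex v)
    then show ?thesis
      using dist_ge_of_adapted[OF Y x(2), of "Vertex v"] x(3) \<epsilon> nY Y by (auto simp: adapted_def)
  next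
    case (inner e t)
    then have "e \<notin> A" using nY Y by (auto simp: adapted_def)
    then consider "tail \<Gamma> e \<in> W" "t \<le> \<epsilon>" | "head \<Gamma> e \<in> W" "len e - t \<le> \<epsilon>"
      using dist_ge_of_adapted[OF Y x(2), of "Inner e t"] inner x(3) \<epsilon>
      by (auto simp: gl_inner min_def split: if_splits)
    then show ?thesis
    proof cases
      case 1
      then have "vt (tail \<Gamma> e) \<in> Y" using Y inner by (auto simp: adapted_def)
      from x(4)[OF this] have "\<epsilon> \<le> t" using dist_pt_le[of e 0 t] inner by auto
      then show ?thesis using 1 inner \<open>e \<notin> A\<close> by auto
    next
      case 2
      then have "vt (head \<Gamma> e) \<in> Y" using Y inner by (auto simp: adapted_def)
      from x(4)[OF this] have "\<epsilon> \<le> len e - t"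
        using dist_pt_le[of e "len e" t] inner len_pos[of e] by (auto simp: gl_len)
      then have "t = len e - \<epsilon>" using 2 by simp
      then show ?thesis using 2 inner \<open>e \<notin> A\<close> by auto
    qed
  qed
next
  fix x assume "x \<in> (\<lambda>e. pt e \<epsilon>) ` {e \<in> arcs \<Gamma> - A. tail \<Gamma> e \<in> W}
    \<union> (\<lambda>e. pt e (len e - \<epsilon>)) ` {e \<in> arcs \<Gamma> - A. head \<Gamma> e \<in> W}"
  then consider e where "e \<in> arcs \<Gamma>" "e \<notin> A" "tail \<Gamma> e \<in> W" "x = pt e \<epsilon>"
    | e where "e \<in> arcs \<Gamma>" "e \<notin> A" "head \<Gamma> e \<in> W" "x = pt e (len e - \<epsilon>)" by auto
  then show "x \<in> shell X Y \<epsilon>"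
  proof cases
    case 1
    note r = rad_le[OF 1(1)]
    have "vt (tail \<Gamma> e) \<in> Y" using 1 Y by (auto simp: adapted_def)
    moreover have "mdist X (vt (tail \<Gamma> e)) x = \<epsilon>" using dist_pt[OF 1(1), of 0 \<epsilon>] 1 \<epsilon> r by simp
    moreover have "\<epsilon> \<le> mdist X q x" if "q \<in> Y" for q
      using dist_ge_of_adapted[OF Y that, of "gl e \<epsilon>"] 1 \<epsilon> r by (simp add: gl_inner)
    moreover have "x \<in> mspace X" using 1 \<epsilon> r by (simp add: pt_in)
    ultimately show ?thesis by (auto simp: shell_def)
  next
    case 2
    note r = rad_le[OF 2(1)]
    have "vt (head \<Gamma> e) \<in> Y" using 2 Y by (auto simp: adapted_def)
    moreover have "mdist X (vt (head \<Gamma> e)) x = \<epsilon>"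
      using dist_pt[OF 2(1), of "len e" "len e - \<epsilon>"] 2 \<epsilon> r by (simp add: gl_len)
    moreover have "\<epsilon> \<le> mdist X q x" if "q \<in> Y" for q
      using dist_ge_of_adapted[OF Y that, of "gl e (len e - \<epsilon>)"] 2 \<epsilon> r by (simp add: gl_inner)
    moreover have "x \<in> mspace X" using 2 \<epsilon> r by (simp add: pt_in)
    ultimately show ?thesis by (auto simp: shell_def)
  qed
qed

lemma finite_shell: "adapted Y W A \<Longrightarrow> 0 < \<epsilon> \<Longrightarrow> \<epsilon> < rad \<Longrightarrow> finite (shell X Y \<epsilon>)"
  by (simp add: shell_adapted)

text \<open>Since \<epsilon> is less than half of every edge length, the points near the two ends of
  an edge are distinct, and the sum over the shell counts edge ends with the same multiplicity as
  \<open>valence\<close>.\<close>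

lemma sum_shell:
  assumes Y: "adapted Y W A" and \<epsilon>: "0 < \<epsilon>" "\<epsilon> < rad"
  shows "(\<Sum>x\<in>shell X Y \<epsilon>. g x) = (\<Sum>e | e \<in> arcs \<Gamma> - A \<and> tail \<Gamma> e \<in> W. g (pt e \<epsilon>))
    + (\<Sum>e | e \<in> arcs \<Gamma> - A \<and> head \<Gamma> e \<in> W. g (pt e (len e - \<epsilon>)))"
proof -
  have lt: "\<epsilon> < len e / 2" if "e \<in> arcs \<Gamma>" for e using rad_le[OF that] \<epsilon> by simp
  have eq: "pt e s = pt e' s' \<longleftrightarrow> e = e' \<and> s = s'"
    if "e \<in> arcs \<Gamma>" "e' \<in> arcs \<Gamma>" "s = \<epsilon> \<or> s = len e - \<epsilon>" "s' = \<epsilon> \<or> s' = len e' - \<epsilon>" for e e' s s'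
    using pt_eq_iff[of e' s' e s] lt[of e] lt[of e'] that \<epsilon> by auto
  have "inj_on (\<lambda>e. pt e \<epsilon>) {e \<in> arcs \<Gamma> - A. tail \<Gamma> e \<in> W}"
    "inj_on (\<lambda>e. pt e (len e - \<epsilon>)) {e \<in> arcs \<Gamma> - A. head \<Gamma> e \<in> W}"
    using eq by (auto simp: inj_on_def)
  moreover have "(\<lambda>e. pt e \<epsilon>) ` {e \<in> arcs \<Gamma> - A. tail \<Gamma> e \<in> W}
      \<inter> (\<lambda>e. pt e (len e - \<epsilon>)) ` {e \<in> arcs \<Gamma> - A. head \<Gamma> e \<in> W} = {}"
  proof -
    have "pt e \<epsilon> \<noteq> pt e' (len e' - \<epsilon>)" if "e \<in> arcs \<Gamma>" "e' \<in> arcs \<Gamma>" for e e'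
      using eq[of e e' \<epsilon> "len e' - \<epsilon>"] that lt[of e'] by auto
    then show ?thesis by blast
  qed
  ultimately show ?thesis
    unfolding shell_adapted[OF assms] by (subst sum.union_disjoint) (simp_all add: sum.reindex)
qed

definition boundary :: "nat set \<Rightarrow> nat set \<Rightarrow> nat" where
  "boundary W A = card {e \<in> arcs \<Gamma> - A. tail \<Gamma> e \<in> W} + card {e \<in> arcs \<Gamma> - A. head \<Gamma> e \<in> W}"

lemma card_shell: "adapted Y W A \<Longrightarrow> 0 < \<epsilon> \<Longrightarrow> \<epsilon> < rad \<Longrightarrow> card (shell X Y \<epsilon>) = boundary W A"
  using sum_shell[of Y W A \<epsilon> "\<lambda>_. 1 :: nat"] by (simp add: boundary_def)

lemma sum_valence:
  assumes "finite W"
  shows "(\<Sum>v\<in>W. valence \<Gamma> (arcs \<Gamma> - A) v) = boundary W A"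
proof -
  have "(\<Sum>v\<in>W. card (in_arcs \<Gamma> v \<inter> (arcs \<Gamma> - A))) = card (\<Union>v\<in>W. in_arcs \<Gamma> v \<inter> (arcs \<Gamma> - A))"
    by (rule card_UN_disjoint[symmetric]) (auto simp: assms in_arcs_def)
  moreover have "(\<Union>v\<in>W. in_arcs \<Gamma> v \<inter> (arcs \<Gamma> - A)) = {e \<in> arcs \<Gamma> - A. head \<Gamma> e \<in> W}"
    by (auto simp: in_arcs_def)
  moreover have "(\<Sum>v\<in>W. card (out_arcs \<Gamma> v \<inter> (arcs \<Gamma> - A))) = card (\<Union>v\<in>W. out_arcs \<Gamma> v \<inter> (arcs \<Gamma> - A))"
    by (rule card_UN_disjoint[symmetric]) (auto simp: assms out_arcs_def)
  moreover have "(\<Union>v\<in>W. out_arcs \<Gamma> v \<inter> (arcs \<Gamma> - A)) = {e \<in> arcs \<Gamma> - A. tail \<Gamma> e \<in> W}"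
    by (auto simp: out_arcs_def)
  ultimately show ?thesis by (simp add: valence_def sum.distrib boundary_def)
qed

end

text \<open>For \<epsilon> below the radii of two models, both boundary counts equal the cardinality
  of the same shell. This is also what makes the definite description in \<open>delta\<close>
  meaningful.\<close>

lemma delta_eqI:
  assumes "curve_model X \<Gamma> len \<phi>" and "curve_model.adapted X \<Gamma> len \<phi> Y W A"
  shows "delta X Y = curve_model.boundary \<Gamma> W A"
proof -
  interpret curve_model X \<Gamma> len \<phi> by fact
  note Y = assms(2)
  have fin: "finite W" using Y finite_subset[OF _ finite_verts] by (auto simp: adapted_def)
  show ?thesis
    unfolding delta_def
  proof (rule the_equality)
    obtain \<Delta> where "subgraph \<Delta> \<Gamma>" "Y = \<phi> ` graph_points \<Delta> len" "verts \<Delta> = W" "arcs \<Delta> = A"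
      using adapted_subgraph[OF Y] .
    then show "\<exists>\<Gamma> \<Delta>. induces X \<Gamma> \<Delta> Y \<and> boundary W A = (\<Sum>v\<in>verts \<Delta>. valence \<Gamma> (arcs \<Gamma> - arcs \<Delta>) v)"
      using model sum_valence[OF fin, of A] unfolding induces_def by (intro exI[of _ \<Gamma>] exI[of _ \<Delta>]) auto
  next
    fix n assume "\<exists>\<Gamma> \<Delta>. induces X \<Gamma> \<Delta> Y \<and> n = (\<Sum>v\<in>verts \<Delta>. valence \<Gamma> (arcs \<Gamma> - arcs \<Delta>) v)"
    then obtain \<Gamma>' \<Delta>' len' \<phi>' where m: "model X \<Gamma>' len' \<phi>'" "subgraph \<Delta>' \<Gamma>'" "Y = \<phi>' ` graph_points \<Delta>' len'"
      and n: "n = (\<Sum>v\<in>verts \<Delta>'. valence \<Gamma>' (arcs \<Gamma>' - arcs \<Delta>') v)"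
      unfolding induces_def by blast
    interpret B: curve_model X \<Gamma>' len' \<phi>' by unfold_locales fact
    have Y': "B.adapted Y (verts \<Delta>') (arcs \<Delta>')" using B.adapted_of_subgraph[OF m(2)] m(3) by simp
    have fin': "finite (verts \<Delta>')" using Y' finite_subset[OF _ B.finite_verts] by (auto simp: B.adapted_def)
    define \<epsilon> where "\<epsilon> = min rad B.rad / 2"
    have "0 < \<epsilon>" "\<epsilon> < rad" "\<epsilon> < B.rad" using rad_pos B.rad_pos by (auto simp: \<epsilon>_def min_def)
    then show "n = boundary W A"
      using card_shell[OF Y, of \<epsilon>] B.card_shell[OF Y', of \<epsilon>] n B.sum_valence[OF fin'] by simp
  qed
qed

lemmas (in curve_model) delta_eq = delta_eqI[OF curve_model_axioms]

lemma (in curve_model) has_ord_vertex: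
  assumes f: "linear_on_edges \<Gamma> len \<phi> f a" and v: "v \<in> verts \<Gamma>"
  shows "has_ord X f (vt v) ((\<Sum>e\<in>in_arcs \<Gamma> v. a e) + (\<Sum>e\<in>out_arcs \<Gamma> v. - a e))"
proof -
  have "\<forall>\<^sub>F \<epsilon> in at_right 0. 0 < \<epsilon> \<and> \<epsilon> < rad"
    using rad_pos by (auto simp: eventually_at_right_field)
  then show ?thesis
    unfolding has_ord_def
  proof eventually_elim
    case (elim \<epsilon>)
    have lt: "\<epsilon> < len e / 2" if "e \<in> arcs \<Gamma>" for e using rad_le[OF that] elim by simp
    have "(\<Sum>x\<in>shell X {vt v} \<epsilon>. f (vt v) - f x)
      = (\<Sum>e\<in>out_arcs \<Gamma> v. f (vt v) - f (pt e \<epsilon>)) + (\<Sum>e\<in>in_arcs \<Gamma> v. f (vt v) - f (pt e (len e - \<epsilon>)))"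
      using sum_shell[OF adapted_vertex[OF v], of \<epsilon> "\<lambda>x. f (vt v) - f x"] elim
      by (simp add: in_arcs_def out_arcs_def)
    also have "(\<Sum>e\<in>out_arcs \<Gamma> v. f (vt v) - f (pt e \<epsilon>)) = (\<Sum>e\<in>out_arcs \<Gamma> v. of_int (- a e) * \<epsilon>)"
    proof (rule sum.cong)
      fix e assume e: "e \<in> out_arcs \<Gamma> v"
      then have "f (pt e \<epsilon>) = f (pt e 0) + of_int (a e) * \<epsilon>"
        using f lt[of e] elim unfolding linear_on_edges_def by (auto simp: out_arcs_def)
      then show "f (vt v) - f (pt e \<epsilon>) = of_int (- a e) * \<epsilon>" using e by (simp add: out_arcs_def)
    qed simp
    also have "(\<Sum>e\<in>in_arcs \<Gamma> v. f (vt v) - f (pt e (len e - \<epsilon>))) = (\<Sum>e\<in>in_arcs \<Gamma> v. of_int (a e) * \<epsilon>)"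
    proof (rule sum.cong)
      fix e assume e: "e \<in> in_arcs \<Gamma> v"
      then have ea: "e \<in> arcs \<Gamma>" by (simp add: in_arcs_def)
      have "f (pt e (len e - \<epsilon>)) = f (pt e 0) + of_int (a e) * (len e - \<epsilon>)"
        "f (pt e (len e)) = f (pt e 0) + of_int (a e) * len e"
        using f lt[OF ea] elim ea unfolding linear_on_edges_def by auto
      then show "f (vt v) - f (pt e (len e - \<epsilon>)) = of_int (a e) * \<epsilon>"
        using e ea by (simp add: in_arcs_def gl_len algebra_simps)
    qed simp
    finally show ?case unfolding sum_distrib_right[symmetric] of_int_add of_int_sum distrib_right by simp
  qed
qed

section \<open>Rational functions and divisors\<close>

context two_models
begin

text \<open>By \<open>edge_affine\<close> each edge of the finer model traverses one edge of the
  coarser model at unit speed, so slopes change at most their sign.\<close>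

lemma linear_refine:
  assumes f: "linear_on_edges \<Gamma>\<^sub>1 len\<^sub>1 \<phi>\<^sub>1 f b" and sub: "B.vt ` verts \<Gamma>\<^sub>1 \<subseteq> A.vt ` verts \<Gamma>"
  shows "\<exists>a. linear_on_edges \<Gamma> len \<phi> f a"
proof -
  have "\<exists>k :: int. \<forall>t\<in>{0..len e}. f (A.pt e t) = f (A.pt e 0) + of_int k * t" if e: "e \<in> arcs \<Gamma>" for e
  proof -
    obtain e1 \<sigma> c where e1: "e1 \<in> arcs \<Gamma>\<^sub>1" "\<sigma> = 1 \<or> \<sigma> = - 1"
      "\<And>s. s \<in> {0..len e} \<Longrightarrow> c + \<sigma> * s \<in> {0..len\<^sub>1 e1}"
      "\<And>s. s \<in> {0..len e} \<Longrightarrow> A.pt e s = B.pt e1 (c + \<sigma> * s)"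
      using edge_affine[OF e sub] by metis
    have f1: "f (A.pt e s) = f (B.pt e1 0) + of_int (b e1) * (c + \<sigma> * s)" if "s \<in> {0..len e}" for s
      using f e1(1) e1(3)[OF that] e1(4)[OF that] unfolding linear_on_edges_def by metis
    have "0 \<in> {0..len e}" using A.len_pos[OF e] by simp
    from f1[OF this] have f0: "f (A.pt e 0) = f (B.pt e1 0) + of_int (b e1) * c" by simp
    have "f (A.pt e s) = f (A.pt e 0) + of_int (if \<sigma> = 1 then b e1 else - b e1) * s" if "s \<in> {0..len e}" for s
      using e1(2) unfolding f0 f1[OF that] by (auto simp: algebra_simps)
    then show ?thesis by blast
  qed
  then show ?thesis unfolding linear_on_edges_def by metis
qed

end

text \<open>The vertices of the model that witnesses rationality serve as \<open>F\<close>. In this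
  form several functions can be made linear in one common model.\<close>

lemma rational_function_linear:
  assumes "rational_function X f"
  obtains F where "finite F" "F \<subseteq> mspace X"
    "\<And>\<Gamma> len \<phi>. model X \<Gamma> len \<phi> \<Longrightarrow> F \<subseteq> \<phi> ` Vertex ` verts \<Gamma> \<Longrightarrow> \<exists>a. linear_on_edges \<Gamma> len \<phi> f a"
proof -
  obtain \<Gamma>' len' \<phi>' b where m: "model X \<Gamma>' len' \<phi>'" "linear_on_edges \<Gamma>' len' \<phi>' f b"
    using assms by (auto simp: rational_function_def)
  interpret B: curve_model X \<Gamma>' len' \<phi>' by unfold_locales fact
  show ?thesis
  proof (rule that)
    show "finite (B.vt ` verts \<Gamma>')" by simp
    show "B.vt ` verts \<Gamma>' \<subseteq> mspace X" using B.vt_in by blast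
    fix \<Gamma> len \<phi> assume a: "model X \<Gamma> len \<phi>" "B.vt ` verts \<Gamma>' \<subseteq> \<phi> ` Vertex ` verts \<Gamma>"
    interpret A: curve_model X \<Gamma> len \<phi> by unfold_locales fact
    interpret two_models X \<Gamma> len \<phi> \<Gamma>' len' \<phi>' ..
    show "\<exists>a. linear_on_edges \<Gamma> len \<phi> f a"
      using linear_refine[OF m(2)] a(2) by (simp add: image_image)
  qed
qed

text \<open>This allows orders to be computed on small spheres of any convenient model, even one
  inside whose edges \<open>f\<close> bends. The witness required by the definition arises by
  refining at the break points and at \<open>p\<close>.\<close>

lemma ord_at_eq:
  assumes f: "rational_function X f" and p: "p \<in> mspace X" and k: "has_ord X f p k"
  shows "ord_at X f p = k"
proof -
  obtain F where F: "finite F" "F \<subseteq> mspace X"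
    "\<And>\<Gamma> len \<phi>. model X \<Gamma> len \<phi> \<Longrightarrow> F \<subseteq> \<phi> ` Vertex ` verts \<Gamma> \<Longrightarrow> \<exists>a. linear_on_edges \<Gamma> len \<phi> f a"
    using rational_function_linear[OF f] by metis
  obtain \<Gamma>' len' \<phi>' where "model X \<Gamma>' len' \<phi>'"
    using f by (auto simp: rational_function_def)
  then obtain \<Gamma> len \<phi> where m: "model X \<Gamma> len \<phi>" "insert p F \<union> \<phi>' ` Vertex ` verts \<Gamma>' \<subseteq> \<phi> ` Vertex ` verts \<Gamma>"
    using model_refine[of X \<Gamma>' len' \<phi>' "insert p F"] F p by (metis finite_insert insert_subset)
  then obtain a where a: "linear_on_edges \<Gamma> len \<phi> f a" using F(3) by blast
  obtain v where v: "v \<in> verts \<Gamma>" "\<phi> (Vertex v) = p" using m(2) by auto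
  show ?thesis
    unfolding ord_at_def
  proof (rule the_equality)
    interpret curve_model X \<Gamma> len \<phi> by unfold_locales fact
    show "\<exists>\<Gamma> len \<phi> a v. model X \<Gamma> len \<phi> \<and> linear_on_edges \<Gamma> len \<phi> f a \<and> v \<in> verts \<Gamma> \<and> \<phi> (Vertex v) = p \<and>
        k = (\<Sum>e\<in>in_arcs \<Gamma> v. a e) + (\<Sum>e\<in>out_arcs \<Gamma> v. - a e)"
      using m(1) a v has_ord_unique[OF k, of "(\<Sum>e\<in>in_arcs \<Gamma> v. a e) + (\<Sum>e\<in>out_arcs \<Gamma> v. - a e)"]
        has_ord_vertex[OF a v(1)] by blast
  next
    fix k' assume "\<exists>\<Gamma> len \<phi> a v. model X \<Gamma> len \<phi> \<and> linear_on_edges \<Gamma> len \<phi> f a \<and> v \<in> verts \<Gamma> \<and> \<phi> (Vertex v) = p \<and>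
        k' = (\<Sum>e\<in>in_arcs \<Gamma> v. a e) + (\<Sum>e\<in>out_arcs \<Gamma> v. - a e)"
    then obtain \<Gamma> len \<phi> a v where h: "model X \<Gamma> len \<phi>" "linear_on_edges \<Gamma> len \<phi> f a" "v \<in> verts \<Gamma>" "\<phi> (Vertex v) = p"
      "k' = (\<Sum>e\<in>in_arcs \<Gamma> v. a e) + (\<Sum>e\<in>out_arcs \<Gamma> v. - a e)" by blast
    interpret curve_model X \<Gamma> len \<phi> by unfold_locales fact
    show "k' = k" using has_ord_unique[OF k] has_ord_vertex[OF h(2,3)] h(4,5) by metis
  qed
qed

context curve_model
begin

lemma linear_imp_rational:
  assumes f: "linear_on_edges \<Gamma> len \<phi> f a"
  shows "rational_function X f"
proof -
  \<comment> \<open>The summand 1 keeps \<open>C\<close> positive when all slopes vanish, so that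
    \<open>f\<close> divided by \<open>C\<close> can serve as a test function.\<close>
  define C where "C = 1 + (\<Sum>e\<in>arcs \<Gamma>. \<bar>of_int (a e)\<bar> :: real)"
  have C: "0 < C" unfolding C_def by (intro add_pos_nonneg sum_nonneg) auto
  have aC: "\<bar>of_int (a e)\<bar> \<le> C" if "e \<in> arcs \<Gamma>" for e
    using member_le_sum[OF that, of "\<lambda>e. \<bar>of_int (a e)\<bar> :: real"] by (simp add: C_def)
  have "\<bar>f p - f q\<bar> \<le> C * mdist X p q" if pq: "p \<in> mspace X" "q \<in> mspace X" for p q
  proof -
    obtain x y where x: "x \<in> points" "p = \<phi> x" and y: "y \<in> points" "q = \<phi> y" using pq \<phi>_image by blast
    have "\<bar>f (\<phi> x) / C - f (\<phi> y) / C\<bar> \<le> gd x y"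
    proof (rule dist_ge_lipschitz[OF x(1) y(1)])
      fix e s t assume e: "e \<in> arcs \<Gamma>" "s \<in> {0..len e}" "t \<in> {0..len e}"
      have "f (pt e s) - f (pt e t) = of_int (a e) * (s - t)"
        using f e unfolding linear_on_edges_def by (simp add: algebra_simps)
      then have "\<bar>f (pt e s) - f (pt e t)\<bar> \<le> C * \<bar>s - t\<bar>"
        using aC[OF e(1)] by (simp add: abs_mult mult_right_mono)
      then show "\<bar>f (pt e s) / C - f (pt e t) / C\<bar> \<le> \<bar>s - t\<bar>"
        using C by (simp add: diff_divide_distrib[symmetric] abs_divide divide_le_eq mult.commute)
    qed
    then show ?thesis
      using C x y \<phi>_dist[OF x(1) y(1)] by (simp add: diff_divide_distrib[symmetric] abs_divide divide_le_eq mult.commute)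
  qed
  then have "Lipschitz_continuous_map X euclidean_metric f"
    unfolding Lipschitz_continuous_map_def by (auto simp: dist_real_def)
  then have "continuous_map (mtopology_of X) euclideanreal f"
    using Lipschitz_continuous_imp_continuous_map by fastforce
  then show ?thesis using f model unfolding rational_function_def by blast
qed

lemma shell_inner:
  assumes e: "e \<in> arcs \<Gamma>" "0 < t" "t < len e" and \<epsilon>: "0 < \<epsilon>" "\<epsilon> < t" "\<epsilon> < len e - t"
  shows "shell X {pt e t} \<epsilon> = {pt e (t - \<epsilon>), pt e (t + \<epsilon>)}"
proof -
  have p: "gl e t \<in> points" using e by (simp add: gl_in_points)
  have "shell X {pt e t} \<epsilon> = \<phi> ` {z \<in> points. gd (gl e t) z = \<epsilon>}"
    using \<phi>_dist[OF p] unfolding shell_def \<phi>_image[symmetric] by auto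
  then show ?thesis using sphere_inner[OF e \<epsilon>] by simp
qed

lemma has_ord_inner:
  assumes e: "e \<in> arcs \<Gamma>" "0 < t" "t < len e"
    and k: "\<forall>\<^sub>F \<epsilon> in at_right 0. 2 * f (pt e t) - f (pt e (t - \<epsilon>)) - f (pt e (t + \<epsilon>)) = of_int k * \<epsilon>"
  shows "has_ord X f (pt e t) k"
proof -
  have "\<forall>\<^sub>F \<epsilon> in at_right 0. 0 < \<epsilon> \<and> \<epsilon> < min t (len e - t)"
    unfolding eventually_at_right_field using e by (intro exI[of _ "min t (len e - t)"]) simp
  with k show ?thesis
    unfolding has_ord_def
  proof eventually_elim
    case (elim \<epsilon>)
    have "pt e (t - \<epsilon>) \<noteq> pt e (t + \<epsilon>)" using pt_eq_iff[of e "t + \<epsilon>" e "t - \<epsilon>"] e elim by auto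
    then show ?case using shell_inner[OF e, of \<epsilon>] elim by simp
  qed
qed

lemma div_of_vertex:
  assumes "linear_on_edges \<Gamma> len \<phi> f a" "v \<in> verts \<Gamma>"
  shows "div_of X f (vt v) = (\<Sum>e\<in>in_arcs \<Gamma> v. a e) + (\<Sum>e\<in>out_arcs \<Gamma> v. - a e)"
  using ord_at_eq[OF linear_imp_rational[OF assms(1)] vt_in[OF assms(2)] has_ord_vertex[OF assms]] vt_in[OF assms(2)]
  by (simp add: div_of_def)

lemma sum_in_out_arcs:
  fixes a b :: "nat \<Rightarrow> 'b :: comm_monoid_add"
  assumes "W \<subseteq> verts \<Gamma>"
  shows "(\<Sum>v\<in>W. (\<Sum>e\<in>in_arcs \<Gamma> v. a e) + (\<Sum>e\<in>out_arcs \<Gamma> v. b e))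
    = (\<Sum>e | e \<in> arcs \<Gamma> \<and> head \<Gamma> e \<in> W. a e) + (\<Sum>e | e \<in> arcs \<Gamma> \<and> tail \<Gamma> e \<in> W. b e)"
proof -
  have fin: "finite W" using assms finite_subset[OF _ finite_verts] by auto
  have "(\<Sum>v\<in>W. \<Sum>e\<in>in_arcs \<Gamma> v. a e) = (\<Sum>v\<in>W. \<Sum>e | e \<in> {e \<in> arcs \<Gamma>. head \<Gamma> e \<in> W} \<and> head \<Gamma> e = v. a e)"
    by (intro sum.cong refl) (auto simp: in_arcs_def)
  also have "\<dots> = (\<Sum>e | e \<in> arcs \<Gamma> \<and> head \<Gamma> e \<in> W. a e)"
    by (rule sum.group) (use fin in auto)
  finally have 1: "(\<Sum>v\<in>W. \<Sum>e\<in>in_arcs \<Gamma> v. a e) = (\<Sum>e | e \<in> arcs \<Gamma> \<and> head \<Gamma> e \<in> W. a e)" .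
  have "(\<Sum>v\<in>W. \<Sum>e\<in>out_arcs \<Gamma> v. b e) = (\<Sum>v\<in>W. \<Sum>e | e \<in> {e \<in> arcs \<Gamma>. tail \<Gamma> e \<in> W} \<and> tail \<Gamma> e = v. b e)"
    by (intro sum.cong refl) (auto simp: out_arcs_def)
  also have "\<dots> = (\<Sum>e | e \<in> arcs \<Gamma> \<and> tail \<Gamma> e \<in> W. b e)"
    by (rule sum.group) (use fin in auto)
  finally show ?thesis using 1 by (simp add: sum.distrib)
qed

section \<open>Degrees, cuts and beta on subcurves spanned by vertex sets\<close>

lemma total_on_vertices:
  assumes "\<And>p. g p \<noteq> 0 \<Longrightarrow> p \<in> vt ` verts \<Gamma>"
  shows "total_on_set g Y = (\<Sum>v | v \<in> verts \<Gamma> \<and> vt v \<in> Y. g (vt v))"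
proof -
  have inj: "inj_on vt {v \<in> verts \<Gamma>. vt v \<in> Y}" by (auto simp: inj_on_def vt_eq_iff)
  have "total_on_set g Y = (\<Sum>p\<in>vt ` {v \<in> verts \<Gamma>. vt v \<in> Y}. g p)"
    unfolding total_on_set_def by (rule sum.mono_neutral_left) (use assms in auto)
  then show ?thesis using inj by (simp add: sum.reindex)
qed

text \<open>Including all edges with both ends in \<open>W\<close> leaves only the edges of the cut
  in \<delta>.\<close>

definition region :: "nat set \<Rightarrow> 'a set" where
  "region W = \<phi> ` graph_points (\<Gamma> \<restriction> W) len"

lemma adapted_region:
  assumes "W \<subseteq> verts \<Gamma>"
  shows "adapted (region W) W {e \<in> arcs \<Gamma>. tail \<Gamma> e \<in> W \<and> head \<Gamma> e \<in> W}"
  using adapted_of_subgraph[of "\<Gamma> \<restriction> W"] assms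
  by (simp add: region_def subgraphI wellformed_induce_subgraph induced_imp_subgraph induced_induce)

definition cut :: "nat set \<Rightarrow> nat" where
  "cut W = card {e \<in> arcs \<Gamma>. tail \<Gamma> e \<in> W \<and> head \<Gamma> e \<notin> W} + card {e \<in> arcs \<Gamma>. head \<Gamma> e \<in> W \<and> tail \<Gamma> e \<notin> W}"

lemma delta_region: "W \<subseteq> verts \<Gamma> \<Longrightarrow> delta X (region W) = cut W"
proof -
  have "{e \<in> arcs \<Gamma> - {e \<in> arcs \<Gamma>. tail \<Gamma> e \<in> W \<and> head \<Gamma> e \<in> W}. tail \<Gamma> e \<in> W}
      = {e \<in> arcs \<Gamma>. tail \<Gamma> e \<in> W \<and> head \<Gamma> e \<notin> W}"
    "{e \<in> arcs \<Gamma> - {e \<in> arcs \<Gamma>. tail \<Gamma> e \<in> W \<and> head \<Gamma> e \<in> W}. head \<Gamma> e \<in> W}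
      = {e \<in> arcs \<Gamma>. head \<Gamma> e \<in> W \<and> tail \<Gamma> e \<notin> W}" by auto
  then show "W \<subseteq> verts \<Gamma> \<Longrightarrow> ?thesis" using delta_eq[OF adapted_region, of W] by (simp add: boundary_def cut_def)
qed

text \<open>Complementation exchanges the two summands, so the subcurves spanned by \<open>W\<close>
  and by its complement have the same \<delta>.\<close>

lemma cut_complement: "cut (verts \<Gamma> - W) = cut W"
proof -
  have "{e \<in> arcs \<Gamma>. tail \<Gamma> e \<in> verts \<Gamma> - W \<and> head \<Gamma> e \<notin> verts \<Gamma> - W} = {e \<in> arcs \<Gamma>. head \<Gamma> e \<in> W \<and> tail \<Gamma> e \<notin> W}"
    "{e \<in> arcs \<Gamma>. head \<Gamma> e \<in> verts \<Gamma> - W \<and> tail \<Gamma> e \<notin> verts \<Gamma> - W} = {e \<in> arcs \<Gamma>. tail \<Gamma> e \<in> W \<and> head \<Gamma> e \<notin> W}"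
    using head_in_verts tail_in_verts by auto
  then show ?thesis by (simp add: cut_def)
qed

lemma beta_region:
  assumes W: "W \<subseteq> verts \<Gamma>"
    and "\<And>p. D p \<noteq> 0 \<Longrightarrow> p \<in> vt ` verts \<Gamma>" "\<And>p. \<mu> p \<noteq> 0 \<Longrightarrow> p \<in> vt ` verts \<Gamma>"
  shows "beta X \<mu> D (region W) = (\<Sum>v\<in>W. of_int (D (vt v)) - \<mu> (vt v)) + cut W / 2"
proof -
  have "{v. v \<in> verts \<Gamma> \<and> vt v \<in> region W} = W"
    using adapted_region[OF W] W by (auto simp: adapted_def)
  then show ?thesis
    using total_on_vertices[of D "region W"] total_on_vertices[of \<mu> "region W"] assms(2,3) delta_region[OF W]
    by (simp add: beta_def degree_on_def sum_subtractf)
qed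

end

section \<open>Minimisation of the energy\<close>

text \<open>The convex piecewise linear function that interpolates the squares of the integers.\<close>

definition interp_sq :: "real \<Rightarrow> real" where
  "interp_sq s = (2 * of_int \<lfloor>s\<rfloor> + 1) * s - of_int \<lfloor>s\<rfloor> * (of_int \<lfloor>s\<rfloor> + 1)"

text \<open>The chords of the square function lie below its piecewise linear interpolation: for m
  the floor of s, the chords of m and n differ by (m - n)(2s - m - n - 1), and these factors never
  have opposite signs.\<close>

lemma interp_sq_ge_line: "(2 * of_int n + 1) * s - of_int n * (of_int n + 1) \<le> interp_sq s"
proof -
  define m where "m = \<lfloor>s\<rfloor>"
  have m: "of_int m \<le> s" "s < of_int m + 1" by (simp_all add: m_def)
  have "0 \<le> (real_of_int m - of_int n) * (2 * s - of_int m - of_int n - 1)"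
  proof (cases "n < m")
    case True
    then have "real_of_int n + 1 \<le> of_int m" by linarith
    then show ?thesis using m by (intro mult_nonneg_nonneg) auto
  next
    case False
    then consider "m = n" | "real_of_int m + 1 \<le> of_int n" by linarith
    then show ?thesis
    proof cases
      case 2
      then show ?thesis using m by (intro mult_nonpos_nonpos) auto
    qed simp
  qed
  then show ?thesis by (simp add: interp_sq_def m_def[symmetric] algebra_simps)
qed

lemma interp_sq_ge_square: "s\<^sup>2 \<le> interp_sq s"
proof -
  have "0 \<le> (s - of_int \<lfloor>s\<rfloor>) * (of_int \<lfloor>s\<rfloor> + 1 - s)"
    by (intro mult_nonneg_nonneg) linarith+
  then show ?thesis by (simp add: interp_sq_def power2_eq_square algebra_simps)
qed

lemma interp_sq_0 [simp]: "interp_sq 0 = 0"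
  by (simp add: interp_sq_def)

text \<open>The chord through the floor of the intermediate point supports the function there.
  Convexity is used to obtain continuity.\<close>

lemma convex_on_interp_sq: "convex_on UNIV interp_sq"
proof (rule convex_onI)
  fix u x y :: real assume u: "0 < u" "u < 1"
  define z where "z = (1 - u) *\<^sub>R x + u *\<^sub>R y"
  define l where "l t = (2 * of_int \<lfloor>z\<rfloor> + 1) * t - of_int \<lfloor>z\<rfloor> * (of_int \<lfloor>z\<rfloor> + 1)" for t :: real
  have "interp_sq z = (1 - u) * l x + u * l y"
    by (simp add: interp_sq_def l_def z_def[symmetric]) (simp add: z_def algebra_simps)
  also have "\<dots> \<le> (1 - u) * interp_sq x + u * interp_sq y"
    using u by (intro add_mono mult_left_mono) (auto simp: l_def interp_sq_ge_line)
  finally show "interp_sq ((1 - u) *\<^sub>R x + u *\<^sub>R y) \<le> (1 - u) * interp_sq x + u * interp_sq y"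
    by (simp add: z_def)
qed simp

lemma continuous_on_interp_sq: "continuous_on S interp_sq"
  using convex_on_continuous[OF open_UNIV convex_on_interp_sq] continuous_on_subset by blast

text \<open>To the right of \<open>s\<close> the function has slope
  \<open>2 * of_int \<lfloor>s\<rfloor> + 1\<close>; the factor \<open>l / 2\<close> and the
  increment \<open>\<epsilon> / l\<close> turn this into the floor plus 1/2. The expansion is exact
  for small \<epsilon> because the function is piecewise linear.\<close>

lemma interp_sq_right:
  assumes l: "0 < l"
  shows "\<forall>\<^sub>F \<epsilon> in at_right 0. l / 2 * interp_sq (s + \<epsilon> / l) = l / 2 * interp_sq s + (of_int \<lfloor>s\<rfloor> + 1 / 2) * \<epsilon>"
  unfolding eventually_at_right_field
proof (intro exI[of _ "l * (of_int \<lfloor>s\<rfloor> + 1 - s)"] conjI allI impI)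
  show "0 < l * (of_int \<lfloor>s\<rfloor> + 1 - s)" using l by (intro mult_pos_pos) linarith+
  fix \<epsilon> :: real assume \<epsilon>: "0 < \<epsilon>" "\<epsilon> < l * (of_int \<lfloor>s\<rfloor> + 1 - s)"
  then have "\<epsilon> / l < of_int \<lfloor>s\<rfloor> + 1 - s" "0 < \<epsilon> / l" using l by (simp_all add: field_simps)
  then have "\<lfloor>s + \<epsilon> / l\<rfloor> = \<lfloor>s\<rfloor>" by linarith
  then show "l / 2 * interp_sq (s + \<epsilon> / l) = l / 2 * interp_sq s + (of_int \<lfloor>s\<rfloor> + 1 / 2) * \<epsilon>"
    using l by (simp add: interp_sq_def field_simps)
qed

lemma interp_sq_left:
  assumes l: "0 < l"
  shows "\<forall>\<^sub>F \<epsilon> in at_right 0. l / 2 * interp_sq (s - \<epsilon> / l) = l / 2 * interp_sq s + (1 / 2 - of_int \<lceil>s\<rceil>) * \<epsilon>"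
  unfolding eventually_at_right_field
proof (intro exI[of _ "l * (s - (of_int \<lceil>s\<rceil> - 1))"] conjI allI impI)
  show "0 < l * (s - (of_int \<lceil>s\<rceil> - 1))" using l by (intro mult_pos_pos) linarith+
  fix \<epsilon> :: real assume \<epsilon>: "0 < \<epsilon>" "\<epsilon> < l * (s - (of_int \<lceil>s\<rceil> - 1))"
  then have "\<epsilon> / l < s - (of_int \<lceil>s\<rceil> - 1)" "0 < \<epsilon> / l" using l by (simp_all add: field_simps)
  then have f: "\<lfloor>s - \<epsilon> / l\<rfloor> = \<lceil>s\<rceil> - 1" by linarith
  \<comment> \<open>At an integer the floor selects the piece to the right of \<open>s\<close>,
    whereas the piece to the left is wanted; both have the same value at \<open>s\<close>.\<close>
  have "interp_sq s = (2 * of_int \<lceil>s\<rceil> - 1) * s - (of_int \<lceil>s\<rceil> - 1) * of_int \<lceil>s\<rceil>"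
  proof (cases "s = of_int \<lfloor>s\<rfloor>")
    case True
    then obtain n where n: "s = of_int n" by blast
    show ?thesis by (simp add: interp_sq_def n algebra_simps)
  next
    case False
    then have "\<lceil>s\<rceil> = \<lfloor>s\<rfloor> + 1" by linarith
    then show ?thesis by (simp add: interp_sq_def algebra_simps)
  qed
  then have "interp_sq (s - \<epsilon> / l) = interp_sq s - (2 * of_int \<lceil>s\<rceil> - 1) * (\<epsilon> / l)"
    by (simp add: interp_sq_def[of "s - \<epsilon> / l"] f algebra_simps)
  moreover have "l / 2 * ((2 * of_int \<lceil>s\<rceil> - 1) * (\<epsilon> / l)) = (of_int \<lceil>s\<rceil> - 1 / 2) * \<epsilon>"
    using l by (simp add: field_simps)
  ultimately show "l / 2 * interp_sq (s - \<epsilon> / l) = l / 2 * interp_sq s + (1 / 2 - of_int \<lceil>s\<rceil>) * \<epsilon>"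
    by (simp add: right_diff_distrib left_diff_distrib)
qed

section \<open>The energy of functions on the vertices\<close>

context mgraph
begin

definition slope :: "('v \<Rightarrow> real) \<Rightarrow> 'e \<Rightarrow> real" where
  "slope x e = (x (head \<Gamma> e) - x (tail \<Gamma> e)) / len e"

text \<open>The first part is the least value of \<open>1/2 \<integral> f'\<^sup>2\<close> over functions with integer slopes and the given vertex values.\<close>

definition energy :: "('v \<Rightarrow> real) \<Rightarrow> ('v \<Rightarrow> real) \<Rightarrow> real" where
  "energy c x = (\<Sum>e\<in>arcs \<Gamma>. len e / 2 * interp_sq (slope x e)) + (\<Sum>v\<in>verts \<Gamma>. c v * x v)"

definition variation :: "('v \<Rightarrow> real) \<Rightarrow> real" where
  "variation x = (\<Sum>e\<in>arcs \<Gamma>. \<bar>x (head \<Gamma> e) - x (tail \<Gamma> e)\<bar>)"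

lemma variation_nonneg: "0 \<le> variation x"
  by (simp add: variation_def sum_nonneg)

lemma connected_verts:
  assumes "W \<subseteq> verts \<Gamma>" "W \<noteq> {}" "\<And>e. e \<in> arcs \<Gamma> \<Longrightarrow> tail \<Gamma> e \<in> W \<longleftrightarrow> head \<Gamma> e \<in> W"
  shows "W = verts \<Gamma>"
proof -
  have "Digraph_Component.connected \<Gamma>" using metric_graph by (simp add: metric_graph_def)
  then show ?thesis using assms unfolding connected_iff by blast
qed

lemma verts_nonempty: "verts \<Gamma> \<noteq> {}"
  using metric_graph by (simp add: metric_graph_def connected_iff)

text \<open>The vertices for which some constant works form a set closed under edges, since crossing
  an edge costs at most one more \<open>variation x\<close>; connectedness makes this set
  everything. The constant does not depend on \<open>x\<close>.\<close>

lemma variation_bound: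
  assumes u: "u \<in> verts \<Gamma>"
  obtains K where "0 \<le> K" "\<And>x v. v \<in> verts \<Gamma> \<Longrightarrow> \<bar>x v - x u\<bar> \<le> K * variation x"
proof -
  define W where "W = {v \<in> verts \<Gamma>. \<exists>K. \<forall>x. \<bar>x v - x u\<bar> \<le> K * variation x}"
  have step: "w \<in> W" if vw: "v \<in> W" "w \<in> verts \<Gamma>" "\<And>x :: 'v \<Rightarrow> real. \<bar>x w - x v\<bar> \<le> variation x" for v w
  proof -
    obtain K where K: "\<And>x. \<bar>x v - x u\<bar> \<le> K * variation x" using vw(1) by (auto simp: W_def)
    have "\<bar>x w - x u\<bar> \<le> (K + 1) * variation x" for x
      using K[of x] vw(3)[of x] by (simp add: algebra_simps)
    then show ?thesis using vw(2) by (auto simp: W_def)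
  qed
  have edge: "\<bar>x (head \<Gamma> e) - x (tail \<Gamma> e)\<bar> \<le> variation x" if "e \<in> arcs \<Gamma>" for e x
    unfolding variation_def by (rule member_le_sum[OF that]) auto
  have "W = verts \<Gamma>"
  proof (rule connected_verts)
    have "u \<in> W" using u by (auto simp: W_def intro: exI[of _ 0])
    then show "W \<noteq> {}" by blast
    fix e assume e: "e \<in> arcs \<Gamma>"
    show "tail \<Gamma> e \<in> W \<longleftrightarrow> head \<Gamma> e \<in> W"
      using step[of "tail \<Gamma> e" "head \<Gamma> e"] step[of "head \<Gamma> e" "tail \<Gamma> e"] edge[OF e] e
      by (auto simp: abs_minus_commute)
  qed (auto simp: W_def)
  then have "\<forall>v\<in>verts \<Gamma>. \<exists>K. \<forall>x. \<bar>x v - x u\<bar> \<le> K * variation x" by (auto simp: W_def)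
  then obtain k where k: "\<And>v x. v \<in> verts \<Gamma> \<Longrightarrow> \<bar>x v - x u\<bar> \<le> k v * variation x" by metis
  show ?thesis
  proof (rule that[of "\<Sum>v\<in>verts \<Gamma>. \<bar>k v\<bar>"])
    fix x :: "'v \<Rightarrow> real" and v assume v: "v \<in> verts \<Gamma>"
    have "k v \<le> (\<Sum>v\<in>verts \<Gamma>. \<bar>k v\<bar>)"
      using member_le_sum[OF v, of "\<lambda>v. \<bar>k v\<bar>"] by auto
    then show "\<bar>x v - x u\<bar> \<le> (\<Sum>v\<in>verts \<Gamma>. \<bar>k v\<bar>) * variation x"
      using k[OF v, of x] mult_right_mono[OF _ variation_nonneg] order_trans by blast
  qed (simp add: sum_nonneg)
qed

text \<open>Slopes do not see constants, and total 0 of \<open>c\<close> expresses that the divisor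
  and the polarization have the same degree. Hence the energy can be minimised over functions
  normalised at one vertex.\<close>

lemma energy_shift:
  assumes "(\<Sum>v\<in>verts \<Gamma>. c v) = 0" and "\<And>v. v \<in> verts \<Gamma> \<Longrightarrow> y v = x v - r"
  shows "energy c y = energy c x"
proof -
  have "(\<Sum>e\<in>arcs \<Gamma>. len e / 2 * interp_sq (slope y e)) = (\<Sum>e\<in>arcs \<Gamma>. len e / 2 * interp_sq (slope x e))"
    by (intro sum.cong) (simp_all add: slope_def assms(2))
  moreover have "(\<Sum>v\<in>verts \<Gamma>. c v * y v) = (\<Sum>v\<in>verts \<Gamma>. c v * x v) - (\<Sum>v\<in>verts \<Gamma>. c v) * r"
    by (simp add: assms(2) right_diff_distrib sum_subtractf sum_distrib_right)
  ultimately show ?thesis using assms(1) by (simp add: energy_def)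
qed

lemma energy_ge_variation:
  assumes c: "(\<Sum>v\<in>verts \<Gamma>. c v) = 0"
  obtains M where "\<And>x. variation x - M \<le> energy c x"
proof -
  obtain u where u: "u \<in> verts \<Gamma>" using verts_nonempty by blast
  obtain K where K: "0 \<le> K" "\<And>x v. v \<in> verts \<Gamma> \<Longrightarrow> \<bar>x v - x u\<bar> \<le> K * variation x"
    using variation_bound[OF u] by metis
  define B where "B = (\<Sum>v\<in>verts \<Gamma>. \<bar>c v\<bar>) * K"
  \<comment> \<open>The linear term costs at most \<open>B * variation x\<close>, so the quadratic
    part has to dominate \<open>(B + 1) * variation x\<close>. Completing the square on an edge of
    length l leaves the constant \<open>(B + 1)\<^sup>2 * l / 2\<close>.\<close>
  define M where "M = (\<Sum>e\<in>arcs \<Gamma>. (B + 1)\<^sup>2 * len e / 2)"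
  have "variation x - M \<le> energy c x" for x
  proof -
    have "(\<Sum>v\<in>verts \<Gamma>. c v * x v) = (\<Sum>v\<in>verts \<Gamma>. c v * (x v - x u))"
      using c by (simp add: right_diff_distrib sum_subtractf sum_distrib_right[symmetric])
    moreover have "- (\<Sum>v\<in>verts \<Gamma>. c v * (x v - x u)) \<le> (\<Sum>v\<in>verts \<Gamma>. \<bar>c v\<bar> * (K * variation x))"
      unfolding sum_negf[symmetric]
    proof (rule sum_mono)
      fix v assume "v \<in> verts \<Gamma>"
      have "- (c v * (x v - x u)) \<le> \<bar>c v\<bar> * \<bar>x v - x u\<bar>" by (metis abs_ge_minus_self abs_mult)
      also have "\<dots> \<le> \<bar>c v\<bar> * (K * variation x)" using K(2)[OF \<open>v \<in> verts \<Gamma>\<close>] by (intro mult_left_mono) auto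
      finally show "- (c v * (x v - x u)) \<le> \<bar>c v\<bar> * (K * variation x)" .
    qed
    ultimately have lin: "- (B * variation x) \<le> (\<Sum>v\<in>verts \<Gamma>. c v * x v)"
      by (simp add: B_def sum_distrib_right mult.assoc)
    have "(B + 1) * variation x - M = (\<Sum>e\<in>arcs \<Gamma>. (B + 1) * \<bar>x (head \<Gamma> e) - x (tail \<Gamma> e)\<bar> - (B + 1)\<^sup>2 * len e / 2)"
      by (simp add: variation_def M_def sum_subtractf sum_distrib_left)
    also have "\<dots> \<le> (\<Sum>e\<in>arcs \<Gamma>. len e / 2 * interp_sq (slope x e))"
    proof (rule sum_mono)
      fix e assume e: "e \<in> arcs \<Gamma>"
      define l where "l = len e"
      define s where "s = slope x e"
      have l: "0 < l" using len_pos[OF e] by (simp add: l_def)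
      have "x (head \<Gamma> e) - x (tail \<Gamma> e) = s * l" using l by (simp add: s_def slope_def l_def)
      then have "(B + 1) * \<bar>x (head \<Gamma> e) - x (tail \<Gamma> e)\<bar> - (B + 1)\<^sup>2 * l / 2 = l / 2 * (\<bar>s\<bar>\<^sup>2 - (\<bar>s\<bar> - (B + 1))\<^sup>2)"
        using l by (simp add: abs_mult power2_eq_square algebra_simps)
      also have "\<dots> \<le> l / 2 * interp_sq s"
        using l interp_sq_ge_square[of s] by (intro mult_left_mono) (auto intro: order_trans[OF _ interp_sq_ge_square])
      finally show "(B + 1) * \<bar>x (head \<Gamma> e) - x (tail \<Gamma> e)\<bar> - (B + 1)\<^sup>2 * len e / 2 \<le> len e / 2 * interp_sq (slope x e)"
        by (simp add: l_def s_def)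
    qed
    finally show ?thesis using lin by (simp add: energy_def algebra_simps)
  qed
  then show ?thesis using that by blast
qed

lemma continuous_on_energy: "continuous_on S (energy c)"
proof -
  have coord: "continuous_on S (\<lambda>x :: 'v \<Rightarrow> real. x v)" for v
    by (rule continuous_on_subset[OF continuous_on_product_coordinates subset_UNIV])
  have "continuous_on S (\<lambda>x. interp_sq (slope x e))" if "e \<in> arcs \<Gamma>" for e
  proof (rule continuous_on_compose2[OF continuous_on_interp_sq[of UNIV]])
    show "continuous_on S (\<lambda>x. slope x e)"
      unfolding slope_def using len_pos[OF that]
      by (intro continuous_on_divide continuous_on_diff coord continuous_on_const) simp
  qed simp
  then show ?thesis
    unfolding energy_def
    by (intro continuous_on_add continuous_on_sum continuous_on_mult continuous_on_const coord)
qed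

lemma energy_minimiser:
  assumes c: "(\<Sum>v\<in>verts \<Gamma>. c v) = 0"
  obtains x where "\<And>y. energy c x \<le> energy c y"
proof -
  obtain u where u: "u \<in> verts \<Gamma>" using verts_nonempty by blast
  obtain K where K: "0 \<le> K" "\<And>x v. v \<in> verts \<Gamma> \<Longrightarrow> \<bar>x v - x u\<bar> \<le> K * variation x"
    using variation_bound[OF u] by metis
  obtain M where M: "\<And>x. variation x - M \<le> energy c x" using energy_ge_variation[OF c] by metis
  define R where "R = K * \<bar>M\<bar>"
  \<comment> \<open>A function has a coordinate for every element of the vertex type; pinning those
    outside of the graph to 0 gives a compact box, and the energy depends on the others
    only.\<close>
  define S where "S = (\<Pi>\<^sub>E v\<in>UNIV. if v \<in> verts \<Gamma> then {- R..R} else {0 :: real})"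
  have R: "0 \<le> R" using K by (simp add: R_def)
  have "compactin (product_topology (\<lambda>_. euclidean) UNIV) S"
    unfolding S_def by (subst compactin_PiE) auto
  then have S: "compact S" by (simp add: euclidean_product_topology)
  have zero: "(\<lambda>_. 0) \<in> S" using R by (simp add: S_def PiE_UNIV_domain Pi_iff)
  have e0: "energy c (\<lambda>_. 0) = 0" by (simp add: energy_def slope_def)
  obtain x where x: "x \<in> S" "\<And>y. y \<in> S \<Longrightarrow> energy c x \<le> energy c y"
    using continuous_attains_inf[OF S _ continuous_on_energy, of c] zero by blast
  \<comment> \<open>Functions of positive energy lose against 0, which lies in the box. The others
    have variation at most \<open>\<bar>M\<bar>\<close> and enter the box once their value at
    \<open>u\<close> is subtracted.\<close>
  have "energy c x \<le> energy c y" for y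
  proof (cases "energy c y \<le> 0")
    case True
    define z where "z v = (if v \<in> verts \<Gamma> then y v - y u else 0)" for v
    have "variation y \<le> \<bar>M\<bar>" using M[of y] True by linarith
    then have "\<bar>y v - y u\<bar> \<le> R" if "v \<in> verts \<Gamma>" for v
      using K(2)[OF that, of y] mult_left_mono[OF \<open>variation y \<le> \<bar>M\<bar>\<close> K(1)] unfolding R_def by linarith
    then have "z \<in> S" by (simp add: S_def PiE_UNIV_domain Pi_iff z_def abs_le_iff) (smt (verit))
    then have "energy c x \<le> energy c z" by (rule x(2))
    also have "energy c z = energy c y" by (rule energy_shift[OF c]) (simp add: z_def)
    finally show ?thesis .
  next
    case False
    then show ?thesis using x(2)[OF zero] e0 by simp
  qed
  then show ?thesis using that by blast
qed

text \<open>The right-hand side is the derivative of the energy at \<open>x\<close> in the direction of the indicator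
  function of \<open>W\<close>.\<close>

lemma minimiser_inequality:
  assumes min: "\<And>y. energy c x \<le> energy c y" and W: "W \<subseteq> verts \<Gamma>"
  shows "0 \<le> (\<Sum>v\<in>W. c v) + (\<Sum>e | e \<in> arcs \<Gamma> \<and> head \<Gamma> e \<in> W \<and> tail \<Gamma> e \<notin> W. of_int \<lfloor>slope x e\<rfloor> + 1 / 2)
    + (\<Sum>e | e \<in> arcs \<Gamma> \<and> tail \<Gamma> e \<in> W \<and> head \<Gamma> e \<notin> W. 1 / 2 - of_int \<lceil>slope x e\<rceil>)" (is "0 \<le> ?B")
proof -
  define y where "y \<epsilon> v = x v + (if v \<in> W then \<epsilon> else 0)" for \<epsilon> v
  define b where "b e = (if head \<Gamma> e \<in> W \<and> tail \<Gamma> e \<notin> W then of_int \<lfloor>slope x e\<rfloor> + 1 / 2 else 0)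
      + (if tail \<Gamma> e \<in> W \<and> head \<Gamma> e \<notin> W then 1 / 2 - of_int \<lceil>slope x e\<rceil> else (0 :: real))" for e
  have "\<forall>\<^sub>F \<epsilon> in at_right 0. len e / 2 * interp_sq (slope (y \<epsilon>) e) = len e / 2 * interp_sq (slope x e) + b e * \<epsilon>"
    if e: "e \<in> arcs \<Gamma>" for e
  proof -
    note l = len_pos[OF e]
    consider "head \<Gamma> e \<in> W" "tail \<Gamma> e \<notin> W" | "tail \<Gamma> e \<in> W" "head \<Gamma> e \<notin> W"
      | "head \<Gamma> e \<in> W \<longleftrightarrow> tail \<Gamma> e \<in> W" by blast
    then show ?thesis
    proof cases
      case 1
      then have "slope (y \<epsilon>) e = slope x e + \<epsilon> / len e" for \<epsilon>
        by (simp add: slope_def y_def diff_divide_distrib add_divide_distrib)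
      then show ?thesis using interp_sq_right[OF l, of "slope x e"] 1 by (simp add: b_def)
    next
      case 2
      then have "slope (y \<epsilon>) e = slope x e - \<epsilon> / len e" for \<epsilon>
        by (simp add: slope_def y_def diff_divide_distrib add_divide_distrib)
      then show ?thesis using interp_sq_left[OF l, of "slope x e"] 2 by (simp add: b_def)
    next
      case 3
      then have "slope (y \<epsilon>) e = slope x e" for \<epsilon> by (auto simp: slope_def y_def)
      then show ?thesis using 3 by (auto simp: b_def)
    qed
  qed
  then have "\<forall>\<^sub>F \<epsilon> in at_right 0. \<forall>e\<in>arcs \<Gamma>.
      len e / 2 * interp_sq (slope (y \<epsilon>) e) = len e / 2 * interp_sq (slope x e) + b e * \<epsilon>"
    by (intro eventually_ball_finite) auto
  moreover have "\<forall>\<^sub>F \<epsilon> :: real in at_right 0. 0 < \<epsilon>" by (simp add: eventually_at_right_less)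
  ultimately have "\<forall>\<^sub>F \<epsilon> :: real in at_right 0. 0 \<le> ?B"
  proof eventually_elim
    case (elim \<epsilon>)
    have lin: "(\<Sum>v\<in>verts \<Gamma>. c v * y \<epsilon> v) = (\<Sum>v\<in>verts \<Gamma>. c v * x v) + (\<Sum>v\<in>W. c v) * \<epsilon>"
    proof -
      have "(\<Sum>v\<in>verts \<Gamma>. c v * y \<epsilon> v) = (\<Sum>v\<in>verts \<Gamma>. c v * x v + (if v \<in> W then c v * \<epsilon> else 0))"
        by (intro sum.cong) (auto simp: y_def algebra_simps)
      also have "\<dots> = (\<Sum>v\<in>verts \<Gamma>. c v * x v) + (\<Sum>v\<in>verts \<Gamma> \<inter> W. c v * \<epsilon>)"
        by (simp add: sum.distrib sum.inter_restrict)
      also have "verts \<Gamma> \<inter> W = W" using W by blast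
      finally show ?thesis by (simp add: sum_distrib_right)
    qed
    have "(\<Sum>e\<in>arcs \<Gamma>. b e) = ?B - (\<Sum>v\<in>W. c v)"
    proof -
      have "(\<Sum>e\<in>arcs \<Gamma>. b e) =
          (\<Sum>e\<in>arcs \<Gamma>. if head \<Gamma> e \<in> W \<and> tail \<Gamma> e \<notin> W then of_int \<lfloor>slope x e\<rfloor> + 1 / 2 else 0)
        + (\<Sum>e\<in>arcs \<Gamma>. if tail \<Gamma> e \<in> W \<and> head \<Gamma> e \<notin> W then 1 / 2 - of_int \<lceil>slope x e\<rceil> else 0)"
        unfolding b_def by (rule sum.distrib)
      then show ?thesis by (simp only: sum.inter_filter[OF finite_arcs, symmetric])
    qed
    moreover have "(\<Sum>e\<in>arcs \<Gamma>. len e / 2 * interp_sq (slope (y \<epsilon>) e))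
        = (\<Sum>e\<in>arcs \<Gamma>. len e / 2 * interp_sq (slope x e) + b e * \<epsilon>)"
      using elim(1) by (intro sum.cong) blast+
    then have "(\<Sum>e\<in>arcs \<Gamma>. len e / 2 * interp_sq (slope (y \<epsilon>) e))
        = (\<Sum>e\<in>arcs \<Gamma>. len e / 2 * interp_sq (slope x e)) + (\<Sum>e\<in>arcs \<Gamma>. b e) * \<epsilon>"
      by (simp only: sum.distrib sum_distrib_right)
    ultimately have "energy c (y \<epsilon>) = energy c x + ?B * \<epsilon>"
      using lin unfolding energy_def by (simp only:) (simp only: left_diff_distrib)
    then have "0 \<le> ?B * \<epsilon>" using min[of "y \<epsilon>"] by simp
    then show ?case using elim(2) by (simp add: zero_le_mult_iff)
  qed
  then show ?thesis by simp
qed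

end

section \<open>Uniqueness\<close>

context curve_model
begin

text \<open>Both divisors are compared with a third one, by \<open>f\<^sub>1\<close> and
  \<open>f\<^sub>2\<close>. In a common model the slopes of these functions are subtracted edge by
  edge, which takes the place of additivity of \<open>div_of\<close>.\<close>

lemma quasistable_unique:
  assumes f: "linear_on_edges \<Gamma> len \<phi> f\<^sub>1 a\<^sub>1" "linear_on_edges \<Gamma> len \<phi> f\<^sub>2 a\<^sub>2"
    and supp: "\<And>p. D\<^sub>1 p \<noteq> 0 \<Longrightarrow> p \<in> vt ` verts \<Gamma>" "\<And>p. D\<^sub>2 p \<noteq> 0 \<Longrightarrow> p \<in> vt ` verts \<Gamma>"
      "\<And>p. \<mu> p \<noteq> 0 \<Longrightarrow> p \<in> vt ` verts \<Gamma>"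
    and p0: "p0 \<in> vt ` verts \<Gamma>"
    and eq: "\<And>p. D\<^sub>1 p - D\<^sub>2 p = div_of X f\<^sub>1 p - div_of X f\<^sub>2 p"
    and deg: "(\<Sum>v\<in>verts \<Gamma>. of_int (D\<^sub>1 (vt v)) - \<mu> (vt v)) = 0"
    and qs: "quasistable X p0 \<mu> D\<^sub>1" "quasistable X p0 \<mu> D\<^sub>2"
  shows "D\<^sub>1 = D\<^sub>2"
proof -
  define f where "f v = f\<^sub>1 (vt v) - f\<^sub>2 (vt v)" for v
  define a where "a e = a\<^sub>1 e - a\<^sub>2 e" for e
  have slope: "f (head \<Gamma> e) = f (tail \<Gamma> e) + of_int (a e) * len e" if "e \<in> arcs \<Gamma>" for e
  proof -
    have "g (vt (head \<Gamma> e)) = g (vt (tail \<Gamma> e)) + of_int (b e) * len e"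
      if "linear_on_edges \<Gamma> len \<phi> g b" for g b
      using that \<open>e \<in> arcs \<Gamma>\<close> len_pos[of e] unfolding linear_on_edges_def
      by (auto dest!: bspec[of _ _ e] bspec[of _ _ "len e"] simp: gl_len)
    from this[OF f(1)] this[OF f(2)] show ?thesis by (simp add: f_def a_def algebra_simps)
  qed
  have diff: "D\<^sub>1 (vt v) - D\<^sub>2 (vt v) = (\<Sum>e\<in>in_arcs \<Gamma> v. a e) + (\<Sum>e\<in>out_arcs \<Gamma> v. - a e)"
    if "v \<in> verts \<Gamma>" for v
    using eq[of "vt v"] div_of_vertex[OF f(1) that] div_of_vertex[OF f(2) that]
    by (simp add: a_def sum_subtractf sum_negf)
  \<comment> \<open>Leaving the set \<open>W\<close> of maximal vertices, \<open>f\<close> drops with slope at least 1 along every edge of the cut.\<close>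
  define M where "M = Max (f ` verts \<Gamma>)"
  define W where "W = {v \<in> verts \<Gamma>. f v = M}"
  have fM: "f v \<le> M" if "v \<in> verts \<Gamma>" for v using that by (simp add: M_def)
  have "M \<in> f ` verts \<Gamma>" unfolding M_def using verts_nonempty by (intro Max_in) auto
  then have W: "W \<subseteq> verts \<Gamma>" "W \<noteq> {}" by (auto simp: W_def)
  let ?in = "{e \<in> arcs \<Gamma>. head \<Gamma> e \<in> W \<and> tail \<Gamma> e \<notin> W}"
  let ?out = "{e \<in> arcs \<Gamma>. tail \<Gamma> e \<in> W \<and> head \<Gamma> e \<notin> W}"
  let ?both = "{e \<in> arcs \<Gamma>. head \<Gamma> e \<in> W \<and> tail \<Gamma> e \<in> W}"
  have a_in: "1 \<le> a e" if "e \<in> ?in" for e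
  proof -
    have "f (tail \<Gamma> e) < f (head \<Gamma> e)" using that fM[of "tail \<Gamma> e"] by (auto simp: W_def less_le)
    then have "0 < of_int (a e) * len e" using slope[of e] that by simp
    then show ?thesis using len_pos[of e] that by (simp add: zero_less_mult_iff)
  qed
  have a_out: "a e \<le> - 1" if "e \<in> ?out" for e
  proof -
    have "f (head \<Gamma> e) < f (tail \<Gamma> e)" using that fM[of "head \<Gamma> e"] by (auto simp: W_def less_le)
    then have "of_int (a e) * len e < 0" using slope[of e] that by simp
    then show ?thesis using len_pos[of e] that by (simp add: mult_less_0_iff)
  qed
  have "(\<Sum>v\<in>W. D\<^sub>1 (vt v) - D\<^sub>2 (vt v)) = (\<Sum>v\<in>W. (\<Sum>e\<in>in_arcs \<Gamma> v. a e) + (\<Sum>e\<in>out_arcs \<Gamma> v. - a e))"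
    using diff W(1) by (intro sum.cong) auto
  also have "\<dots> = (\<Sum>e | e \<in> arcs \<Gamma> \<and> head \<Gamma> e \<in> W. a e) - (\<Sum>e | e \<in> arcs \<Gamma> \<and> tail \<Gamma> e \<in> W. a e)"
    unfolding sum_in_out_arcs[OF W(1)] by (simp add: sum_negf)
  also have "{e. e \<in> arcs \<Gamma> \<and> head \<Gamma> e \<in> W} = ?in \<union> ?both" by auto
  also have "{e. e \<in> arcs \<Gamma> \<and> tail \<Gamma> e \<in> W} = ?out \<union> ?both" by auto
  also have "(\<Sum>e\<in>?in \<union> ?both. a e) = (\<Sum>e\<in>?in. a e) + (\<Sum>e\<in>?both. a e)"
    by (rule sum.union_disjoint) auto
  also have "(\<Sum>e\<in>?out \<union> ?both. a e) = (\<Sum>e\<in>?out. a e) + (\<Sum>e\<in>?both. a e)"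
    by (rule sum.union_disjoint) auto
  finally have "(\<Sum>v\<in>W. D\<^sub>1 (vt v) - D\<^sub>2 (vt v)) = (\<Sum>e\<in>?in. a e) - (\<Sum>e\<in>?out. a e)" by simp
  moreover have "int (card ?in) \<le> (\<Sum>e\<in>?in. a e)"
    using sum_mono[of ?in "\<lambda>_. 1" a] a_in by simp
  moreover have "(\<Sum>e\<in>?out. a e) \<le> - int (card ?out)"
    using sum_mono[of ?out a "\<lambda>_. - 1"] a_out by simp
  ultimately have "int (cut W) \<le> (\<Sum>v\<in>W. D\<^sub>1 (vt v) - D\<^sub>2 (vt v))"
    by (simp add: cut_def)
  then have "real_of_int (int (cut W)) \<le> of_int (\<Sum>v\<in>W. D\<^sub>1 (vt v) - D\<^sub>2 (vt v))"
    by (simp only: of_int_le_iff)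
  then have gain: "cut W \<le> (\<Sum>v\<in>W. of_int (D\<^sub>1 (vt v)) - of_int (D\<^sub>2 (vt v)) :: real)" by simp
  let ?V = "verts \<Gamma> - W"
  have "(\<Sum>v\<in>verts \<Gamma>. of_int (D\<^sub>1 (vt v)) - \<mu> (vt v))
      = (\<Sum>v\<in>?V. of_int (D\<^sub>1 (vt v)) - \<mu> (vt v)) + (\<Sum>v\<in>W. of_int (D\<^sub>1 (vt v)) - \<mu> (vt v))"
    by (rule sum.subset_diff[OF W(1) finite_verts])
  \<comment> \<open>The total degree condition rewrites the first term through \<open>W\<close>, so
    the sum equals \<open>cut W\<close> minus the excess of \<open>D\<^sub>1\<close> over
    \<open>D\<^sub>2\<close> on \<open>W\<close>.\<close>
  then have "beta X \<mu> D\<^sub>1 (region ?V) + beta X \<mu> D\<^sub>2 (region W) \<le> 0"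
    using beta_region[OF W(1) supp(2,3)] beta_region[OF Diff_subset supp(1,3)] deg gain
    by (simp add: cut_complement sum_subtractf)
  moreover have sub: "subcurve X (region ?V)" "subcurve X (region W)"
    using adapted_subcurve[OF adapted_region] W(1) by auto
  moreover have "0 \<le> beta X \<mu> D\<^sub>1 (region ?V)" "0 \<le> beta X \<mu> D\<^sub>2 (region W)"
    using qs sub by (auto simp: quasistable_def)
  ultimately have zero: "\<not> 0 < beta X \<mu> D\<^sub>1 (region ?V)" "\<not> 0 < beta X \<mu> D\<^sub>2 (region W)" by linarith+
  have in_region: "vt v \<in> region U \<longleftrightarrow> v \<in> U" if "U \<subseteq> verts \<Gamma>" "v \<in> verts \<Gamma>" for U v
    using adapted_region[OF that(1)] that(2) by (simp add: adapted_def)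
  obtain v0 where v0: "v0 \<in> verts \<Gamma>" "p0 = vt v0" using p0 by blast
  \<comment> \<open>Neither beta is positive, so the subcurve that contains \<open>p0\<close> cannot
    be proper. If it is the one on the complement, this contradicts that \<open>W\<close> is
    nonempty.\<close>
  have "W = verts \<Gamma>"
  proof (cases "v0 \<in> W")
    case True
    then have "p0 \<in> region W" using in_region[OF W(1) v0(1)] v0(2) by simp
    then have "region W = mspace X" using qs(2) sub(2) zero(2) by (auto simp: quasistable_def)
    then show ?thesis using in_region[OF W(1)] vt_in W(1) by blast
  next
    case False
    then have "p0 \<in> region ?V" using in_region[OF Diff_subset v0(1)] v0 by simp
    then have "region ?V = mspace X" using qs(1) sub(1) zero(1) by (auto simp: quasistable_def)
    then show ?thesis using in_region[OF Diff_subset] vt_in W by blast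
  qed
  then have "f v = M" if "v \<in> verts \<Gamma>" for v using that by (auto simp: W_def)
  then have "a e = 0" if "e \<in> arcs \<Gamma>" for e
    using slope[OF that] len_pos[OF that] that by simp
  then have "D\<^sub>1 (vt v) = D\<^sub>2 (vt v)" if "v \<in> verts \<Gamma>" for v
    using diff[OF that] by (simp add: in_arcs_def out_arcs_def)
  moreover have "D\<^sub>1 p = 0 \<and> D\<^sub>2 p = 0" if "p \<notin> vt ` verts \<Gamma>" for p
    using supp(1,2) that by blast
  ultimately have "D\<^sub>1 p = D\<^sub>2 p" for p
    by (cases "p \<in> vt ` verts \<Gamma>") auto
  then show ?thesis by (rule ext)
qed

end

lemma equivalent_unique:
  assumes X: "tropical_curve X" and p0: "p0 \<in> mspace X" and \<mu>: "polarization X d \<mu>"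
    and D1: "divisor X D\<^sub>1" "degree_div X D\<^sub>1 = d" "equivalent X D\<^sub>1 D" "quasistable X p0 \<mu> D\<^sub>1"
    and D2: "divisor X D\<^sub>2" "equivalent X D\<^sub>2 D" "quasistable X p0 \<mu> D\<^sub>2"
  shows "D\<^sub>1 = D\<^sub>2"
proof -
  obtain f1 where f1: "rational_function X f1" "\<And>p. D\<^sub>1 p - D p = div_of X f1 p"
    using D1(3) by (auto simp: equivalent_def)
  obtain f2 where f2: "rational_function X f2" "\<And>p. D\<^sub>2 p - D p = div_of X f2 p"
    using D2(2) by (auto simp: equivalent_def)
  obtain F1 where F1: "finite F1" "F1 \<subseteq> mspace X"
    "\<And>\<Gamma> len \<phi>. model X \<Gamma> len \<phi> \<Longrightarrow> F1 \<subseteq> \<phi> ` Vertex ` verts \<Gamma> \<Longrightarrow> \<exists>a. linear_on_edges \<Gamma> len \<phi> f1 a"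
    using rational_function_linear[OF f1(1)] by metis
  obtain F2 where F2: "finite F2" "F2 \<subseteq> mspace X"
    "\<And>\<Gamma> len \<phi>. model X \<Gamma> len \<phi> \<Longrightarrow> F2 \<subseteq> \<phi> ` Vertex ` verts \<Gamma> \<Longrightarrow> \<exists>a. linear_on_edges \<Gamma> len \<phi> f2 a"
    using rational_function_linear[OF f2(1)] by metis
  obtain \<Gamma>' len' \<phi>' where m': "model X \<Gamma>' len' \<phi>'" using X by (auto simp: tropical_curve_def)
  let ?F = "{p0} \<union> F1 \<union> F2 \<union> {p. D\<^sub>1 p \<noteq> 0} \<union> {p. D\<^sub>2 p \<noteq> 0} \<union> {p. \<mu> p \<noteq> 0}"
  have "finite ?F" "?F \<subseteq> mspace X"
    using p0 F1(1,2) F2(1,2) D1(1) D2(1) \<mu> by (auto simp: divisor_def polarization_def fin_supp_on_def)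
  then obtain \<Gamma> len \<phi> where m: "model X \<Gamma> len \<phi>" "?F \<union> \<phi>' ` Vertex ` verts \<Gamma>' \<subseteq> \<phi> ` Vertex ` verts \<Gamma>"
    using model_refine[OF m'] by metis
  then have F: "?F \<subseteq> \<phi> ` Vertex ` verts \<Gamma>" by (rule_tac subset_trans[OF Un_upper1])
  interpret curve_model X \<Gamma> len \<phi> by unfold_locales fact
  obtain a1 a2 where a: "linear_on_edges \<Gamma> len \<phi> f1 a1" "linear_on_edges \<Gamma> len \<phi> f2 a2"
    using F1(3)[OF m(1)] F2(3)[OF m(1)] F by auto
  have supp: "p \<in> vt ` verts \<Gamma>" if "p \<in> ?F" for p using F that by (auto simp: image_image)
  show ?thesis
  proof (rule quasistable_unique[OF a _ _ _ _ _ _ D1(4) D2(3)])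
    show "D\<^sub>1 p - D\<^sub>2 p = div_of X f1 p - div_of X f2 p" for p using f1(2)[of p] f2(2)[of p] by linarith
    have "{v \<in> verts \<Gamma>. vt v \<in> mspace X} = verts \<Gamma>" using vt_in by blast
    then have "(\<Sum>v\<in>verts \<Gamma>. D\<^sub>1 (vt v)) = d" "(\<Sum>v\<in>verts \<Gamma>. \<mu> (vt v)) = of_int d"
      using total_on_vertices[of D\<^sub>1 "mspace X"] total_on_vertices[of \<mu> "mspace X"] supp D1(2) \<mu>
      by (auto simp: degree_div_def degree_on_def polarization_def)
    then show "(\<Sum>v\<in>verts \<Gamma>. of_int (D\<^sub>1 (vt v)) - \<mu> (vt v)) = 0"
      by (simp add: sum_subtractf flip: of_int_sum)
  qed (use supp in auto)
qed

section \<open>Exits of a subcurve along an edge\<close>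

lemma subcurve_shell:
  assumes "subcurve X Y"
  shows "\<forall>\<^sub>F \<epsilon> in at_right 0. finite (shell X Y \<epsilon>) \<and> card (shell X Y \<epsilon>) = delta X Y"
proof -
  obtain \<Gamma> len \<phi> \<Delta> where m: "model X \<Gamma> len \<phi>" "subgraph \<Delta> \<Gamma>" "Y = \<phi> ` graph_points \<Delta> len"
    using assms by (auto simp: subcurve_def induces_def)
  interpret curve_model X \<Gamma> len \<phi> by unfold_locales fact
  have Y: "adapted Y (verts \<Delta>) (arcs \<Delta>)" using adapted_of_subgraph[OF m(2)] m(3) by simp
  show ?thesis
    unfolding eventually_at_right_field
    using rad_pos finite_shell[OF Y] card_shell[OF Y] delta_eq[OF Y] by (intro exI[of _ rad]) auto
qed

lemma subcurve_subset:
  assumes "subcurve X Y"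
  shows "Y \<subseteq> mspace X"
proof -
  obtain \<Gamma> len \<phi> \<Delta> where m: "model X \<Gamma> len \<phi>" "subgraph \<Delta> \<Gamma>" "Y = \<phi> ` graph_points \<Delta> len"
    using assms by (auto simp: subcurve_def induces_def)
  interpret curve_model X \<Gamma> len \<phi> by unfold_locales fact
  show ?thesis using adapted_of_subgraph[OF m(2)] m(3) by (simp add: adapted_def)
qed

text \<open>Closedness of \<open>Y\<close> in quantitative form; it makes the parameters of an edge
  that belong to \<open>Y\<close> a closed set.\<close>

lemma subcurve_separated:
  assumes "subcurve X Y" and x: "x \<in> mspace X" "x \<notin> Y"
  obtains r where "0 < r" "\<And>p. p \<in> Y \<Longrightarrow> r \<le> mdist X p x"
proof -
  obtain \<Gamma> len \<phi> \<Delta> where m: "model X \<Gamma> len \<phi>" "subgraph \<Delta> \<Gamma>" "Y = \<phi> ` graph_points \<Delta> len"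
    using assms(1) by (auto simp: subcurve_def induces_def)
  interpret curve_model X \<Gamma> len \<phi> by unfold_locales fact
  have Y: "adapted Y (verts \<Delta>) (arcs \<Delta>)" using adapted_of_subgraph[OF m(2)] m(3) by simp
  from x(1) show ?thesis
  proof (cases rule: mspace_cases)
    case (vertex v)
    then have "v \<notin> verts \<Delta>" using Y x(2) by (simp add: adapted_def)
    then show ?thesis using dist_ge_of_adapted[OF Y, of _ "Vertex v"] vertex rad_pos by (intro that[of rad]) auto
  next
    case (inner e t)
    then have "e \<notin> arcs \<Delta>" using Y x(2) by (auto simp: adapted_def)
    then show ?thesis
      using dist_ge_of_adapted[OF Y, of _ "Inner e t"] inner rad_pos
      by (intro that[of "min rad (min t (len e - t))"]) (force simp: gl_inner min_def split: if_splits)+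
  qed
qed

text \<open>For fixed \<open>r\<close> the numbers in question form a translate of the
  half-integers, which has a gap below 0, and finitely many gaps have a common lower bound. This
  turns approximate nonnegativity into exact nonnegativity.\<close>

lemma discrete_gap:
  fixes R :: "real set"
  assumes "finite R"
  obtains \<eta> where "0 < \<eta>" "\<And>r k. r \<in> R \<Longrightarrow> - \<eta> \<le> of_int k / 2 - r \<Longrightarrow> 0 \<le> of_int k / 2 - r"
proof -
  have "\<exists>\<eta>>0. \<forall>r\<in>R. \<forall>k. - \<eta> \<le> of_int k / 2 - r \<longrightarrow> 0 \<le> of_int k / 2 - r"
    using assms
  proof (induction R)
    case (insert r R)
    then obtain \<eta> where \<eta>: "0 < \<eta>" "\<forall>r\<in>R. \<forall>k. - \<eta> \<le> of_int k / 2 - r \<longrightarrow> 0 \<le> of_int k / 2 - r" by blast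
    \<comment> \<open>Half of the distance from \<open>r\<close> down to the greatest half-integer
      strictly below it.\<close>
    define \<theta> where "\<theta> = (2 * r - (of_int \<lceil>2 * r\<rceil> - 1)) / 4"
    have \<theta>: "0 < \<theta>" using ceiling_correct[of "2 * r"] by (simp add: \<theta>_def)
    have "0 \<le> of_int k / 2 - r" if "- \<theta> \<le> of_int k / 2 - r" for k
    proof -
      have "of_int \<lceil>2 * r\<rceil> - 1 < real_of_int k"
        using that ceiling_correct[of "2 * r"] unfolding \<theta>_def by argo
      then have "\<lceil>2 * r\<rceil> \<le> k" by linarith
      then have "2 * r \<le> of_int k" by (simp add: ceiling_le_iff)
      then show ?thesis by simp
    qed
    then show ?case using \<eta> \<theta> by (intro exI[of _ "min \<eta> \<theta>"]) (auto simp: min_def)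
  qed (auto intro: exI[of _ 1])
  then show ?thesis using that by blast
qed

context curve_model
begin

text \<open>A point of \<open>Y\<close> closer than \<epsilon> to the candidate would, by
  \<open>near_pt\<close>, lie on the same edge and inside the gap. The bound on
  \<open>2 * \<epsilon>\<close> keeps the candidate at distance at least \<epsilon> from both ends
  of the gap.\<close>

lemma gap_exits:
  assumes e: "e \<in> arcs \<Gamma>" and lr: "0 \<le> l" "l < r" "r \<le> len e"
    and gap: "\<And>t. l < t \<Longrightarrow> t < r \<Longrightarrow> pt e t \<notin> Y" and Y: "Y \<subseteq> mspace X"
    and \<epsilon>: "0 < \<epsilon>" "2 * \<epsilon> < r - l"
  shows "pt e l \<in> Y \<Longrightarrow> pt e (l + \<epsilon>) \<in> shell X Y \<epsilon>" and "pt e r \<in> Y \<Longrightarrow> pt e (r - \<epsilon>) \<in> shell X Y \<epsilon>"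
proof -
  have far: "\<epsilon> \<le> mdist X p (pt e s)" if p: "p \<in> Y" and s: "l + \<epsilon> \<le> s" "s \<le> r - \<epsilon>" for p s
  proof (rule ccontr)
    assume "\<not> \<epsilon> \<le> mdist X p (pt e s)"
    then have d: "mdist X (pt e s) p < \<epsilon>" by (simp add: mdist_commute)
    have p': "p \<in> mspace X" using p Y by blast
    obtain u where u: "0 < u" "u < len e" "p = pt e u" "\<bar>u - s\<bar> = mdist X (pt e s) p"
    proof (rule near_pt[OF e _ _ p'])
      show "0 < s" "s < len e" "mdist X (pt e s) p < min s (len e - s)" using s lr \<epsilon> d by auto
    qed
    have "l < u" "u < r" using u(4) d s by linarith+
    then show False using gap p u(3) by blast
  qed
  show "pt e (l + \<epsilon>) \<in> shell X Y \<epsilon>" if "pt e l \<in> Y"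
  proof -
    have "mdist X (pt e l) (pt e (l + \<epsilon>)) = \<epsilon>" using dist_pt[OF e, of l "l + \<epsilon>"] lr \<epsilon> by simp
    moreover have "pt e (l + \<epsilon>) \<in> mspace X" using lr \<epsilon> by (intro pt_in e) auto
    ultimately show ?thesis using that far \<epsilon> by (auto simp: shell_def)
  qed
  show "pt e (r - \<epsilon>) \<in> shell X Y \<epsilon>" if "pt e r \<in> Y"
  proof -
    have "mdist X (pt e r) (pt e (r - \<epsilon>)) = \<epsilon>" using dist_pt[OF e, of r "r - \<epsilon>"] lr \<epsilon> by simp
    moreover have "pt e (r - \<epsilon>) \<in> mspace X" using lr \<epsilon> by (intro pt_in e) auto
    ultimately show ?thesis using that far \<epsilon> by (auto simp: shell_def)
  qed
qed

definition open_edge :: "nat \<Rightarrow> 'a set" where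
  "open_edge e = pt e ` {0<..<len e}"

lemma open_edge_disjoint: "e \<in> arcs \<Gamma> \<Longrightarrow> e' \<in> arcs \<Gamma> \<Longrightarrow> e \<noteq> e' \<Longrightarrow> open_edge e \<inter> open_edge e' = {}"
  by (auto simp: open_edge_def) (metis pt_eq_iff atLeastAtMost_iff less_imp_le)

text \<open>The number of boundary points that \<open>Y\<close> is forced to have along
  \<open>e\<close>, given only which ends of \<open>e\<close> lie in \<open>Y\<close> and whether
  the open edge is contained in \<open>Y\<close> or meets it: a gap between two points of
  \<open>Y\<close> has two ends, and so has a piece of \<open>Y\<close> between two points
  outside.\<close>

definition exits :: "'a set \<Rightarrow> nat \<Rightarrow> nat" where
  "exits Y e =
     (if vt (tail \<Gamma> e) \<in> Y \<and> vt (head \<Gamma> e) \<in> Y then (if open_edge e \<subseteq> Y then 0 else 2)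
      else if vt (tail \<Gamma> e) \<in> Y \<or> vt (head \<Gamma> e) \<in> Y then 1
      else if open_edge e \<inter> Y = {} then 0 else 2)"

text \<open>\<open>Y\<close> may begin and end anywhere inside \<open>e\<close>. As its parameters
  form a closed set, every maximal gap has its inner end points in \<open>Y\<close>, and
  \<open>gap_exits\<close> yields a point of the shell next to each of them.\<close>

lemma exits_le_card:
  assumes Y: "subcurve X Y" and e: "e \<in> arcs \<Gamma>"
  shows "\<forall>\<^sub>F \<epsilon> in at_right 0. \<exists>S. S \<subseteq> shell X Y \<epsilon> \<and> S \<subseteq> open_edge e \<and> card S = exits Y e"
proof -
  note l0 = len_pos[OF e]
  have YX: "Y \<subseteq> mspace X" by (rule subcurve_subset[OF Y])
  define T where "T = {t \<in> {0..len e}. pt e t \<in> Y}"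
  have "closed T"
    unfolding closed_def open_dist
  proof
    fix t assume t: "t \<in> - T"
    show "\<exists>r>0. \<forall>s. dist s t < r \<longrightarrow> s \<in> - T"
    proof (cases "t \<in> {0..len e}")
      case True
      then have "pt e t \<in> mspace X" "pt e t \<notin> Y" using t pt_in[OF e True] by (auto simp: T_def)
      then obtain r where r: "0 < r" "\<And>p. p \<in> Y \<Longrightarrow> r \<le> mdist X p (pt e t)"
        using subcurve_separated[OF Y] by metis
      have "s \<in> - T" if "dist s t < r" for s
      proof
        assume s: "s \<in> T"
        then have "r \<le> mdist X (pt e s) (pt e t)" using r(2) by (simp add: T_def)
        also have "\<dots> \<le> \<bar>s - t\<bar>" using s True by (intro dist_pt_le[OF e]) (auto simp: T_def)
        finally show False using that by (simp add: dist_real_def)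
      qed
      then show ?thesis using r(1) by blast
    next
      case False
      have "open (- {0..len e})" by (rule open_Compl[OF closed_atLeastAtMost])
      then obtain r where "0 < r" "\<And>s. dist s t < r \<Longrightarrow> s \<in> - {0..len e}"
        using False unfolding open_dist by blast
      then show ?thesis by (auto simp: T_def)
    qed
  qed
  then have comp: "compact (T \<inter> {a..b})" for a b
    by (rule closed_Int_compact) simp
  \<comment> \<open>The last parameter in \<open>Y\<close> before a point outside of
    \<open>Y\<close>; \<open>first\<close> is the mirror image. Both exist by compactness.\<close>
  have last: "\<exists>l\<in>T. a \<le> l \<and> l < b \<and> (\<forall>t. l < t \<and> t < b \<longrightarrow> t \<notin> T)" if "s \<in> T" "a \<le> s" "s < b" "b \<notin> T" for a b s
  proof -
    have s: "s \<in> T \<inter> {a..b}" using that by auto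
    obtain l where l: "l \<in> T \<inter> {a..b}" "\<And>t. t \<in> T \<inter> {a..b} \<Longrightarrow> t \<le> l"
      using compact_attains_sup[OF comp[of a b]] s by blast
    then have "l \<noteq> b" "l \<le> b" using that(4) by auto
    then have "l < b" by simp
    moreover have "t \<notin> T" if "l < t" "t < b" for t using l(1) l(2)[of t] that by auto
    ultimately show ?thesis using l(1) by auto
  qed
  have first: "\<exists>r\<in>T. a < r \<and> r \<le> b \<and> (\<forall>t. a < t \<and> t < r \<longrightarrow> t \<notin> T)" if "s \<in> T" "a < s" "s \<le> b" "a \<notin> T" for a b s
  proof -
    have s: "s \<in> T \<inter> {a..b}" using that by auto
    obtain r where r: "r \<in> T \<inter> {a..b}" "\<And>t. t \<in> T \<inter> {a..b} \<Longrightarrow> r \<le> t"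
      using compact_attains_inf[OF comp[of a b]] s by blast
    then have "r \<noteq> a" "a \<le> r" using that(4) by auto
    then have "a < r" by simp
    moreover have "t \<notin> T" if "a < t" "t < r" for t using r(1) r(2)[of t] that by auto
    ultimately show ?thesis using r(1) by auto
  qed
  have T: "t \<in> T \<longleftrightarrow> pt e t \<in> Y" if "0 \<le> t" "t \<le> len e" for t using that by (simp add: T_def)
  have T01: "0 \<in> T \<longleftrightarrow> vt (tail \<Gamma> e) \<in> Y" "len e \<in> T \<longleftrightarrow> vt (head \<Gamma> e) \<in> Y"
    using T[of 0] T[of "len e"] l0 gl_len[OF e] by auto
  have Tsub: "0 \<le> t \<and> t \<le> len e" if "t \<in> T" for t using that by (simp add: T_def)
  have right: "pt e (l + \<epsilon>) \<in> shell X Y \<epsilon> \<and> pt e (l + \<epsilon>) \<in> open_edge e"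
    if "l \<in> T" "l < r" "r \<le> len e" "\<forall>t. l < t \<and> t < r \<longrightarrow> t \<notin> T" "0 < \<epsilon>" "2 * \<epsilon> < r - l" for l r \<epsilon>
    using gap_exits(1)[OF e, of l r Y \<epsilon>] that T YX Tsub[OF that(1)] by (auto simp: open_edge_def)
  have left: "pt e (r - \<epsilon>) \<in> shell X Y \<epsilon> \<and> pt e (r - \<epsilon>) \<in> open_edge e"
    if "r \<in> T" "l < r" "0 \<le> l" "\<forall>t. l < t \<and> t < r \<longrightarrow> t \<notin> T" "0 < \<epsilon>" "2 * \<epsilon> < r - l" for l r \<epsilon>
    using gap_exits(2)[OF e, of l r Y \<epsilon>] that T YX Tsub[OF that(1)] by (auto simp: open_edge_def)
  have two: "card {pt e s, pt e t} = 2" if "0 < s" "s < len e" "s \<noteq> t" "0 < t" "t < len e" for s t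
    using pt_eq_iff[of e t e s] that e by simp
  have ev: ?thesis if "0 < \<delta>" "\<And>\<epsilon>. 0 < \<epsilon> \<Longrightarrow> \<epsilon> < \<delta> \<Longrightarrow> \<exists>S. S \<subseteq> shell X Y \<epsilon> \<and> S \<subseteq> open_edge e \<and> card S = exits Y e" for \<delta>
    unfolding eventually_at_right_field using that by blast
  consider (full) "0 \<in> T" "len e \<in> T" "open_edge e \<subseteq> Y" | (gap) "0 \<in> T" "len e \<in> T" "\<not> open_edge e \<subseteq> Y"
    | (tail) "0 \<in> T" "len e \<notin> T" | (head) "0 \<notin> T" "len e \<in> T"
    | (empty) "0 \<notin> T" "len e \<notin> T" "open_edge e \<inter> Y = {}" | (mid) "0 \<notin> T" "len e \<notin> T" "open_edge e \<inter> Y \<noteq> {}"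
    by blast
  then show ?thesis
  proof cases
    case full
    then have "exits Y e = 0" using T01 by (simp add: exits_def)
    then show ?thesis by (intro ev[of 1]) (auto intro: exI[of _ "{}"])
  next
    case empty
    then have "exits Y e = 0" using T01 by (simp add: exits_def)
    then show ?thesis by (intro ev[of 1]) (auto intro: exI[of _ "{}"])
  next
    case gap
    then obtain s where "s \<in> {0<..<len e}" "pt e s \<notin> Y" unfolding open_edge_def by blast
    then have s: "0 < s" "s < len e" "s \<notin> T" by (auto simp: T_def)
    obtain l where l: "l \<in> T" "0 \<le> l" "l < s" "\<forall>t. l < t \<and> t < s \<longrightarrow> t \<notin> T" using last[OF gap(1) order_refl s(1,3)] by blast
    obtain r where r: "r \<in> T" "s < r" "r \<le> len e" "\<forall>t. s < t \<and> t < r \<longrightarrow> t \<notin> T" using first[OF gap(2) s(2) order_refl s(3)] by blast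
    have lr: "\<forall>t. l < t \<and> t < r \<longrightarrow> t \<notin> T" using l r s by (metis linorder_neqE_linordered_idom)
    have ex: "exits Y e = 2" using gap T01 by (simp add: exits_def)
    show ?thesis
    proof (rule ev)
      show "0 < (r - l) / 2" using l r by simp
      fix \<epsilon> assume \<epsilon>: "0 < \<epsilon>" "\<epsilon> < (r - l) / 2"
      have "card {pt e (l + \<epsilon>), pt e (r - \<epsilon>)} = 2" using l r \<epsilon> by (intro two) auto
      then show "\<exists>S. S \<subseteq> shell X Y \<epsilon> \<and> S \<subseteq> open_edge e \<and> card S = exits Y e"
        using right[of l r \<epsilon>] left[of r l \<epsilon>] l r lr \<epsilon> ex by (intro exI[of _ "{pt e (l + \<epsilon>), pt e (r - \<epsilon>)}"]) auto
    qed
  next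
    case tail
    obtain l where l: "l \<in> T" "0 \<le> l" "l < len e" "\<forall>t. l < t \<and> t < len e \<longrightarrow> t \<notin> T"
      using last[OF tail(1) order_refl l0 tail(2)] by blast
    have ex: "exits Y e = 1" using tail T01 by (simp add: exits_def)
    show ?thesis
    proof (rule ev)
      show "0 < (len e - l) / 2" using l by simp
      fix \<epsilon> assume "0 < \<epsilon>" "\<epsilon> < (len e - l) / 2"
      then show "\<exists>S. S \<subseteq> shell X Y \<epsilon> \<and> S \<subseteq> open_edge e \<and> card S = exits Y e"
        using right[of l "len e" \<epsilon>] l ex by (intro exI[of _ "{pt e (l + \<epsilon>)}"]) auto
    qed
  next
    case head
    obtain r where r: "r \<in> T" "0 < r" "r \<le> len e" "\<forall>t. 0 < t \<and> t < r \<longrightarrow> t \<notin> T"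
      using first[OF head(2) l0 order_refl head(1)] by blast
    have ex: "exits Y e = 1" using head T01 by (simp add: exits_def)
    show ?thesis
    proof (rule ev)
      show "0 < r / 2" using r by simp
      fix \<epsilon> assume "0 < \<epsilon>" "\<epsilon> < r / 2"
      then show "\<exists>S. S \<subseteq> shell X Y \<epsilon> \<and> S \<subseteq> open_edge e \<and> card S = exits Y e"
        using left[of r 0 \<epsilon>] r ex by (intro exI[of _ "{pt e (r - \<epsilon>)}"]) auto
    qed
  next
    case mid
    then obtain s where s: "0 < s" "s < len e" "s \<in> T" by (auto simp: open_edge_def T_def)
    \<comment> \<open>Here \<open>l\<close> is the last and \<open>r\<close> the first parameter in
      \<open>Y\<close>, so \<open>r \<le> l\<close>, possibly with equality. The two points of the
      shell lie on the outer sides and are distinct in any case.\<close>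
    obtain l where l: "l \<in> T" "s \<le> l" "l < len e" "\<forall>t. l < t \<and> t < len e \<longrightarrow> t \<notin> T"
      using last[OF s(3) order_refl s(2) mid(2)] by blast
    obtain r where r: "r \<in> T" "0 < r" "r \<le> s" "\<forall>t. 0 < t \<and> t < r \<longrightarrow> t \<notin> T"
      using first[OF s(3,1) order_refl mid(1)] by blast
    have ex: "exits Y e = 2" using mid T01 by (simp add: exits_def)
    show ?thesis
    proof (rule ev)
      show "0 < min r (len e - l) / 2" using l r by simp
      fix \<epsilon> assume \<epsilon>: "0 < \<epsilon>" "\<epsilon> < min r (len e - l) / 2"
      then have \<epsilon>': "2 * \<epsilon> < r" "2 * \<epsilon> < len e - l" by auto
      have "card {pt e (r - \<epsilon>), pt e (l + \<epsilon>)} = 2" using l r \<epsilon>(1) \<epsilon>' by (intro two) auto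
      then show "\<exists>S. S \<subseteq> shell X Y \<epsilon> \<and> S \<subseteq> open_edge e \<and> card S = exits Y e"
        using right[of l "len e" \<epsilon>] left[of r 0 \<epsilon>] l r \<epsilon>(1) \<epsilon>' ex
        by (intro exI[of _ "{pt e (r - \<epsilon>), pt e (l + \<epsilon>)}"]) auto
    qed
  qed
qed

text \<open>The open edges are disjoint, so the selected points of the shell are counted once.
  Further gaps of \<open>Y\<close> inside an edge only increase \<delta>, and lower bounds on beta
  need just this direction.\<close>

lemma sum_exits_le_delta:
  assumes Y: "subcurve X Y"
  shows "(\<Sum>e\<in>arcs \<Gamma>. exits Y e) \<le> delta X Y"
proof -
  have "\<forall>\<^sub>F \<epsilon> in at_right 0. \<forall>e\<in>arcs \<Gamma>. \<exists>S. S \<subseteq> shell X Y \<epsilon> \<and> S \<subseteq> open_edge e \<and> card S = exits Y e"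
    using exits_le_card[OF Y] by (intro eventually_ball_finite) auto
  with subcurve_shell[OF Y] have "\<forall>\<^sub>F \<epsilon> :: real in at_right 0. ?thesis"
  proof eventually_elim
    case (elim \<epsilon>)
    then obtain S where S: "\<And>e. e \<in> arcs \<Gamma> \<Longrightarrow> S e \<subseteq> shell X Y \<epsilon> \<and> S e \<subseteq> open_edge e \<and> card (S e) = exits Y e"
      by metis
    have fin: "finite (S e)" if "e \<in> arcs \<Gamma>" for e using S[OF that] elim finite_subset by blast
    have "(\<Sum>e\<in>arcs \<Gamma>. exits Y e) = (\<Sum>e\<in>arcs \<Gamma>. card (S e))" using S by (intro sum.cong) auto
    also have "\<dots> = card (\<Union>e\<in>arcs \<Gamma>. S e)"
    proof (rule card_UN_disjoint[symmetric])
      show "\<forall>e\<in>arcs \<Gamma>. \<forall>e'\<in>arcs \<Gamma>. e \<noteq> e' \<longrightarrow> S e \<inter> S e' = {}"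
        using S open_edge_disjoint by blast
    qed (use fin in auto)
    also have "\<dots> \<le> card (shell X Y \<epsilon>)" using S elim by (intro card_mono) auto
    finally show ?case using elim by simp
  qed
  then show ?thesis by simp
qed

end

section \<open>The interpolating rational function\<close>

context curve_model
begin

context
  fixes x :: "nat \<Rightarrow> real"
begin

abbreviation lo :: "nat \<Rightarrow> int" where "lo e \<equiv> \<lfloor>slope x e\<rfloor>"
abbreviation hi :: "nat \<Rightarrow> int" where "hi e \<equiv> \<lceil>slope x e\<rceil>"

definition bends :: "nat set" where "bends = {e \<in> arcs \<Gamma>. lo e \<noteq> hi e}"

text \<open>With \<open>hi = lo + 1\<close>, slope \<open>lo\<close> up to b and slope
  \<open>hi\<close> afterwards give the average \<open>slope x e\<close> exactly for this b. If the
  average is an integer, the value is the default 0.\<close>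

definition bend :: "nat \<Rightarrow> real" where "bend e = len e * (of_int (hi e) - slope x e)"

text \<open>On every edge the slopes \<open>lo\<close> and \<open>hi\<close> are used in increasing order, so that the divisor has
  coefficient \<open>-1\<close>, never \<open>+1\<close>, at the bend; with \<open>+1\<close> the complement of a small interval around the
  bend would have \<open>\<beta> = 0\<close>.\<close>

definition interpolant :: "'a \<Rightarrow> real" where
  "interpolant p = (case the_inv_into points \<phi> p of Vertex v \<Rightarrow> x v
     | Inner e t \<Rightarrow> max (x (tail \<Gamma> e) + of_int (lo e) * t) (x (head \<Gamma> e) - of_int (hi e) * (len e - t)))"

lemma hi_lo: "hi e = lo e + (if lo e = hi e then 0 else 1)"
proof (cases "lo e = hi e")
  case False
  then have "hi e = lo e + 1" by linarith
  then show ?thesis by simp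
qed simp

lemma head_value: "e \<in> arcs \<Gamma> \<Longrightarrow> x (head \<Gamma> e) = x (tail \<Gamma> e) + slope x e * len e"
  using len_pos[of e] by (simp add: slope_def)

lemma interpolant_vt: "v \<in> verts \<Gamma> \<Longrightarrow> interpolant (vt v) = x v"
  by (simp add: interpolant_def the_inv_into_f_f[OF inj_\<phi>])

lemma bend_branches: "e \<in> arcs \<Gamma> \<Longrightarrow>
    (x (tail \<Gamma> e) + of_int (lo e) * t) - (x (head \<Gamma> e) - of_int (hi e) * (len e - t))
      = (of_int (hi e) - of_int (lo e)) * (bend e - t)"
proof -
  assume e: "e \<in> arcs \<Gamma>"
  show ?thesis
  proof (cases "lo e = hi e")
    case True
    then have "slope x e = of_int (hi e)" by linarith
    then show ?thesis using True head_value[OF e] by (simp add: algebra_simps)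
  next
    case False
    then have "hi e = lo e + 1" using hi_lo[of e] by simp
    then show ?thesis using head_value[OF e] by (simp add: bend_def algebra_simps)
  qed
qed

lemma bend_range: "e \<in> arcs \<Gamma> \<Longrightarrow> 0 \<le> bend e \<and> bend e < len e"
  and bend_pos: "e \<in> bends \<Longrightarrow> 0 < bend e"
  and bend_0: "e \<in> arcs \<Gamma> \<Longrightarrow> e \<notin> bends \<Longrightarrow> bend e = 0"
proof -
  show "0 \<le> bend e \<and> bend e < len e" if "e \<in> arcs \<Gamma>"
  proof
    show "0 \<le> bend e" using len_pos[OF that] unfolding bend_def by (intro mult_nonneg_nonneg) linarith+
    have "len e * (of_int (hi e) - slope x e) < len e * 1"
      using len_pos[OF that] by (intro mult_strict_left_mono) linarith+
    then show "bend e < len e" by (simp add: bend_def)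
  qed
  show "0 < bend e" if "e \<in> bends"
  proof -
    have "slope x e < of_int (hi e)" using that unfolding bends_def by (auto simp: less_le) linarith
    then show ?thesis using len_pos[of e] that by (simp add: bend_def bends_def)
  qed
  show "bend e = 0" if "e \<in> arcs \<Gamma>" "e \<notin> bends"
  proof -
    have "lo e = hi e" using that by (simp add: bends_def)
    then have "of_int (hi e) = slope x e" by linarith
    then show ?thesis by (simp add: bend_def)
  qed
qed

lemma interpolant_pt:
  assumes e: "e \<in> arcs \<Gamma>" and t: "t \<in> {0..len e}"
  shows "t \<le> bend e \<Longrightarrow> interpolant (pt e t) = x (tail \<Gamma> e) + of_int (lo e) * t"
    and "bend e \<le> t \<Longrightarrow> interpolant (pt e t) = x (head \<Gamma> e) - of_int (hi e) * (len e - t)"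
proof -
  have lh: "real_of_int (lo e) \<le> of_int (hi e)" by linarith
  have m: "interpolant (pt e t) = max (x (tail \<Gamma> e) + of_int (lo e) * t) (x (head \<Gamma> e) - of_int (hi e) * (len e - t))"
  proof -
    consider "t = 0" | "t = len e" | "0 < t" "t < len e" using t by fastforce
    then show ?thesis
    proof cases
      case 1
      have "0 \<le> (of_int (hi e) - of_int (lo e)) * (bend e - 0)"
        using lh bend_range[OF e] by (intro mult_nonneg_nonneg) auto
      then show ?thesis using bend_branches[OF e, of 0] 1 e by (simp add: interpolant_vt max_def)
    next
      case 2
      have "(of_int (hi e) - of_int (lo e)) * (bend e - len e) \<le> 0"
        using lh bend_range[OF e] by (intro mult_nonneg_nonpos) auto
      then show ?thesis using bend_branches[OF e, of "len e"] 2 e by (simp add: gl_len interpolant_vt max_def)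
    next
      case 3
      then show ?thesis using e by (simp add: interpolant_def gl_inner the_inv_into_f_f[OF inj_\<phi>])
    qed
  qed
  show "interpolant (pt e t) = x (tail \<Gamma> e) + of_int (lo e) * t" if "t \<le> bend e"
  proof -
    have "0 \<le> (of_int (hi e) - of_int (lo e)) * (bend e - t)" using lh that by (intro mult_nonneg_nonneg) auto
    then show ?thesis using m bend_branches[OF e, of t] by (simp add: max_def)
  qed
  show "interpolant (pt e t) = x (head \<Gamma> e) - of_int (hi e) * (len e - t)" if "bend e \<le> t"
  proof -
    have "(of_int (hi e) - of_int (lo e)) * (bend e - t) \<le> 0" using lh that by (intro mult_nonneg_nonpos) auto
    then show ?thesis using m bend_branches[OF e, of t] by (simp add: max_def)
  qed
qed

text \<open>On an edge without a bend the two branches are the same line, so the default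
  \<open>bend e = 0\<close> imposes no restriction on \<open>t\<close>.\<close>

lemma interpolant_near_tail:
  assumes e: "e \<in> arcs \<Gamma>" and t: "t \<in> {0..len e}" and b: "e \<in> bends \<Longrightarrow> t \<le> bend e"
  shows "interpolant (pt e t) = x (tail \<Gamma> e) + of_int (lo e) * t"
proof (cases "e \<in> bends")
  case True
  then show ?thesis using interpolant_pt(1)[OF e t] b by simp
next
  case False
  then have "lo e = hi e" "bend e \<le> t" using e t bend_0[OF e] by (auto simp: bends_def)
  then show ?thesis using interpolant_pt(2)[OF e t] bend_branches[OF e, of t] by simp
qed

lemma interpolant_rational: "rational_function X interpolant"
proof -
  define F where "F = (\<lambda>e. pt e (bend e)) ` bends"
  have "finite F" by (simp add: F_def bends_def)
  moreover have "F \<subseteq> mspace X"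
    using bend_range pt_in by (force simp: F_def bends_def)
  ultimately obtain \<Gamma>' len' \<phi>' where m: "model X \<Gamma>' len' \<phi>'" "F \<union> \<phi> ` Vertex ` verts \<Gamma> \<subseteq> \<phi>' ` Vertex ` verts \<Gamma>'"
    using model_refine[OF model] by metis
  interpret A: curve_model X \<Gamma>' len' \<phi>' by unfold_locales fact
  interpret two_models X \<Gamma>' len' \<phi>' \<Gamma> len \<phi> ..
  have sub: "vt ` verts \<Gamma> \<subseteq> A.vt ` verts \<Gamma>'" "F \<subseteq> A.vt ` verts \<Gamma>'" using m(2) by (auto simp: image_image)
  have "\<exists>k :: int. \<forall>t\<in>{0..len' e'}. interpolant (A.pt e' t) = interpolant (A.pt e' 0) + of_int k * t"
    if e': "e' \<in> arcs \<Gamma>'" for e'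
  proof -
    obtain e \<sigma> c where e: "e \<in> arcs \<Gamma>" "\<sigma> = 1 \<or> \<sigma> = - 1"
      "\<And>s. s \<in> {0..len' e'} \<Longrightarrow> c + \<sigma> * s \<in> {0..len e}"
      "\<And>s. s \<in> {0..len' e'} \<Longrightarrow> A.pt e' s = pt e (c + \<sigma> * s)"
      using edge_affine[OF e' sub(1)] by metis
    \<comment> \<open>The parameter of the bend in the coordinate of \<open>e'\<close>, which may
      lie outside of the edge; \<sigma> is its own inverse.\<close>
    define s0 where "s0 = \<sigma> * (bend e - c)"
    have s0: "c + \<sigma> * s0 = bend e" using e(2) by (auto simp: s0_def)
    have l': "0 < len' e'" using A.len_pos[OF e'] .
    have one: "\<exists>k :: int. \<forall>t\<in>{0..len' e'}. interpolant (A.pt e' t) = interpolant (A.pt e' 0) + of_int k * t"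
      if lin: "\<And>s. s \<in> {0..len' e'} \<Longrightarrow> interpolant (pt e (c + \<sigma> * s)) = r + of_int n * (c + \<sigma> * s)" for r and n :: int
    proof -
      define k where "k = (if \<sigma> = 1 then n else - n)"
      have k: "of_int k = \<sigma> * of_int n" using e(2) by (auto simp: k_def)
      have "interpolant (A.pt e' t) = interpolant (A.pt e' 0) + of_int k * t" if t: "t \<in> {0..len' e'}" for t
      proof -
        have z: "0 \<in> {0..len' e'}" using l' by simp
        show ?thesis unfolding e(4)[OF t] e(4)[OF z] lin[OF t] lin[OF z] k by (simp add: algebra_simps)
      qed
      then show ?thesis by blast
    qed
    have before: ?thesis if "\<And>s. s \<in> {0..len' e'} \<Longrightarrow> e \<in> bends \<Longrightarrow> c + \<sigma> * s \<le> bend e"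
      by (rule one[of "x (tail \<Gamma> e)" "lo e"]) (use interpolant_near_tail[OF e(1) e(3)] that in auto)
    have after: ?thesis if "\<And>s. s \<in> {0..len' e'} \<Longrightarrow> bend e \<le> c + \<sigma> * s"
    proof (rule one[of "x (head \<Gamma> e) - of_int (hi e) * len e" "hi e"])
      fix s assume s: "s \<in> {0..len' e'}"
      show "interpolant (pt e (c + \<sigma> * s)) = x (head \<Gamma> e) - of_int (hi e) * len e + of_int (hi e) * (c + \<sigma> * s)"
        using interpolant_pt(2)[OF e(1) e(3)[OF s] that[OF s]] by (simp add: right_diff_distrib)
    qed
    show ?thesis
    proof (cases "e \<in> bends")
      case False
      then show ?thesis by (intro before) auto
    next
      case True
      \<comment> \<open>The bend was made a vertex of the refined model, hence \<open>e'\<close>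
        lies entirely on one side of it.\<close>
      have "\<not> (0 < s0 \<and> s0 < len' e')"
      proof
        assume s: "0 < s0 \<and> s0 < len' e'"
        then have "A.pt e' s0 \<in> F" using e(4)[of s0] s0 True by (auto simp: F_def)
        then obtain v where "v \<in> verts \<Gamma>'" "A.pt e' s0 = A.vt v" using subsetD[OF sub(2)] by blast
        then show False using A.vt_neq_pt[of v e' s0] e' s by metis
      qed
      then consider "s0 \<le> 0" | "len' e' \<le> s0" by linarith
      then show ?thesis
      proof cases
        case 1
        show ?thesis
        proof (cases "\<sigma> = 1")
          case True
          then show ?thesis using s0 1 by (intro after) auto
        next
          case False
          then show ?thesis using s0 1 e(2) by (intro before) auto
        qed
      next
        case 2
        show ?thesis
        proof (cases "\<sigma> = 1")
          case True
          then show ?thesis using s0 2 by (intro before) auto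
        next
          case False
          then show ?thesis using s0 2 e(2) by (intro after) auto
        qed
      qed
    qed
  qed
  then obtain k where "\<And>e'. e' \<in> arcs \<Gamma>' \<Longrightarrow> \<forall>t\<in>{0..len' e'}. interpolant (A.pt e' t) = interpolant (A.pt e' 0) + of_int (k e') * t"
    by metis
  then have "linear_on_edges \<Gamma>' len' \<phi>' interpolant k" by (simp add: linear_on_edges_def)
  then show ?thesis by (rule A.linear_imp_rational)
qed

text \<open>Close to a head the slope is \<open>hi\<close>, close to a tail it is \<open>lo\<close>.
  The order is read off from small spheres of the given model, although the function is linear only
  on a refinement.\<close>

lemma div_interpolant_vertex:
  assumes v: "v \<in> verts \<Gamma>"
  shows "div_of X interpolant (vt v) = (\<Sum>e\<in>in_arcs \<Gamma> v. hi e) + (\<Sum>e\<in>out_arcs \<Gamma> v. - lo e)"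
proof -
  have "\<forall>\<^sub>F \<epsilon> in at_right 0. 0 < \<epsilon> \<and> \<epsilon> < rad"
    unfolding eventually_at_right_field using rad_pos by (intro exI[of _ rad]) simp
  moreover have "\<forall>\<^sub>F \<epsilon> in at_right 0. \<forall>e\<in>arcs \<Gamma>. (e \<in> bends \<longrightarrow> \<epsilon> < bend e) \<and> \<epsilon> < len e - bend e"
  proof (intro eventually_ball_finite ballI finite_arcs)
    fix e assume e: "e \<in> arcs \<Gamma>"
    show "\<forall>\<^sub>F \<epsilon> in at_right 0. (e \<in> bends \<longrightarrow> \<epsilon> < bend e) \<and> \<epsilon> < len e - bend e"
      unfolding eventually_at_right_field
      using bend_range[OF e] bend_pos[of e]
      by (intro exI[of _ "if e \<in> bends then min (bend e) (len e - bend e) else len e - bend e"]) auto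
  qed
  ultimately have "has_ord X interpolant (vt v) ((\<Sum>e\<in>in_arcs \<Gamma> v. hi e) + (\<Sum>e\<in>out_arcs \<Gamma> v. - lo e))"
    unfolding has_ord_def
  proof eventually_elim
    case (elim \<epsilon>)
    have lt: "\<epsilon> < len e / 2" if "e \<in> arcs \<Gamma>" for e using rad_le[OF that] elim by simp
    have "(\<Sum>p\<in>shell X {vt v} \<epsilon>. interpolant (vt v) - interpolant p)
      = (\<Sum>e\<in>out_arcs \<Gamma> v. x v - interpolant (pt e \<epsilon>)) + (\<Sum>e\<in>in_arcs \<Gamma> v. x v - interpolant (pt e (len e - \<epsilon>)))"
      using sum_shell[OF adapted_vertex[OF v], of \<epsilon> "\<lambda>p. interpolant (vt v) - interpolant p"] elim interpolant_vt[OF v]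
      by (simp add: in_arcs_def out_arcs_def)
    also have "(\<Sum>e\<in>out_arcs \<Gamma> v. x v - interpolant (pt e \<epsilon>)) = (\<Sum>e\<in>out_arcs \<Gamma> v. of_int (- lo e) * \<epsilon>)"
    proof (rule sum.cong)
      fix e assume e: "e \<in> out_arcs \<Gamma> v"
      then have "interpolant (pt e \<epsilon>) = x (tail \<Gamma> e) + of_int (lo e) * \<epsilon>"
        using elim lt[of e] by (intro interpolant_near_tail) (auto simp: out_arcs_def)
      then show "x v - interpolant (pt e \<epsilon>) = of_int (- lo e) * \<epsilon>" using e by (simp add: out_arcs_def)
    qed simp
    also have "(\<Sum>e\<in>in_arcs \<Gamma> v. x v - interpolant (pt e (len e - \<epsilon>))) = (\<Sum>e\<in>in_arcs \<Gamma> v. of_int (hi e) * \<epsilon>)"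
    proof (rule sum.cong)
      fix e assume e: "e \<in> in_arcs \<Gamma> v"
      then have "interpolant (pt e (len e - \<epsilon>)) = x (head \<Gamma> e) - of_int (hi e) * (len e - (len e - \<epsilon>))"
        using elim lt[of e] by (intro interpolant_pt(2)) (force simp: in_arcs_def)+
      then show "x v - interpolant (pt e (len e - \<epsilon>)) = of_int (hi e) * \<epsilon>" using e by (simp add: in_arcs_def)
    qed simp
    finally show ?case unfolding sum_distrib_right[symmetric] of_int_add of_int_sum distrib_right by simp
  qed
  from ord_at_eq[OF interpolant_rational vt_in[OF v] this] show ?thesis using vt_in[OF v] by (simp add: div_of_def)
qed

text \<open>At a bend the incoming slopes are \<open>lo\<close> and \<open>- hi\<close>, with sum
  -1; elsewhere inside the edge they cancel.\<close>

lemma div_interpolant_inner: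
  assumes e: "e \<in> arcs \<Gamma>" and t: "0 < t" "t < len e"
  shows "div_of X interpolant (pt e t) = (if e \<in> bends \<and> t = bend e then - 1 else 0)" (is "_ = ?k")
proof -
  have p: "pt e t \<in> mspace X" using t by (intro pt_in[OF e]) auto
  consider "t < bend e" | "t = bend e" | "bend e < t" by linarith
  then have "\<forall>\<^sub>F \<epsilon> in at_right 0. 2 * interpolant (pt e t) - interpolant (pt e (t - \<epsilon>)) - interpolant (pt e (t + \<epsilon>)) = of_int ?k * \<epsilon>"
  proof cases
    case 1
    show ?thesis
      unfolding eventually_at_right_field
    proof (intro exI[of _ "min t (bend e - t)"] conjI allI impI)
      fix \<epsilon> assume "0 < \<epsilon>" "\<epsilon> < min t (bend e - t)"
      then show "2 * interpolant (pt e t) - interpolant (pt e (t - \<epsilon>)) - interpolant (pt e (t + \<epsilon>)) = of_int ?k * \<epsilon>"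
        using 1 bend_range[OF e] t interpolant_pt(1)[OF e, of t] interpolant_pt(1)[OF e, of "t - \<epsilon>"]
          interpolant_pt(1)[OF e, of "t + \<epsilon>"] by (simp add: algebra_simps)
    qed (use 1 t in auto)
  next
    case 2
    then have b: "e \<in> bends" using bend_0[OF e] t by auto
    then have n: "hi e = lo e + 1" using hi_lo[of e] by (simp add: bends_def)
    have k: "?k = - 1" using b 2 by simp
    show ?thesis
      unfolding eventually_at_right_field k
    proof (intro exI[of _ "min t (len e - t)"] conjI allI impI)
      fix \<epsilon> assume "0 < \<epsilon>" "\<epsilon> < min t (len e - t)"
      then show "2 * interpolant (pt e t) - interpolant (pt e (t - \<epsilon>)) - interpolant (pt e (t + \<epsilon>)) = of_int (- 1) * \<epsilon>"
        using 2 t interpolant_pt[OF e, of t] interpolant_pt(1)[OF e, of "t - \<epsilon>"]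
          interpolant_pt(2)[OF e, of "t + \<epsilon>"] by (simp add: n algebra_simps)
    qed (use t in auto)
  next
    case 3
    show ?thesis
      unfolding eventually_at_right_field
    proof (intro exI[of _ "min (t - bend e) (len e - t)"] conjI allI impI)
      fix \<epsilon> assume "0 < \<epsilon>" "\<epsilon> < min (t - bend e) (len e - t)"
      then show "2 * interpolant (pt e t) - interpolant (pt e (t - \<epsilon>)) - interpolant (pt e (t + \<epsilon>)) = of_int ?k * \<epsilon>"
        using 3 bend_range[OF e] t interpolant_pt(2)[OF e, of t] interpolant_pt(2)[OF e, of "t - \<epsilon>"]
          interpolant_pt(2)[OF e, of "t + \<epsilon>"] by (simp add: algebra_simps)
    qed (use 3 t in auto)
  qed
  from ord_at_eq[OF interpolant_rational p has_ord_inner[OF e t this]] show ?thesis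
    using p by (simp add: div_of_def)
qed

lemma total_shifted_divisor:
  assumes D: "\<And>p. D p \<noteq> 0 \<Longrightarrow> p \<in> vt ` verts \<Gamma>"
  defines "D' \<equiv> \<lambda>p. D p + div_of X interpolant p"
  shows "fin_supp_on (mspace X) D'"
    and "total_on_set D' Y = (\<Sum>v | v \<in> verts \<Gamma> \<and> vt v \<in> Y. D' (vt v)) - int (card {e \<in> bends. pt e (bend e) \<in> Y})"
proof -
  let ?B = "(\<lambda>e. pt e (bend e)) ` bends"
  have bends: "e \<in> arcs \<Gamma>" "0 < bend e" "bend e < len e" if "e \<in> bends" for e
    using that bend_range bend_pos by (auto simp: bends_def)
  have finb: "finite bends" by (simp add: bends_def)
  have inj: "inj_on (\<lambda>e. pt e (bend e)) bends"
  proof (rule inj_onI)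
    fix e e' assume "e \<in> bends" "e' \<in> bends" "pt e (bend e) = pt e' (bend e')"
    then show "e = e'" using pt_eq_iff[of e' "bend e'" e "bend e"] bends[of e] bends[of e'] by simp
  qed
  have npt: "pt e t \<notin> vt ` verts \<Gamma>" if "e \<in> arcs \<Gamma>" "0 < t" "t < len e" for e t
    using vt_neq_pt[OF _ that] by (metis imageE)
  have Dp: "D (pt e t) = 0" if "e \<in> arcs \<Gamma>" "0 < t" "t < len e" for e t
    using D[of "pt e t"] npt[OF that] by metis
  have supp: "p \<in> vt ` verts \<Gamma> \<union> ?B" if "D' p \<noteq> 0" for p
  proof (cases "p \<in> mspace X")
    case True
    then show ?thesis
    proof (cases rule: mspace_cases)
      case (inner e t)
      then have "e \<in> bends \<and> t = bend e"
        using that Dp[of e t] div_interpolant_inner[of e t] by (auto simp: D'_def split: if_splits)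
      then show ?thesis using inner by auto
    qed auto
  next
    case False
    then have "D p = 0" using D[of p] vt_in by auto
    then show ?thesis using that False by (simp add: D'_def div_of_def)
  qed
  have BX: "?B \<subseteq> mspace X" using bends pt_in by (auto simp: less_imp_le)
  show "fin_supp_on (mspace X) D'"
    unfolding fin_supp_on_def
  proof
    show "finite {p. D' p \<noteq> 0}" by (rule finite_subset[of _ "vt ` verts \<Gamma> \<union> ?B"]) (use supp finb in auto)
    show "{p. D' p \<noteq> 0} \<subseteq> mspace X" using supp BX vt_in by blast
  qed
  have "total_on_set D' Y = (\<Sum>p\<in>vt ` {v \<in> verts \<Gamma>. vt v \<in> Y} \<union> (\<lambda>e. pt e (bend e)) ` {e \<in> bends. pt e (bend e) \<in> Y}. D' p)"
    unfolding total_on_set_def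
  proof (rule sum.mono_neutral_left)
    show "{p. p \<in> Y \<and> D' p \<noteq> 0} \<subseteq> vt ` {v \<in> verts \<Gamma>. vt v \<in> Y} \<union> (\<lambda>e. pt e (bend e)) ` {e \<in> bends. pt e (bend e) \<in> Y}"
      using supp by blast
    show "\<forall>p\<in>vt ` {v \<in> verts \<Gamma>. vt v \<in> Y} \<union> (\<lambda>e. pt e (bend e)) ` {e \<in> bends. pt e (bend e) \<in> Y} - {p. p \<in> Y \<and> D' p \<noteq> 0}. D' p = 0"
      by blast
  qed (use finb in simp)
  also have "\<dots> = (\<Sum>p\<in>vt ` {v \<in> verts \<Gamma>. vt v \<in> Y}. D' p) + (\<Sum>p\<in>(\<lambda>e. pt e (bend e)) ` {e \<in> bends. pt e (bend e) \<in> Y}. D' p)"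
  proof (rule sum.union_disjoint)
    show "vt ` {v \<in> verts \<Gamma>. vt v \<in> Y} \<inter> (\<lambda>e. pt e (bend e)) ` {e \<in> bends. pt e (bend e) \<in> Y} = {}"
    proof (rule equals0I)
      fix p assume "p \<in> vt ` {v \<in> verts \<Gamma>. vt v \<in> Y} \<inter> (\<lambda>e. pt e (bend e)) ` {e \<in> bends. pt e (bend e) \<in> Y}"
      then obtain v e where "v \<in> verts \<Gamma>" "p = vt v" "e \<in> bends" "p = pt e (bend e)" by blast
      then show False using vt_neq_pt[of v e "bend e"] bends[of e] by metis
    qed
  qed (use finb in simp_all)
  also have "(\<Sum>p\<in>vt ` {v \<in> verts \<Gamma>. vt v \<in> Y}. D' p) = (\<Sum>v | v \<in> verts \<Gamma> \<and> vt v \<in> Y. D' (vt v))"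
    by (subst sum.reindex) (auto simp: inj_on_def vt_eq_iff)
  also have "(\<Sum>p\<in>(\<lambda>e. pt e (bend e)) ` {e \<in> bends. pt e (bend e) \<in> Y}. D' p) = (\<Sum>e | e \<in> bends \<and> pt e (bend e) \<in> Y. D' (pt e (bend e)))"
    using inj by (subst sum.reindex) (auto intro: inj_on_subset)
  also have "\<dots> = (\<Sum>e | e \<in> bends \<and> pt e (bend e) \<in> Y. - 1)"
    using bends Dp div_interpolant_inner by (intro sum.cong) (auto simp: D'_def)
  finally show "total_on_set D' Y = (\<Sum>v | v \<in> verts \<Gamma> \<and> vt v \<in> Y. D' (vt v)) - int (card {e \<in> bends. pt e (bend e) \<in> Y})"
    by simp
qed

end

end

section \<open>Existence\<close>

context curve_model
begin

lemma sum_div_interpolant: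
  assumes "W \<subseteq> verts \<Gamma>"
  shows "(\<Sum>v\<in>W. div_of X (interpolant x) (vt v))
    = (\<Sum>e\<in>arcs \<Gamma>. (if head \<Gamma> e \<in> W then hi x e else 0) + (if tail \<Gamma> e \<in> W then - lo x e else 0))"
proof -
  have "(\<Sum>v\<in>W. div_of X (interpolant x) (vt v))
      = (\<Sum>v\<in>W. (\<Sum>e\<in>in_arcs \<Gamma> v. hi x e) + (\<Sum>e\<in>out_arcs \<Gamma> v. - lo x e))"
    using assms by (intro sum.cong refl div_interpolant_vertex) auto
  then show ?thesis
    unfolding sum_in_out_arcs[OF assms] by (simp only: sum.distrib sum.inter_filter[OF finite_arcs])
qed

text \<open>The bound of \<open>minimiser_inequality\<close> with \<open>c\<close> independent of
  \<open>x\<close>: later \<open>x\<close> minimises the energy of a perturbed \<open>c\<close>,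
  while the bound on beta concerns the original one.\<close>

definition chip_gain :: "(nat \<Rightarrow> real) \<Rightarrow> (nat \<Rightarrow> real) \<Rightarrow> nat set \<Rightarrow> real" where
  "chip_gain x c W = (\<Sum>v\<in>W. c v)
    + (\<Sum>e | e \<in> arcs \<Gamma> \<and> head \<Gamma> e \<in> W \<and> tail \<Gamma> e \<notin> W. of_int \<lfloor>slope x e\<rfloor> + 1 / 2)
    + (\<Sum>e | e \<in> arcs \<Gamma> \<and> tail \<Gamma> e \<in> W \<and> head \<Gamma> e \<notin> W. 1 / 2 - of_int \<lceil>slope x e\<rceil>)"

text \<open>Both sides are split into contributions of the edges, \<open>g\<close> for the bound and
  \<open>h\<close> for beta with \<delta> replaced by the sum of \<open>exits\<close>. Only the
  vertices of \<open>Y\<close> enter the bound, so it is common to all subcurves with the same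
  vertices.\<close>

lemma beta_ge_chip_gain:
  fixes x :: "nat \<Rightarrow> real"
  assumes Y: "subcurve X Y"
    and D: "\<And>p. D p \<noteq> 0 \<Longrightarrow> p \<in> vt ` verts \<Gamma>" and \<mu>: "\<And>p. \<mu> p \<noteq> 0 \<Longrightarrow> p \<in> vt ` verts \<Gamma>"
  defines "D' \<equiv> \<lambda>p. D p + div_of X (interpolant x) p"
    and "W \<equiv> {v \<in> verts \<Gamma>. vt v \<in> Y}"
    and "c \<equiv> \<lambda>v. of_int (D (vt v)) - \<mu> (vt v)"
  shows "chip_gain x c W \<le> beta X \<mu> D' Y"
    and "\<exists>e\<in>arcs \<Gamma>. tail \<Gamma> e \<in> W \<and> head \<Gamma> e \<in> W \<and> \<not> open_edge e \<subseteq> Y \<Longrightarrow> chip_gain x c W < beta X \<mu> D' Y"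
proof -
  define g :: "nat \<Rightarrow> real" where "g e = (if head \<Gamma> e \<in> W \<and> tail \<Gamma> e \<notin> W then of_int (lo x e) + 1 / 2 else 0)
    + (if tail \<Gamma> e \<in> W \<and> head \<Gamma> e \<notin> W then 1 / 2 - of_int (hi x e) else 0)" for e
  define h :: "nat \<Rightarrow> real" where "h e = of_int ((if head \<Gamma> e \<in> W then hi x e else 0) + (if tail \<Gamma> e \<in> W then - lo x e else 0))
    - (if e \<in> bends x \<and> pt e (bend x e) \<in> Y then 1 else 0) + real (exits Y e) / 2" for e
  have WV: "W \<subseteq> verts \<Gamma>" by (auto simp: W_def)
  have "chip_gain x c W = (\<Sum>v\<in>W. c v) + (\<Sum>e\<in>arcs \<Gamma>. g e)"
    unfolding chip_gain_def g_def sum.distrib[of "\<lambda>e. if head \<Gamma> e \<in> W \<and> tail \<Gamma> e \<notin> W then _ e else _"]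
    by (simp only: sum.inter_filter[OF finite_arcs] add.assoc)
  moreover have "(\<Sum>v\<in>W. c v) + (\<Sum>e\<in>arcs \<Gamma>. h e) \<le> beta X \<mu> D' Y"
  proof -
    have "{e \<in> bends x. pt e (bend x e) \<in> Y} = {e \<in> arcs \<Gamma>. e \<in> bends x \<and> pt e (bend x e) \<in> Y}"
      by (auto simp: bends_def)
    then have "real (card {e \<in> bends x. pt e (bend x e) \<in> Y}) = (\<Sum>e\<in>arcs \<Gamma>. if e \<in> bends x \<and> pt e (bend x e) \<in> Y then 1 else 0)"
      by (simp only: sum.inter_filter[OF finite_arcs, symmetric]) simp
    moreover have "real (\<Sum>e\<in>arcs \<Gamma>. exits Y e) \<le> real (delta X Y)"
      using sum_exits_le_delta[OF Y] by (simp only: of_nat_le_iff)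
    moreover have "total_on_set \<mu> Y = (\<Sum>v\<in>W. \<mu> (vt v))"
      unfolding W_def by (rule total_on_vertices[OF \<mu>])
    moreover have "total_on_set D' Y = (\<Sum>v\<in>W. D (vt v)) + (\<Sum>v\<in>W. div_of X (interpolant x) (vt v))
        - int (card {e \<in> bends x. pt e (bend x e) \<in> Y})"
      using total_shifted_divisor(2)[where D = D and x = x and Y = Y, OF D] by (simp add: D'_def W_def sum.distrib)
    ultimately show ?thesis
      unfolding sum_div_interpolant[OF WV] beta_def degree_on_def h_def c_def
      by (simp add: sum.distrib sum_subtractf sum_divide_distrib[symmetric])
  qed
  \<comment> \<open>With both ends in \<open>W\<close>, \<open>hi - lo\<close> pays for the
    coefficient -1 at a bend, and a missing piece of the edge adds two exits, a surplus of at least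
    1. With one end, the single exit gives the 1/2 and counting the bend at most replaces one of
    \<open>lo\<close>, \<open>hi\<close> by the other. With no end, a bend in \<open>Y\<close>
    forces two exits, which pay for it.\<close>
  moreover have gh: "g e \<le> h e \<and> (tail \<Gamma> e \<in> W \<and> head \<Gamma> e \<in> W \<and> \<not> open_edge e \<subseteq> Y \<longrightarrow> g e < h e)"
    if e: "e \<in> arcs \<Gamma>" for e
  proof -
    have ends: "tail \<Gamma> e \<in> W \<longleftrightarrow> vt (tail \<Gamma> e) \<in> Y" "head \<Gamma> e \<in> W \<longleftrightarrow> vt (head \<Gamma> e) \<in> Y"
      using e by (auto simp: W_def)
    have open_bend: "pt e (bend x e) \<in> open_edge e" if "e \<in> bends x"
      using bend_pos[OF that] bend_range[OF e, of x] by (auto simp: open_edge_def)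
    have hl: "real_of_int (hi x e) = of_int (lo x e) + (if e \<in> bends x then 1 else 0)"
      using hi_lo[of x e] e by (auto simp: bends_def)
    consider "tail \<Gamma> e \<in> W" "head \<Gamma> e \<in> W" | "tail \<Gamma> e \<in> W" "head \<Gamma> e \<notin> W" | "tail \<Gamma> e \<notin> W" "head \<Gamma> e \<in> W"
      | "tail \<Gamma> e \<notin> W" "head \<Gamma> e \<notin> W" by blast
    then show ?thesis
    proof cases
      case 1
      then show ?thesis using ends hl open_bend by (auto simp: g_def h_def exits_def)
    next
      case 2
      then show ?thesis using ends hl by (auto simp: g_def h_def exits_def)
    next
      case 3
      then show ?thesis using ends hl by (auto simp: g_def h_def exits_def)
    next
      case 4
      then show ?thesis using ends hl open_bend by (auto simp: g_def h_def exits_def)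
    qed
  qed
  moreover have "(\<Sum>e\<in>arcs \<Gamma>. g e) \<le> (\<Sum>e\<in>arcs \<Gamma>. h e)"
    using gh by (intro sum_mono) blast
  moreover have "(\<Sum>e\<in>arcs \<Gamma>. g e) < (\<Sum>e\<in>arcs \<Gamma>. h e)"
    if "\<exists>e\<in>arcs \<Gamma>. tail \<Gamma> e \<in> W \<and> head \<Gamma> e \<in> W \<and> \<not> open_edge e \<subseteq> Y"
    using gh that by (intro sum_strict_mono_ex1 finite_arcs) blast+
  ultimately show "chip_gain x c W \<le> beta X \<mu> D' Y"
    and "\<exists>e\<in>arcs \<Gamma>. tail \<Gamma> e \<in> W \<and> head \<Gamma> e \<in> W \<and> \<not> open_edge e \<subseteq> Y \<Longrightarrow> chip_gain x c W < beta X \<mu> D' Y"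
    by linarith+
qed

text \<open>The vertices collect \<open>hi - lo\<close> from every edge, which is 1 exactly on the
  edges that bend and is cancelled by the coefficient -1 at the bend.\<close>

lemma degree_shifted_divisor:
  assumes D: "\<And>p. D p \<noteq> 0 \<Longrightarrow> p \<in> vt ` verts \<Gamma>"
  shows "degree_div X (\<lambda>p. D p + div_of X (interpolant x) p) = degree_div X D"
proof -
  have V: "{v. v \<in> verts \<Gamma> \<and> vt v \<in> mspace X} = verts \<Gamma>" using vt_in by blast
  have "pt e (bend x e) \<in> mspace X" if "e \<in> bends x" for e
    using that bend_range[of e x] by (intro pt_in) (auto simp: bends_def)
  then have B: "{e \<in> bends x. pt e (bend x e) \<in> mspace X} = bends x" by blast
  have "(\<Sum>v\<in>verts \<Gamma>. div_of X (interpolant x) (vt v)) = (\<Sum>e\<in>arcs \<Gamma>. hi x e - lo x e)"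
    unfolding sum_div_interpolant[OF order_refl] by (intro sum.cong) auto
  also have "\<dots> = (\<Sum>e\<in>arcs \<Gamma>. if e \<in> bends x then 1 else 0)"
  proof (rule sum.cong)
    fix e assume "e \<in> arcs \<Gamma>"
    then show "hi x e - lo x e = (if e \<in> bends x then 1 else 0)"
      using hi_lo[of x e] by (cases "lo x e = hi x e") (simp_all add: bends_def)
  qed simp
  also have "\<dots> = int (card (bends x))"
    by (simp add: bends_def sum.If_cases Int_def conj_commute)
  finally show ?thesis
    using total_shifted_divisor(2)[where D = D and x = x and Y = "mspace X", OF D] total_on_vertices[where g = D and Y = "mspace X", OF D]
    unfolding V B by (simp add: degree_div_def degree_on_def sum.distrib)
qed

lemma exists_quasistable:
  assumes D: "\<And>p. D p \<noteq> 0 \<Longrightarrow> p \<in> vt ` verts \<Gamma>" and \<mu>: "\<And>p. \<mu> p \<noteq> 0 \<Longrightarrow> p \<in> vt ` verts \<Gamma>"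
    and deg: "(\<Sum>v\<in>verts \<Gamma>. of_int (D (vt v)) - \<mu> (vt v)) = 0" and v0: "v0 \<in> verts \<Gamma>"
  shows "\<exists>D'. divisor X D' \<and> degree_div X D' = degree_div X D \<and> equivalent X D' D \<and> quasistable X (vt v0) \<mu> D'"
proof -
  define c where "c v = of_int (D (vt v)) - \<mu> (vt v)" for v
  \<comment> \<open>The values of \<mu> on vertex sets are the only non-integral data in the bounds,
    so one gap \<eta> serves for all sets.\<close>
  have "finite ((\<lambda>W. \<Sum>v\<in>W. \<mu> (vt v)) ` Pow (verts \<Gamma>))" by simp
  then obtain \<eta> where \<eta>: "0 < \<eta>"
    "\<And>r k. r \<in> (\<lambda>W. \<Sum>v\<in>W. \<mu> (vt v)) ` Pow (verts \<Gamma>) \<Longrightarrow> - \<eta> \<le> of_int k / 2 - r \<Longrightarrow> 0 \<le> of_int k / 2 - r"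
    using discrete_gap by metis
  define m where "m = real (card (verts \<Gamma>))"
  have m: "0 < m" using verts_nonempty by (simp add: m_def card_gt_0_iff)
  \<comment> \<open>Moving a small amount of the polarization to \<open>v0\<close> makes the inequality strict for the sets
    containing \<open>v0\<close>; for the others, the error is absorbed because \<open>\<beta>\<close> takes discrete values.\<close>
  define c' where "c' v = c v - \<eta> * ((if v = v0 then 1 else 0) - 1 / m)" for v
  have sum_c': "(\<Sum>v\<in>W. c' v) = (\<Sum>v\<in>W. c v) - \<eta> * ((if v0 \<in> W then 1 else 0) - card W / m)" if "W \<subseteq> verts \<Gamma>" for W
  proof -
    have "finite W" using that finite_subset[OF _ finite_verts] by auto
    then show ?thesis by (simp add: c'_def sum_subtractf sum_distrib_left[symmetric])
  qed
  have "(\<Sum>v\<in>verts \<Gamma>. c' v) = 0"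
    using sum_c'[OF order_refl] deg v0 m verts_nonempty by (simp add: c_def m_def)
  then obtain x where x: "\<And>y. energy c' x \<le> energy c' y" using energy_minimiser by metis
  \<comment> \<open>The term on the left is at least \<open>- \<eta>\<close> for every
    \<open>W\<close>, and it is positive if \<open>W\<close> contains \<open>v0\<close> and is a
    proper subset of the vertices.\<close>
  have gain: "\<eta> * ((if v0 \<in> W then 1 else 0) - card W / m) \<le> chip_gain x c W" if "W \<subseteq> verts \<Gamma>" for W
    using minimiser_inequality[OF x that] sum_c'[OF that] by (simp add: chip_gain_def)
  have card_le: "card W / m \<le> 1" if "W \<subseteq> verts \<Gamma>" for W
    using card_mono[OF finite_verts that] m by (simp add: m_def)
  have nonneg: "0 \<le> chip_gain x c W" if W: "W \<subseteq> verts \<Gamma>" for W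
  proof -
    \<comment> \<open>Twice the part of \<open>chip_gain\<close> that does not come from \<mu>; it
      is an integer, as \<open>discrete_gap\<close> demands.\<close>
    define k where "k = 2 * (\<Sum>v\<in>W. D (vt v)) + (\<Sum>e | e \<in> arcs \<Gamma> \<and> head \<Gamma> e \<in> W \<and> tail \<Gamma> e \<notin> W. 2 * lo x e + 1)
      + (\<Sum>e | e \<in> arcs \<Gamma> \<and> tail \<Gamma> e \<in> W \<and> head \<Gamma> e \<notin> W. 1 - 2 * hi x e)"
    have "(\<Sum>e\<in>S. of_int (lo x e) + 1 / 2) = real_of_int (\<Sum>e\<in>S. 2 * lo x e + 1) / 2"
      "(\<Sum>e\<in>S. 1 / 2 - of_int (hi x e)) = real_of_int (\<Sum>e\<in>S. 1 - 2 * hi x e) / 2" for S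
      unfolding of_int_sum sum_divide_distrib by (intro sum.cong; simp add: field_simps)+
    then have k: "chip_gain x c W = of_int k / 2 - (\<Sum>v\<in>W. \<mu> (vt v))"
      unfolding chip_gain_def k_def c_def by (simp only: sum_subtractf) (simp add: add_divide_distrib)
    have "- \<eta> \<le> \<eta> * ((if v0 \<in> W then 1 else 0) - card W / m)"
    proof -
      have "- 1 \<le> (if v0 \<in> W then 1 else 0) - card W / m" using card_le[OF W] by (cases "v0 \<in> W") simp_all
      then show ?thesis using mult_left_mono[of "- 1" _ \<eta>] \<eta>(1) by fastforce
    qed
    then have "- \<eta> \<le> chip_gain x c W" using gain[OF W] by linarith
    then show ?thesis using \<eta>(2)[of "\<Sum>v\<in>W. \<mu> (vt v)" k] W k by auto
  qed
  have pos: "0 < chip_gain x c W" if W: "W \<subseteq> verts \<Gamma>" "v0 \<in> W" "W \<noteq> verts \<Gamma>" for W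
  proof -
    have "card W < card (verts \<Gamma>)" using W by (intro psubset_card_mono) auto
    then have "card W / m < 1" using m by (simp add: m_def)
    then have "0 < \<eta> * (1 - card W / m)" using \<eta>(1) by simp
    then show ?thesis using gain[OF W(1)] W(2) by simp
  qed
  define D' where "D' p = D p + div_of X (interpolant x) p" for p
  have "quasistable X (vt v0) \<mu> D'"
    unfolding quasistable_def
  proof (intro conjI allI impI)
    fix Y assume Y: "subcurve X Y"
    show "0 \<le> beta X \<mu> D' Y"
      using beta_ge_chip_gain(1)[where D = D and \<mu> = \<mu> and x = x, OF Y D \<mu>] nonneg[of "{v \<in> verts \<Gamma>. vt v \<in> Y}"]
      by (force simp: D'_def[abs_def] c_def[abs_def])
  next
    fix Y assume Y: "subcurve X Y \<and> Y \<noteq> mspace X \<and> vt v0 \<in> Y"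
    let ?W = "{v \<in> verts \<Gamma>. vt v \<in> Y}"
    note ge = beta_ge_chip_gain[where D = D and \<mu> = \<mu> and x = x, OF conjunct1[OF Y] D \<mu>, folded c_def[abs_def] D'_def[abs_def]]
    have YX: "Y \<subseteq> mspace X" using subcurve_subset Y by blast
    show "0 < beta X \<mu> D' Y"
    proof (cases "?W = verts \<Gamma>")
      case False
      then show ?thesis using ge(1) pos[of ?W] Y v0 by force
    next
      case True
      \<comment> \<open>For the full vertex set \<open>chip_gain\<close> is 0, so strictness has to
        come from an edge of which \<open>Y\<close> misses a piece.\<close>
      have "\<exists>e\<in>arcs \<Gamma>. \<not> open_edge e \<subseteq> Y"
      proof (rule ccontr)
        assume *: "\<not> ?thesis"
        have "p \<in> Y" if "p \<in> mspace X" for p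
          using that
        proof (cases rule: mspace_cases)
          case (inner e t)
          then have "p \<in> open_edge e" by (simp add: open_edge_def)
          then show ?thesis using * inner(1) by blast
        qed (use True in auto)
        then show False using Y YX by blast
      qed
      then obtain e where "e \<in> arcs \<Gamma>" "\<not> open_edge e \<subseteq> Y" by blast
      then have "\<exists>e\<in>arcs \<Gamma>. tail \<Gamma> e \<in> ?W \<and> head \<Gamma> e \<in> ?W \<and> \<not> open_edge e \<subseteq> Y"
        using True tail_in_verts head_in_verts by blast
      then have "chip_gain x c ?W < beta X \<mu> D' Y" by (intro ge(2))
      then show ?thesis using nonneg[of ?W] by simp
    qed
  qed
  moreover have "divisor X D'"
    using total_shifted_divisor(1)[where D = D and x = x, OF D] by (simp add: divisor_def D'_def[abs_def])
  moreover have "degree_div X D' = degree_div X D"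
    using degree_shifted_divisor[where D = D and x = x, OF D] by (simp add: D'_def[abs_def])
  moreover have "equivalent X D' D"
    unfolding equivalent_def using interpolant_rational[of x] by (intro exI[of _ "interpolant x"]) (simp add: D'_def)
  ultimately show ?thesis by blast
qed

end

theorem theorem5p6:
  fixes X :: "'a metric" and p0 :: 'a and d :: int and \<mu> :: "'a \<Rightarrow> real" and D :: "'a \<Rightarrow> int"
  assumes "tropical_curve X"
    and "p0 \<in> mspace X"
    and "polarization X d \<mu>"
    and "divisor X D"
    and "degree_div X D = d"
  shows "\<exists>!D'. divisor X D' \<and> degree_div X D' = d \<and> equivalent X D' D \<and> quasistable X p0 \<mu> D'"
proof (rule ex_ex1I)
  obtain \<Gamma>' len' \<phi>' where m': "model X \<Gamma>' len' \<phi>'" using assms(1) by (auto simp: tropical_curve_def)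
  let ?F = "{p0} \<union> {p. D p \<noteq> 0} \<union> {p. \<mu> p \<noteq> 0}"
  have "finite ?F" "?F \<subseteq> mspace X"
    using assms(2-4) by (auto simp: divisor_def polarization_def fin_supp_on_def)
  then obtain \<Gamma> len \<phi> where m: "model X \<Gamma> len \<phi>" "?F \<union> \<phi>' ` Vertex ` verts \<Gamma>' \<subseteq> \<phi> ` Vertex ` verts \<Gamma>"
    using model_refine[OF m'] by metis
  interpret curve_model X \<Gamma> len \<phi> by unfold_locales fact
  have supp: "p \<in> vt ` verts \<Gamma>" if "p \<in> ?F" for p using m(2) that by (auto simp: image_image)
  then obtain v0 where v0: "v0 \<in> verts \<Gamma>" "p0 = vt v0" by blast
  have "{v \<in> verts \<Gamma>. vt v \<in> mspace X} = verts \<Gamma>" using vt_in by blast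
  then have "(\<Sum>v\<in>verts \<Gamma>. D (vt v)) = d" "(\<Sum>v\<in>verts \<Gamma>. \<mu> (vt v)) = of_int d"
    using total_on_vertices[of D "mspace X"] total_on_vertices[of \<mu> "mspace X"] supp assms(3,5)
    by (auto simp: degree_div_def degree_on_def polarization_def)
  then have "(\<Sum>v\<in>verts \<Gamma>. of_int (D (vt v)) - \<mu> (vt v)) = 0"
    by (simp add: sum_subtractf flip: of_int_sum)
  then show "\<exists>D'. divisor X D' \<and> degree_div X D' = d \<and> equivalent X D' D \<and> quasistable X p0 \<mu> D'"
    using exists_quasistable[of D \<mu> v0] supp v0 assms(5) by auto
qed (use equivalent_unique[OF assms(1-3)] in blast)

end
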